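(* Let $0\le s\le r\le\omega$ and let $k,\ell\ge 0$ be integers. The space $\mathcal S^{r,s}_{k,\ell}$ of $k$-solenoids of class $C^{r,s}$ and transversal dimension $\ell$, ordered by inclusion, has minimal elements.
   Context: Each of $r,s$ is a non-negative integer, $\infty$ or $\omega$ ($C^\omega$ = analytic), $s\le r$. A map $X(x,y)$ on an open subset of $\mathbb R^k\times\mathbb R^\ell$ is of class $C^{r,s}$ if it is $C^r$ in the leaf variable $x$ and $C^s$ in the transversal variable $y$: the partial derivatives $\partial_x^\alpha\partial_y^\beta X$ with $|\beta|\le s$, $|\alpha|+|\beta|\le r$ exist and are continuous (with the usual interpretation for $\infty,\omega$). A foliated manifold $W$ (dimension $k+\ell$, $k$-dimensional leaves, class $C^{r,s}$) is a manifold of dimension $k+\ell$ with an atlas of charts $\varphi_i:U_i\to\mathbb R^k\times\mathbb R^\ell$ whose transition maps have the form $(x,y)\mapsto (X_{ij}(x,y),Y_{ij}(y))$ with $Y_{ij}$ of class $C^s$ and $X_{ij}$ of class $C^{r,s}$; its leaves are the leaves of the corresponding foliation. A regular map between foliated manifolds is a continuous map locally of the form $(X(x,y),Y(y))$ in such charts with $X$ of class $C^{r,s}$, $Y$ of class $C^s$; a diffeomorphism is a homeomorphism regular in both directions. A pre-solenoid $(S,W)$ consists of a foliated manifold $W$ and a non-empty compact subspace $S\subset W$ which is a union of leaves of $W$. Two pre-solenoids $(S,W_1),(S,W_2)$ are equivalent if there are open sets $U_i\subset W_i$ containing $S$ and a diffeomorphism $U_1\to U_2$ which is the identity on $S$.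 A $k$-solenoid of class $C^{r,s}$ and transversal dimension $\ell$ is an equivalence class of pre-solenoids; it is denoted $S$, and $W$ is said to define its solenoid structure. A leaf of $S$ is a leaf of $W$ contained in $S$. The order: $S\subset S'$ means that $S$ is a subset of $S'$ which is a union of leaves of $S'$, with the solenoid structure given by a foliated manifold defining that of $S'$. *)

theory Defs
  imports "HOL-Analysis.Analysis"
begin

section \<open>Differentiability classes\<close>

datatype smoothness = Fin nat | Infty | Omega

instantiation smoothness :: linorder
begin

fun less_eq_smoothness :: "smoothness \<Rightarrow> smoothness \<Rightarrow> bool" where
  "Fin m \<le> Fin n \<longleftrightarrow> m \<le> n"
| "Fin m \<le> Infty \<longleftrightarrow> True"
| "Infty \<le> Infty \<longleftrightarrow> True"
| "(x :: smoothness) \<le> Omega \<longleftrightarrow> True"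
| "(x :: smoothness) \<le> y \<longleftrightarrow> False"

definition less_smoothness :: "smoothness \<Rightarrow> smoothness \<Rightarrow> bool" where
  "less_smoothness x y \<longleftrightarrow> x \<le> y \<and> \<not> y \<le> x"

instance
proof
  fix x y z :: smoothness
  show "x < y \<longleftrightarrow> x \<le> y \<and> \<not> y \<le> x" by (rule less_smoothness_def)
  show "x \<le> x" by (cases x) auto
  show "x \<le> y \<Longrightarrow> y \<le> z \<Longrightarrow> x \<le> z" by (cases x; cases y; cases z) auto
  show "x \<le> y \<Longrightarrow> y \<le> x \<Longrightarrow> x = y" by (cases x; cases y) auto
  show "x \<le> y \<or> y \<le> x" by (cases x; cases y) auto
qed

end

text \<open>
  Dimensions may be 0, so \<open>\<real>\<^sup>n\<close> is the space \<open>Euclidean_space n\<close> of sequences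
  vanishing from index \<open>n\<close> on, and a multi-index for \<open>\<real>\<^sup>n\<close> likewise vanishes from index \<open>n\<close> on.
\<close>

type_synonym point = "nat \<Rightarrow> real"

definition multi :: "nat \<Rightarrow> (nat \<Rightarrow> nat) set" where
  "multi n = {\<alpha>. \<forall>i\<ge>n. \<alpha> i = 0}"

definition mdeg :: "nat \<Rightarrow> (nat \<Rightarrow> nat) \<Rightarrow> nat" where
  "mdeg n \<alpha> = (\<Sum>i<n. \<alpha> i)"

definition mpow :: "nat \<Rightarrow> point \<Rightarrow> (nat \<Rightarrow> nat) \<Rightarrow> real" where
  "mpow n x \<alpha> = (\<Prod>i<n. x i ^ \<alpha> i)"

definition bump :: "(nat \<Rightarrow> nat) \<Rightarrow> nat \<Rightarrow> nat \<Rightarrow> nat" where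
  "bump \<alpha> i = \<alpha>(i := Suc (\<alpha> i))"

definition analytic_fun :: "nat \<Rightarrow> point set \<Rightarrow> (point \<Rightarrow> real) \<Rightarrow> bool" where
  "analytic_fun n V f \<longleftrightarrow>
     (\<forall>p\<in>V. \<exists>e>0. \<exists>c. \<forall>x\<in>V. (\<forall>i<n. \<bar>x i - p i\<bar> < e) \<longrightarrow>
        ((\<lambda>\<alpha>. c \<alpha> * mpow n (\<lambda>i. x i - p i) \<alpha>) has_sum f x) (multi n))"

definition analytic_fun2 ::
    "nat \<Rightarrow> nat \<Rightarrow> (point \<times> point) set \<Rightarrow> (point \<times> point \<Rightarrow> real) \<Rightarrow> bool" where
  "analytic_fun2 k l \<Omega> f \<longleftrightarrow>
     (\<forall>(p, q)\<in>\<Omega>. \<exists>e>0. \<exists>c. \<forall>(x, y)\<in>\<Omega>.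
        (\<forall>i<k. \<bar>x i - p i\<bar> < e) \<and> (\<forall>j<l. \<bar>y j - q j\<bar> < e) \<longrightarrow>
        ((\<lambda>(\<alpha>, \<beta>). c \<alpha> \<beta> * mpow k (\<lambda>i. x i - p i) \<alpha> * mpow l (\<lambda>j. y j - q j) \<beta>)
           has_sum f (x, y)) (multi k \<times> multi l))"

abbreviation prod_Euclidean :: "nat \<Rightarrow> nat \<Rightarrow> (point \<times> point) topology" where
  "prod_Euclidean k l \<equiv> prod_topology (Euclidean_space k) (Euclidean_space l)"

text \<open>
  \<open>D \<beta>\<close> is the partial derivative of \<open>f\<close> of multi-index \<open>\<beta>\<close>, for \<open>\<bar>\<beta>\<bar> \<le> s\<close>.
\<close>

definition partials :: "nat \<Rightarrow> smoothness \<Rightarrow> point set \<Rightarrow> (point \<Rightarrow> real)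
    \<Rightarrow> ((nat \<Rightarrow> nat) \<Rightarrow> point \<Rightarrow> real) \<Rightarrow> bool" where
  "partials n s V f D \<longleftrightarrow>
     (\<forall>y\<in>V. D (\<lambda>_. 0) y = f y) \<and>
     (\<forall>\<beta>\<in>multi n. Fin (mdeg n \<beta>) \<le> s \<longrightarrow>
        continuous_map (subtopology (Euclidean_space n) V) euclideanreal (D \<beta>) \<and>
        (\<forall>j<n. Fin (mdeg n (bump \<beta> j)) \<le> s \<longrightarrow>
          (\<forall>y\<in>V. ((\<lambda>t. D \<beta> (y(j := t))) has_real_derivative D (bump \<beta> j) y) (at (y j)))))"

definition C_fun :: "nat \<Rightarrow> smoothness \<Rightarrow> point set \<Rightarrow> (point \<Rightarrow> real) \<Rightarrow> bool" where
  "C_fun n s V f \<longleftrightarrow>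
     (\<exists>D. partials n s V f D) \<and> (s = Omega \<longrightarrow> analytic_fun n V f)"

text \<open>
  \<open>D \<alpha> \<beta>\<close> is the partial derivative of order \<open>\<alpha>\<close> in the leaf variable \<open>x\<close> and \<open>\<beta>\<close> in the
  transversal variable \<open>y\<close>, for the multi-indices with \<open>\<bar>\<beta>\<bar> \<le> s\<close> and \<open>\<bar>\<alpha>\<bar> + \<bar>\<beta>\<bar> \<le> r\<close>. As these
  derivatives are continuous, they do not depend on the order of differentiation.
\<close>

definition rs_index ::
    "nat \<Rightarrow> nat \<Rightarrow> smoothness \<Rightarrow> smoothness \<Rightarrow> (nat \<Rightarrow> nat) \<Rightarrow> (nat \<Rightarrow> nat) \<Rightarrow> bool" where
  "rs_index k l r s \<alpha> \<beta> \<longleftrightarrow> Fin (mdeg l \<beta>) \<le> s \<and> Fin (mdeg k \<alpha> + mdeg l \<beta>) \<le> r"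

definition rs_partials :: "nat \<Rightarrow> nat \<Rightarrow> smoothness \<Rightarrow> smoothness
    \<Rightarrow> (point \<times> point) set \<Rightarrow> (point \<times> point \<Rightarrow> real)
    \<Rightarrow> ((nat \<Rightarrow> nat) \<Rightarrow> (nat \<Rightarrow> nat) \<Rightarrow> point \<times> point \<Rightarrow> real) \<Rightarrow> bool" where
  "rs_partials k l r s \<Omega> f D \<longleftrightarrow>
     (\<forall>p\<in>\<Omega>. D (\<lambda>_. 0) (\<lambda>_. 0) p = f p) \<and>
     (\<forall>\<alpha>\<in>multi k. \<forall>\<beta>\<in>multi l. rs_index k l r s \<alpha> \<beta> \<longrightarrow>
        continuous_map (subtopology (prod_Euclidean k l) \<Omega>) euclideanreal (D \<alpha> \<beta>) \<and>
        (\<forall>i<k. rs_index k l r s (bump \<alpha> i) \<beta> \<longrightarrow>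
          (\<forall>(x, y)\<in>\<Omega>. ((\<lambda>t. D \<alpha> \<beta> (x(i := t), y))
             has_real_derivative D (bump \<alpha> i) \<beta> (x, y)) (at (x i)))) \<and>
        (\<forall>j<l. rs_index k l r s \<alpha> (bump \<beta> j) \<longrightarrow>
          (\<forall>(x, y)\<in>\<Omega>. ((\<lambda>t. D \<alpha> \<beta> (x, y(j := t)))
             has_real_derivative D \<alpha> (bump \<beta> j) (x, y)) (at (y j)))))"

text \<open>
  For \<open>r = \<omega>\<close> and \<open>s < \<omega>\<close>, the function and its admissible transversal derivatives
  are in addition analytic in the leaf variable; for \<open>r = s = \<omega>\<close>, the function is jointly analytic.
\<close>

definition C_rs_fun :: "nat \<Rightarrow> nat \<Rightarrow> smoothness \<Rightarrow> smoothness
    \<Rightarrow> (point \<times> point) set \<Rightarrow> (point \<times> point \<Rightarrow> real) \<Rightarrow> bool" where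
  "C_rs_fun k l r s \<Omega> f \<longleftrightarrow>
     (\<exists>D. rs_partials k l r s \<Omega> f D \<and>
        (r = Omega \<longrightarrow> (\<forall>\<beta>\<in>multi l. Fin (mdeg l \<beta>) \<le> s \<longrightarrow>
           (\<forall>y. analytic_fun k {x. (x, y) \<in> \<Omega>} (\<lambda>x. D (\<lambda>_. 0) \<beta> (x, y)))))) \<and>
     (s = Omega \<longrightarrow> analytic_fun2 k l \<Omega> f)"

text \<open>Maps of the form \<open>(x, y) \<mapsto> (X(x, y), Y(y))\<close> with \<open>X\<close> of class \<open>C\<^bsup>r,s\<^esup>\<close> and \<open>Y\<close> of class \<open>C\<^sup>s\<close>.\<close>

definition fol_form :: "nat \<Rightarrow> nat \<Rightarrow> smoothness \<Rightarrow> smoothness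
    \<Rightarrow> (point \<times> point) set \<Rightarrow> (point \<times> point \<Rightarrow> point \<times> point) \<Rightarrow> bool" where
  "fol_form k l r s \<Omega> f \<longleftrightarrow>
     (\<exists>X Y. (\<forall>(x, y)\<in>\<Omega>. f (x, y) = (X (x, y), Y y)) \<and>
        (\<forall>i<k. C_rs_fun k l r s \<Omega> (\<lambda>p. X p i)) \<and>
        (\<forall>j<l. C_fun l s (snd ` \<Omega>) (\<lambda>y. Y y j)))"


section \<open>Foliated manifolds\<close>

text \<open>
  A chart is a pair \<open>(U, \<phi>)\<close>; only the values of \<open>\<phi>\<close> on \<open>U\<close> matter.
\<close>

type_synonym 'a chart = "'a set \<times> ('a \<Rightarrow> point \<times> point)"

record 'a foliated =
  fol_top :: "'a topology"
  fol_atlas :: "'a chart set"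

definition foliated_manifold ::
    "nat \<Rightarrow> nat \<Rightarrow> smoothness \<Rightarrow> smoothness \<Rightarrow> 'a foliated \<Rightarrow> bool" where
  "foliated_manifold k l r s W \<longleftrightarrow>
     Hausdorff_space (fol_top W) \<and> second_countable (fol_top W) \<and>
     (\<Union>(U, \<phi>)\<in>fol_atlas W. U) = topspace (fol_top W) \<and>
     (\<forall>(U, \<phi>)\<in>fol_atlas W.
        openin (fol_top W) U \<and> openin (prod_Euclidean k l) (\<phi> ` U) \<and>
        homeomorphic_map (subtopology (fol_top W) U)
          (subtopology (prod_Euclidean k l) (\<phi> ` U)) \<phi>) \<and>
     (\<forall>(U, \<phi>)\<in>fol_atlas W. \<forall>(V, \<psi>)\<in>fol_atlas W.
        fol_form k l r s (\<phi> ` (U \<inter> V)) (\<psi> \<circ> inv_into U \<phi>))"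

definition fol_restrict :: "'a foliated \<Rightarrow> 'a set \<Rightarrow> 'a foliated" where
  "fol_restrict W U =
     \<lparr>fol_top = subtopology (fol_top W) U,
      fol_atlas = (\<lambda>(V, \<phi>). (V \<inter> U, \<phi>)) ` fol_atlas W\<rparr>"

definition regular_map :: "nat \<Rightarrow> nat \<Rightarrow> smoothness \<Rightarrow> smoothness
    \<Rightarrow> 'a foliated \<Rightarrow> 'b foliated \<Rightarrow> ('a \<Rightarrow> 'b) \<Rightarrow> bool" where
  "regular_map k l r s W W' f \<longleftrightarrow>
     continuous_map (fol_top W) (fol_top W') f \<and>
     (\<forall>p\<in>topspace (fol_top W).
        \<exists>(U, \<phi>)\<in>fol_atlas W. \<exists>(V, \<psi>)\<in>fol_atlas W'. \<exists>N.
          openin (fol_top W) N \<and> p \<in> N \<and> N \<subseteq> U \<and> f ` N \<subseteq> V \<and>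
          fol_form k l r s (\<phi> ` N) (\<psi> \<circ> f \<circ> inv_into U \<phi>))"

definition fol_diffeo :: "nat \<Rightarrow> nat \<Rightarrow> smoothness \<Rightarrow> smoothness
    \<Rightarrow> 'a foliated \<Rightarrow> 'b foliated \<Rightarrow> ('a \<Rightarrow> 'b) \<Rightarrow> bool" where
  "fol_diffeo k l r s W W' f \<longleftrightarrow>
     (\<exists>g. homeomorphic_maps (fol_top W) (fol_top W') f g \<and>
        regular_map k l r s W W' f \<and> regular_map k l r s W' W g)"

text \<open>
  The plaques of a chart \<open>(U, \<phi>)\<close> are the connected components of the level sets in \<open>U\<close> of the
  transversal coordinate; leaves are the classes of points joined by a finite chain of plaques.
\<close>

definition same_plaque :: "'a foliated \<Rightarrow> 'a \<Rightarrow> 'a \<Rightarrow> bool" where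
  "same_plaque W p q \<longleftrightarrow>
     (\<exists>(U, \<phi>)\<in>fol_atlas W. p \<in> U \<and>
        connected_component_of
          (subtopology (fol_top W) {z \<in> U. snd (\<phi> z) = snd (\<phi> p)}) p q)"

definition leaf_through :: "'a foliated \<Rightarrow> 'a \<Rightarrow> 'a set" where
  "leaf_through W p = {q. (same_plaque W)\<^sup>*\<^sup>* p q}"

definition leaves :: "'a foliated \<Rightarrow> 'a set set" where
  "leaves W = leaf_through W ` topspace (fol_top W)"


section \<open>Solenoids\<close>

definition pre_solenoid :: "nat \<Rightarrow> nat \<Rightarrow> smoothness \<Rightarrow> smoothness
    \<Rightarrow> 'a set \<times> 'a foliated \<Rightarrow> bool" where
  "pre_solenoid k l r s = (\<lambda>(S, W).
     foliated_manifold k l r s W \<and> S \<noteq> {} \<and> compactin (fol_top W) S \<and>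
     (\<exists>\<L>\<subseteq>leaves W. S = \<Union>\<L>))"

definition solenoid_equiv :: "nat \<Rightarrow> nat \<Rightarrow> smoothness \<Rightarrow> smoothness
    \<Rightarrow> (('a set \<times> 'a foliated) \<times> ('a set \<times> 'a foliated)) set" where
  "solenoid_equiv k l r s =
     {((S, W\<^sub>1), (S', W\<^sub>2)).
        pre_solenoid k l r s (S, W\<^sub>1) \<and> pre_solenoid k l r s (S', W\<^sub>2) \<and> S = S' \<and>
        (\<exists>U\<^sub>1 U\<^sub>2 f. openin (fol_top W\<^sub>1) U\<^sub>1 \<and> openin (fol_top W\<^sub>2) U\<^sub>2 \<and> S \<subseteq> U\<^sub>1 \<and> S \<subseteq> U\<^sub>2 \<and>
           fol_diffeo k l r s (fol_restrict W\<^sub>1 U\<^sub>1) (fol_restrict W\<^sub>2 U\<^sub>2) f \<and>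
           (\<forall>p\<in>S. f p = p))}"

text \<open>The solenoids whose points, and those of their defining foliated manifolds, are drawn from \<open>'a\<close>.\<close>

definition solenoids :: "nat \<Rightarrow> nat \<Rightarrow> smoothness \<Rightarrow> smoothness
    \<Rightarrow> ('a set \<times> 'a foliated) set set" where
  "solenoids k l r s = Collect (pre_solenoid k l r s) // solenoid_equiv k l r s"

text \<open>
  The leaves of the larger solenoid, carried by \<open>S'\<close>, are the leaves of \<open>W\<close> contained in \<open>S'\<close>.
\<close>

definition solenoid_le ::
    "('a set \<times> 'a foliated) set \<Rightarrow> ('a set \<times> 'a foliated) set \<Rightarrow> bool" where
  "solenoid_le \<sigma> \<tau> \<longleftrightarrow>
     (\<exists>S S' W. (S, W) \<in> \<sigma> \<and> (S', W) \<in> \<tau> \<and> S \<subseteq> S' \<and>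
        (\<exists>\<L>\<subseteq>{L \<in> leaves W. L \<subseteq> S'}. S = \<Union>\<L>))"

end

theory Submission
  imports Defs
begin

text \<open>
  A solenoid carried by a single compact leaf is minimal, since a sub-solenoid is a non-empty union of
  leaves. The flat torus \<open>T = \<real>\<^sup>k/\<int>\<^sup>k\<close> is compact in every dimension, and the product \<open>T \<times> \<real>\<^sup>l\<close>, with
  charts that are local inverses of the quotient map of \<open>\<real>\<^sup>k \<times> \<real>\<^sup>l\<close>, is a foliated manifold of every class
  \<open>C\<^bsup>r,s\<^esup>\<close>: its transition maps are locally translations by integer vectors in the leaf variable. The
  minimal element is the class \<open>\<mu>\<close> of \<open>T \<times> {0}\<close> in \<open>T \<times> \<real>\<^sup>l\<close>. The underlying set of the manifold can be
  placed in \<open>'a\<close> because \<open>\<real>\<^sup>k \<times> \<real>\<^sup>l\<close> injects into \<open>\<real>\<close>.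

  Let \<open>\<sigma> \<le> \<mu>\<close>. The inclusion is witnessed by some foliated manifold \<open>W\<close> that defines the structure of
  \<open>\<mu>\<close>, not necessarily by \<open>T \<times> \<real>\<^sup>l\<close>, so two things remain to be shown.

  First, \<open>T \<times> {0}\<close> is contained in one leaf of \<open>W\<close>. The germ of diffeomorphism from \<open>T \<times> \<real>\<^sup>l\<close> to \<open>W\<close> fixes
  \<open>T \<times> {0}\<close> pointwise and has the local form \<open>(X(x, y), Y(y))\<close>; as \<open>y = 0\<close> on \<open>T \<times> {0}\<close>, the transversal
  coordinate of \<open>W\<close> is locally constant along \<open>T \<times> {0}\<close>. A path in \<open>T \<times> {0}\<close> is therefore covered by
  plaques of \<open>W\<close> (\<open>leaf_contains_path_connected\<close>). So \<open>\<sigma>\<close> and \<open>\<mu>\<close> have the same underlying set and a common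
  representative.

  Second, classes with a common representative are equal, that is, equivalence of pre-solenoids is an
  equivalence relation (\<open>equiv_solenoid_equiv\<close>). Its transitivity says that regular maps compose, hence that
  maps \<open>(X(x, y), Y(y))\<close> of class \<open>C\<^bsup>r,s\<^esup>\<close> compose (\<open>fol_form_compose\<close>), and most of the text proves
  this. A \<open>C\<^bsup>r,s\<^esup>\<close> function comes with a family of partial derivatives indexed by multi-indices, which is
  awkward to produce for a composite. The classes are therefore first rewritten in an inductive form
  (\<open>regular_to_order\<close>) that differentiates once at a time and is stable under the chain rule; the
  symmetry of second derivatives turns the inductive form back into a family
  (\<open>partials_of_regular\<close>). In the analytic cases, composites are expanded by substituting absolutely
  convergent power series into each other (\<open>power_series_on_compose\<close>), and the derivatives that appear in
  the chain rule are analytic because power series may be differentiated term by term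
  (\<open>power_series_on_deriv\<close>).
\<close>

section \<open>Power series in finitely many variables\<close>

text \<open>
  Multi-indices and points are functions on an arbitrary type of coordinate directions, cut down to a
  finite set \<open>L\<close> of them. This lets one theory serve the \<open>n\<close> coordinates of \<open>\<real>\<^sup>n\<close>, the leaf coordinates
  alone, and the leaf and transversal coordinates together.
\<close>

definition mults :: "'d set \<Rightarrow> ('d \<Rightarrow> nat) set" where
  "mults L = {\<alpha>. \<forall>d. d \<notin> L \<longrightarrow> \<alpha> d = 0}"

abbreviation deg :: "'d set \<Rightarrow> ('d \<Rightarrow> nat) \<Rightarrow> nat" where
  "deg L \<alpha> \<equiv> sum \<alpha> L"

definition mon :: "'d set \<Rightarrow> ('d \<Rightarrow> real) \<Rightarrow> ('d \<Rightarrow> nat) \<Rightarrow> real" where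
  "mon L u \<alpha> = (\<Prod>d\<in>L. u d ^ \<alpha> d)"

definition cube :: "'d set \<Rightarrow> real \<Rightarrow> ('d \<Rightarrow> real) set" where
  "cube L \<rho> = {u. (\<forall>d. d \<notin> L \<longrightarrow> u d = 0) \<and> (\<forall>d\<in>L. \<bar>u d\<bar> \<le> \<rho>)}"

text \<open>
  The norm \<open>\<Sum> \<bar>c\<^sub>\<alpha>\<bar> \<rho>\<^bsup>\<bar>\<alpha>\<bar>\<^esup>\<close> of a power series on the closed cube of radius \<open>\<rho>\<close> makes the functions with such
  expansions a Banach algebra. The bound \<open>N\<close> on the norm is recorded because substitution of
  one series into another converges when the norms of the inner series are at most the radius of the
  outer one.
\<close>

definition power_series_on :: "'d set \<Rightarrow> real \<Rightarrow> real \<Rightarrow> (('d \<Rightarrow> real) \<Rightarrow> real) \<Rightarrow> bool" where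
  "power_series_on L \<rho> N \<phi> \<longleftrightarrow>
     (\<exists>c M. ((\<lambda>\<alpha>. \<bar>c \<alpha>\<bar> * \<rho> ^ deg L \<alpha>) has_sum M) (mults L) \<and> M \<le> N \<and>
        (\<forall>u\<in>cube L \<rho>. ((\<lambda>\<alpha>. c \<alpha> * mon L u \<alpha>) has_sum \<phi> u) (mults L)))"

lemma mon_add: "mon L u (\<lambda>d. \<alpha> d + \<beta> d) = mon L u \<alpha> * mon L u \<beta>"
  by (simp add: mon_def power_add prod.distrib)

lemma mon_le:
  assumes "u \<in> cube L \<rho>"
  shows "\<bar>mon L u \<alpha>\<bar> \<le> \<rho> ^ deg L \<alpha>"
proof -
  have "\<bar>mon L u \<alpha>\<bar> = (\<Prod>d\<in>L. \<bar>u d\<bar> ^ \<alpha> d)"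
    by (simp add: mon_def abs_prod power_abs)
  also have "\<dots> \<le> (\<Prod>d\<in>L. \<rho> ^ \<alpha> d)"
    using assms by (intro prod_mono) (auto simp: cube_def intro: power_mono)
  also have "\<dots> = \<rho> ^ deg L \<alpha>"
    by (simp add: power_sum)
  finally show ?thesis .
qed

text \<open>
  The device by which the terms of a series are collected according to their multi-index.
\<close>

lemma has_sum_fibres:
  fixes m :: "'j \<Rightarrow> 'b"
  assumes "m ` J \<subseteq> A"
  shows "(f has_sum S) J \<longleftrightarrow> ((\<lambda>(\<alpha>, j). f j) has_sum S) (Sigma A (\<lambda>\<alpha>. {j \<in> J. m j = \<alpha>}))"
  using assms by (intro has_sum_reindex_bij_witness[of _ snd "\<lambda>j. (m j, j)"]) auto

lemma has_sum_abs_le: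
  fixes f :: "'j \<Rightarrow> real"
  assumes "(f has_sum S) J" "((\<lambda>j. \<bar>f j\<bar>) has_sum T) J"
  shows "\<bar>S\<bar> \<le> T"
  using norm_has_sum_bound[of f J T S] assms by simp

lemma has_sum_comparison:
  fixes f :: "'j \<Rightarrow> real"
  assumes "(g has_sum S) J" "\<And>j. j \<in> J \<Longrightarrow> \<bar>f j\<bar> \<le> g j"
  shows "\<exists>T. ((\<lambda>j. \<bar>f j\<bar>) has_sum T) J \<and> T \<le> S"
proof -
  have "(\<lambda>j. \<bar>f j\<bar>) summable_on J"
    using has_sum_imp_summable[OF assms(1)] by (rule summable_on_comparison_test) (simp_all add:
        assms(2))
  then obtain T where T: "((\<lambda>j. \<bar>f j\<bar>) has_sum T) J"
    unfolding summable_on_def by blast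
  have "T \<le> S"
    by (rule has_sum_mono[OF T assms(1) assms(2)])
  with T show ?thesis by blast
qed

text \<open>
  The source of all closure properties below: any absolutely convergent sum of monomials, with
  repetitions and in any order, is a power series once the terms with equal exponents are collected, and
  collecting does not increase the norm.
\<close>

lemma power_series_on_regroup:
  fixes m :: "'j \<Rightarrow> 'd \<Rightarrow> nat"
  assumes m: "m ` J \<subseteq> mults L" and \<rho>: "\<rho> > 0"
    and N: "((\<lambda>j. \<bar>a j\<bar> * \<rho> ^ deg L (m j)) has_sum N) J"
    and \<phi>: "\<And>u. u \<in> cube L \<rho> \<Longrightarrow> ((\<lambda>j. a j * mon L u (m j)) has_sum \<phi> u) J"
  shows "power_series_on L \<rho> N \<phi>"
proof -
  define F where "F \<alpha> = {j \<in> J. m j = \<alpha>}" for \<alpha>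
  define c where "c \<alpha> = infsum a (F \<alpha>)" for \<alpha>
  define b where "b \<alpha> = infsum (\<lambda>j. \<bar>a j\<bar>) (F \<alpha>)" for \<alpha>
  have s: "(\<lambda>j. \<bar>a j\<bar>) summable_on F \<alpha>" for \<alpha>
  proof -
    have "(\<lambda>j. \<bar>a j\<bar> * \<rho> ^ deg L (m j)) summable_on F \<alpha>"
      by (rule summable_on_subset[OF has_sum_imp_summable[OF N]]) (auto simp: F_def)
    also have "?this \<longleftrightarrow> (\<lambda>j. \<bar>a j\<bar> * \<rho> ^ deg L \<alpha>) summable_on F \<alpha>"
      by (rule summable_on_cong) (simp add: F_def)
    finally show ?thesis
      using \<rho> by (simp add: summable_on_cmult_left')
  qed
  then have s': "a summable_on F \<alpha>" for \<alpha>
    by (subst summable_on_iff_abs_summable_on_real) simp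
  have c: "(a has_sum c \<alpha>) (F \<alpha>)" and b: "((\<lambda>j. \<bar>a j\<bar>) has_sum b \<alpha>) (F \<alpha>)" for \<alpha>
    using s s' by (auto simp: c_def b_def)
  have cb: "\<bar>c \<alpha>\<bar> \<le> b \<alpha>" for \<alpha>
    by (rule has_sum_abs_le[OF c b])
  have "((\<lambda>(\<alpha>, j). \<bar>a j\<bar> * \<rho> ^ deg L (m j)) has_sum N) (Sigma (mults L) F)"
    using N unfolding F_def by (subst (asm) has_sum_fibres[OF m])
  then have N': "((\<lambda>\<alpha>. b \<alpha> * \<rho> ^ deg L \<alpha>) has_sum N) (mults L)"
  proof (rule has_sum_SigmaD)
    fix \<alpha>
    have "((\<lambda>j. \<bar>a j\<bar> * \<rho> ^ deg L \<alpha>) has_sum b \<alpha> * \<rho> ^ deg L \<alpha>) (F \<alpha>)"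
      by (intro has_sum_cmult_left b)
    then show "((\<lambda>j. case (\<alpha>, j) of (\<alpha>, j) \<Rightarrow> \<bar>a j\<bar> * \<rho> ^ deg L (m j)) has_sum b \<alpha> * \<rho> ^ deg L \<alpha>) (F \<alpha>)"
      by (subst (asm) has_sum_cong) (auto simp: F_def)
  qed
  have c_le: "\<bar>\<bar>c \<alpha>\<bar> * \<rho> ^ deg L \<alpha>\<bar> \<le> b \<alpha> * \<rho> ^ deg L \<alpha>" for \<alpha>
    using mult_right_mono[OF cb, of "\<rho> ^ deg L \<alpha>" \<alpha>] \<rho> by (simp add: abs_mult)
  then obtain M where M: "((\<lambda>\<alpha>. \<bar>\<bar>c \<alpha>\<bar> * \<rho> ^ deg L \<alpha>\<bar>) has_sum M) (mults L)" "M \<le> N"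
    using has_sum_comparison[OF N' c_le] by blast
  have "((\<lambda>\<alpha>. c \<alpha> * mon L u \<alpha>) has_sum \<phi> u) (mults L)" if u: "u \<in> cube L \<rho>" for u
  proof -
    have "((\<lambda>(\<alpha>, j). a j * mon L u (m j)) has_sum \<phi> u) (Sigma (mults L) F)"
      using \<phi>[OF u] unfolding F_def by (subst (asm) has_sum_fibres[OF m])
    then show ?thesis
    proof (rule has_sum_SigmaD)
      fix \<alpha>
      have "((\<lambda>j. a j * mon L u \<alpha>) has_sum c \<alpha> * mon L u \<alpha>) (F \<alpha>)"
        by (intro has_sum_cmult_left c)
      then show "((\<lambda>j. case (\<alpha>, j) of (\<alpha>, j) \<Rightarrow> a j * mon L u (m j)) has_sum c \<alpha> * mon L u \<alpha>) (F \<alpha>)"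
        by (subst (asm) has_sum_cong) (auto simp: F_def)
    qed
  qed
  then show ?thesis
    unfolding power_series_on_def using M \<rho>
    by (intro exI[of _ c] exI[of _ M]) (simp add: abs_mult)
qed

text \<open>
  Completeness of the Banach algebra, in the form of a normally convergent sum of power series.
\<close>

lemma power_series_on_infsum:
  fixes \<phi> :: "'j \<Rightarrow> ('d \<Rightarrow> real) \<Rightarrow> real"
  assumes \<rho>: "\<rho> > 0"
    and \<phi>: "\<And>j. j \<in> K \<Longrightarrow> power_series_on L \<rho> (N j) (\<phi> j)"
    and N: "(N has_sum M) K"
    and \<Phi>: "\<And>u. u \<in> cube L \<rho> \<Longrightarrow> ((\<lambda>j. \<phi> j u) has_sum \<Phi> u) K"
  shows "power_series_on L \<rho> M \<Phi>"
proof -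
  define P where "P j c M' \<longleftrightarrow> ((\<lambda>\<alpha>. \<bar>c \<alpha>\<bar> * \<rho> ^ deg L \<alpha>) has_sum M') (mults L) \<and> M' \<le> N j \<and>
        (\<forall>u\<in>cube L \<rho>. ((\<lambda>\<alpha>. c \<alpha> * mon L u \<alpha>) has_sum \<phi> j u) (mults L))" for j c M'
  have "\<exists>c M'. P j c M'" if "j \<in> K" for j
    using \<phi>[OF that] unfolding power_series_on_def P_def .
  then obtain c M' where "\<And>j. j \<in> K \<Longrightarrow> P j (c j) (M' j)"
    by metis
  then have c: "\<And>j. j \<in> K \<Longrightarrow> ((\<lambda>\<alpha>. \<bar>c j \<alpha>\<bar> * \<rho> ^ deg L \<alpha>) has_sum M' j) (mults L)"
      "\<And>j. j \<in> K \<Longrightarrow> M' j \<le> N j"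
      "\<And>j u. j \<in> K \<Longrightarrow> u \<in> cube L \<rho> \<Longrightarrow> ((\<lambda>\<alpha>. c j \<alpha> * mon L u \<alpha>) has_sum \<phi> j u) (mults L)"
    unfolding P_def by blast+
  have M'0: "0 \<le> M' j" if "j \<in> K" for j
    using has_sum_nonneg[OF c(1)[OF that]] \<rho> by auto
  have "\<bar>M' j\<bar> \<le> N j" if "j \<in> K" for j
    using c(2)[OF that] M'0[OF that] by simp
  from has_sum_comparison[OF N this]
  obtain T where T: "((\<lambda>j. \<bar>M' j\<bar>) has_sum T) K" "T \<le> M" by blast
  have T': "(M' has_sum T) K"
    using T(1) by (subst has_sum_cong[where g = "\<lambda>j. \<bar>M' j\<bar>"]) (use M'0 in auto)
  let ?g = "\<lambda>(j, \<alpha>). \<bar>c j \<alpha>\<bar> * \<rho> ^ deg L \<alpha>"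
  have "?g summable_on Sigma K (\<lambda>_. mults L)"
    using c(1) has_sum_imp_summable[OF T'] \<rho> by (intro summable_on_SigmaI[where g = M']) auto
  then have S: "(?g has_sum T) (Sigma K (\<lambda>_. mults L))"
    using c(1) T' by (intro has_sum_SigmaI[where g = M']) auto
  have "power_series_on L \<rho> T \<Phi>"
  proof (rule power_series_on_regroup[where m = snd and a = "\<lambda>(j, \<alpha>). c j \<alpha>"])
    show "((\<lambda>j. \<bar>case j of (j, \<alpha>) \<Rightarrow> c j \<alpha>\<bar> * \<rho> ^ deg L (snd j)) has_sum T) (Sigma K (\<lambda>_. mults L))"
      using S by (simp add: case_prod_unfold)
    fix u assume u: "u \<in> cube L \<rho>"
    let ?h = "\<lambda>j. (case j of (j, \<alpha>) \<Rightarrow> c j \<alpha>) * mon L u (snd j)"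
    have "\<bar>?h j\<bar> \<le> ?g j" for j
      by (cases j) (simp add: abs_mult mult_left_mono mon_le[OF u])
    from has_sum_comparison[OF S this]
    have "?h summable_on (Sigma K (\<lambda>_. mults L))"
      by (subst summable_on_iff_abs_summable_on_real) (auto dest: has_sum_imp_summable)
    then show "(?h has_sum \<Phi> u) (Sigma K (\<lambda>_. mults L))"
      using c(3) \<Phi> u by (intro has_sum_SigmaI[where g = "\<lambda>j. \<phi> j u"]) auto
  qed (use \<rho> in auto)
  then show ?thesis
    using T(2) unfolding power_series_on_def by (meson order_trans)
qed

lemma power_series_on_mono: "power_series_on L \<rho> N \<phi> \<Longrightarrow> N \<le> N' \<Longrightarrow> power_series_on L \<rho> N' \<phi>"
  unfolding power_series_on_def by (meson order_trans)

lemma power_series_on_cong: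
  "power_series_on L \<rho> N \<phi> \<Longrightarrow> (\<And>u. u \<in> cube L \<rho> \<Longrightarrow> \<phi> u = \<psi> u) \<Longrightarrow> power_series_on L \<rho> N \<psi>"
  unfolding power_series_on_def by auto

lemma power_series_on_monomial:
  assumes "\<rho> > 0" "\<alpha> \<in> mults L"
  shows "power_series_on L \<rho> (\<bar>a\<bar> * \<rho> ^ deg L \<alpha>) (\<lambda>u. a * mon L u \<alpha>)"
  by (rule power_series_on_regroup[where J = "{()}" and m = "\<lambda>_. \<alpha>" and a = "\<lambda>_. a"])
    (use assms in \<open>auto intro!: has_sum_finiteI\<close>)

lemma power_series_on_const:
  assumes "\<rho> > 0"
  shows "power_series_on L \<rho> \<bar>a\<bar> (\<lambda>u. a)"
  using power_series_on_monomial[OF assms, of "\<lambda>_. 0" L a] by (auto simp: mults_def mon_def)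

lemma power_series_on_add:
  assumes "\<rho> > 0" "power_series_on L \<rho> N \<phi>" "power_series_on L \<rho> M \<psi>"
  shows "power_series_on L \<rho> (N + M) (\<lambda>u. \<phi> u + \<psi> u)"
  by (rule power_series_on_infsum[where K = UNIV and \<phi> = "\<lambda>b. if b then \<phi> else \<psi>" and
        N = "\<lambda>b. if b then N else M"]) (use assms in \<open>auto intro!: has_sum_finiteI simp: UNIV_bool\<close>)

text \<open>
  Expand only the first factor: each of its monomials shifts the exponents of the second factor, and the
  resulting power series are summed up.
\<close>

lemma power_series_on_mult:
  assumes \<rho>: "\<rho> > 0" and \<phi>: "power_series_on L \<rho> N \<phi>" and \<psi>: "power_series_on L \<rho> M \<psi>"
  shows "power_series_on L \<rho> (N * M) (\<lambda>u. \<phi> u * \<psi> u)"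
proof -
  obtain c N' where c: "((\<lambda>\<alpha>. \<bar>c \<alpha>\<bar> * \<rho> ^ deg L \<alpha>) has_sum N') (mults L)" "N' \<le> N"
     "\<And>u. u\<in>cube L \<rho> \<Longrightarrow> ((\<lambda>\<alpha>. c \<alpha> * mon L u \<alpha>) has_sum \<phi> u) (mults L)"
    using \<phi> unfolding power_series_on_def by blast
  obtain d M' where d: "((\<lambda>\<alpha>. \<bar>d \<alpha>\<bar> * \<rho> ^ deg L \<alpha>) has_sum M') (mults L)" "M' \<le> M"
     "\<And>u. u\<in>cube L \<rho> \<Longrightarrow> ((\<lambda>\<alpha>. d \<alpha> * mon L u \<alpha>) has_sum \<psi> u) (mults L)"
    using \<psi> unfolding power_series_on_def by blast
  have *: "power_series_on L \<rho> ((\<bar>c \<alpha>\<bar> * \<rho> ^ deg L \<alpha>) * M') (\<lambda>u. (c \<alpha> * mon L u \<alpha>) * \<psi> u)"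
    if \<alpha>: "\<alpha> \<in> mults L" for \<alpha>
  proof (rule power_series_on_regroup[where J = "mults L" and a = "\<lambda>\<beta>. c \<alpha> * d \<beta>"
      and m = "\<lambda>\<beta> i. \<alpha> i + \<beta> i"])
    show "(\<lambda>\<beta> i. \<alpha> i + \<beta> i) ` mults L \<subseteq> mults L"
      using \<alpha> by (auto simp: mults_def)
    have "((\<lambda>\<beta>. (\<bar>c \<alpha>\<bar> * \<rho> ^ deg L \<alpha>) * (\<bar>d \<beta>\<bar> * \<rho> ^ deg L \<beta>)) has_sum (\<bar>c \<alpha>\<bar> * \<rho> ^ deg L \<alpha>) * M')
        (mults L)"
      by (intro has_sum_cmult_right d)
    then show "((\<lambda>\<beta>. \<bar>c \<alpha> * d \<beta>\<bar> * \<rho> ^ deg L (\<lambda>i. \<alpha> i + \<beta> i)) has_sum (\<bar>c \<alpha>\<bar> * \<rho> ^ deg L \<alpha>) * M') (mults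
        L)"
      by (simp add: sum.distrib power_add abs_mult mult_ac)
    fix u assume u: "u \<in> cube L \<rho>"
    have "((\<lambda>\<beta>. (c \<alpha> * mon L u \<alpha>) * (d \<beta> * mon L u \<beta>)) has_sum (c \<alpha> * mon L u \<alpha>) * \<psi> u) (mults L)"
      by (intro has_sum_cmult_right d u)
    then show "((\<lambda>\<beta>. c \<alpha> * d \<beta> * mon L u (\<lambda>i. \<alpha> i + \<beta> i)) has_sum (c \<alpha> * mon L u \<alpha>) * \<psi> u) (mults L)"
      by (simp add: mon_add mult_ac)
  qed fact
  have "power_series_on L \<rho> (N' * M') (\<lambda>u. \<phi> u * \<psi> u)"
    by (rule power_series_on_infsum[OF \<rho> *])
       (use c in \<open>auto intro!: has_sum_cmult_left\<close>)
  moreover have "0 \<le> N'" "0 \<le> M'"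
    using has_sum_nonneg[OF c(1)] has_sum_nonneg[OF d(1)] \<rho> by auto
  then have "N' * M' \<le> N * M"
    using c(2) d(2) by (intro mult_mono) auto
  ultimately show ?thesis
    by (rule power_series_on_mono)
qed

lemma power_series_on_power:
  assumes "\<rho> > 0" "power_series_on L \<rho> N \<phi>"
  shows "power_series_on L \<rho> (N ^ n) (\<lambda>u. \<phi> u ^ n)"
proof (induction n)
  case 0 then show ?case using power_series_on_const[OF assms(1), of L 1] by simp
next
  case (Suc n)
  then show ?case using power_series_on_mult[OF assms(1) assms(2) Suc] by simp
qed

lemma power_series_on_prod:
  assumes "\<rho> > 0" "finite A" "\<And>i. i \<in> A \<Longrightarrow> power_series_on L \<rho> (N i) (\<phi> i)"
  shows "power_series_on L \<rho> (\<Prod>i\<in>A. N i) (\<lambda>u. \<Prod>i\<in>A. \<phi> i u)"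
  using assms(2,3)
proof (induction A rule: finite_induct)
  case empty then show ?case using power_series_on_const[OF assms(1), of L 1] by simp
next
  case (insert i A)
  have "power_series_on L \<rho> (\<Prod>i\<in>A. N i) (\<lambda>u. \<Prod>i\<in>A. \<phi> i u)"
      by (rule insert.IH) (use insert.prems in auto)
  then show ?case using power_series_on_mult[OF assms(1) insert.prems[of i]] insert by simp
qed

text \<open>
  Substitution of power series: the outer series is a normally convergent sum of the products
  \<open>\<Prod> \<phi>\<^sub>d\<^bsup>\<alpha>\<^sub>d\<^esup>\<close>, whose norms are at most the terms \<open>\<sigma>\<^bsup>\<bar>\<alpha>\<bar>\<^esup>\<close> for which the outer series converges.
\<close>

lemma power_series_on_compose:
  assumes \<rho>: "\<rho> > 0" and fin: "finite L'"
    and g: "power_series_on L' \<sigma> N g"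
    and \<phi>: "\<And>d. d \<in> L' \<Longrightarrow> power_series_on L \<rho> \<sigma> (\<lambda>u. \<phi> u d)"
    and cub: "\<And>u. u \<in> cube L \<rho> \<Longrightarrow> \<phi> u \<in> cube L' \<sigma>"
  shows "power_series_on L \<rho> N (\<lambda>u. g (\<phi> u))"
proof -
  obtain c M where c: "((\<lambda>\<alpha>. \<bar>c \<alpha>\<bar> * \<sigma> ^ deg L' \<alpha>) has_sum M) (mults L')" "M \<le> N"
     "\<And>u. u\<in>cube L' \<sigma> \<Longrightarrow> ((\<lambda>\<alpha>. c \<alpha> * mon L' u \<alpha>) has_sum g u) (mults L')"
    using g unfolding power_series_on_def by blast
  have "power_series_on L \<rho> M (\<lambda>u. g (\<phi> u))"
  proof (rule power_series_on_infsum[OF \<rho> _ c(1)])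
    fix \<alpha>
    show "power_series_on L \<rho> (\<bar>c \<alpha>\<bar> * \<sigma> ^ deg L' \<alpha>) (\<lambda>u. c \<alpha> * mon L' (\<phi> u) \<alpha>)"
      unfolding mon_def power_sum
      by (intro power_series_on_mult power_series_on_const power_series_on_prod power_series_on_power \<phi>
          fin \<rho>)
  qed (use c cub in auto)
  then show ?thesis using c(2) by (rule power_series_on_mono)
qed

lemma zero_in_cube: "\<rho> \<ge> 0 \<Longrightarrow> (\<lambda>_. 0) \<in> cube L \<rho>"
  by (auto simp: cube_def)

lemma mon_zero:
  assumes "finite L" "\<alpha> \<in> mults L"
  shows "mon L (\<lambda>_. 0) \<alpha> = (if \<alpha> = (\<lambda>_. 0) then 1 else 0)"
proof -
  have "\<exists>d\<in>L. \<alpha> d \<noteq> 0" if "\<alpha> \<noteq> (\<lambda>_. 0)"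
    using assms that by (fastforce simp: mults_def fun_eq_iff)
  then show ?thesis
    using assms(1) by (auto simp: mon_def)
qed

text \<open>
  Without constant term, every monomial gains at least one factor \<open>t\<close>. Hence the norm can be made as small
  as a substitution requires.
\<close>

lemma power_series_on_shrink:
  assumes fin: "finite L" and \<rho>: "\<rho> > 0" and \<phi>: "power_series_on L \<rho> N \<phi>" and z: "\<phi> (\<lambda>_. 0) = 0"
    and t: "0 < t" "t \<le> 1"
  shows "power_series_on L (t * \<rho>) (t * N) \<phi>"
proof -
  obtain c M where c: "((\<lambda>\<alpha>. \<bar>c \<alpha>\<bar> * \<rho> ^ deg L \<alpha>) has_sum M) (mults L)" "M \<le> N"
     "\<And>u. u\<in>cube L \<rho> \<Longrightarrow> ((\<lambda>\<alpha>. c \<alpha> * mon L u \<alpha>) has_sum \<phi> u) (mults L)"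
    using \<phi> unfolding power_series_on_def by blast
  let ?z = "\<lambda>_. 0"
  have "((\<lambda>\<alpha>. c \<alpha> * mon L (\<lambda>_. 0) \<alpha>) has_sum 0) (mults L)"
    using c(3)[OF zero_in_cube] \<rho> z by simp
  moreover have "((\<lambda>\<alpha>. c \<alpha> * mon L (\<lambda>_. 0) \<alpha>) has_sum c ?z) (mults L)"
  proof (rule has_sum_finite_neutralI[of "{?z}"])
    show "c \<alpha> * mon L (\<lambda>_. 0) \<alpha> = 0" if "\<alpha> \<in> mults L - {?z}" for \<alpha>
      using that mon_zero[OF fin, of \<alpha>] by auto
  qed (auto simp: mults_def mon_def)
  ultimately have c0: "c ?z = 0" using has_sum_unique by blast
  have le: "\<bar>\<bar>c \<alpha>\<bar> * (t * \<rho>) ^ deg L \<alpha>\<bar> \<le> t * (\<bar>c \<alpha>\<bar> * \<rho> ^ deg L \<alpha>)" if "\<alpha> \<in> mults L" for \<alpha>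
  proof (cases "\<alpha> = ?z")
    case False
    then have "deg L \<alpha> \<noteq> 0"
      using that fin by (auto simp: mults_def fun_eq_iff)
    then have "t ^ deg L \<alpha> \<le> t ^ 1" using t by (intro power_decreasing) auto
    then have "t ^ deg L \<alpha> * (\<bar>c \<alpha>\<bar> * \<rho> ^ deg L \<alpha>) \<le> t * (\<bar>c \<alpha>\<bar> * \<rho> ^ deg L \<alpha>)"
      using \<rho> by (intro mult_right_mono) auto
    then show ?thesis using t \<rho> by (simp add: abs_mult power_mult_distrib mult_ac)
  qed (use c0 in simp)
  obtain T where T: "((\<lambda>\<alpha>. \<bar>\<bar>c \<alpha>\<bar> * (t * \<rho>) ^ deg L \<alpha>\<bar>) has_sum T) (mults L)" "T \<le> t * M"
    using has_sum_comparison[OF has_sum_cmult_right[OF c(1), of t] le] by blast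
  have "cube L (t * \<rho>) \<subseteq> cube L \<rho>"
  proof -
    have "t * \<rho> \<le> \<rho>" using t \<rho> by simp
    then show ?thesis by (force simp: cube_def)
  qed
  moreover have "T \<le> t * N"
    using T(2) c(2) t by (meson mult_left_mono order.strict_implies_order order_trans)
  ultimately show ?thesis
    unfolding power_series_on_def using T(1) t \<rho> c(3)
    by (intro exI[of _ c] exI[of _ T]) (auto simp: abs_mult)
qed

lemma power_series_on_restrict:
  assumes \<rho>: "0 < \<rho>'" "\<rho>' \<le> \<rho>" and \<phi>: "power_series_on L \<rho> N \<phi>"
  shows "power_series_on L \<rho>' N \<phi>"
proof -
  obtain c M where c: "((\<lambda>\<alpha>. \<bar>c \<alpha>\<bar> * \<rho> ^ deg L \<alpha>) has_sum M) (mults L)" "M \<le> N"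
     "\<And>u. u\<in>cube L \<rho> \<Longrightarrow> ((\<lambda>\<alpha>. c \<alpha> * mon L u \<alpha>) has_sum \<phi> u) (mults L)"
    using \<phi> unfolding power_series_on_def by blast
  have "\<bar>\<bar>c \<alpha>\<bar> * \<rho>' ^ deg L \<alpha>\<bar> \<le> \<bar>c \<alpha>\<bar> * \<rho> ^ deg L \<alpha>" for \<alpha>
    using \<rho> by (auto simp: abs_mult intro!: mult_left_mono power_mono)
  from has_sum_comparison[OF c(1) this]
  obtain T where T: "((\<lambda>\<alpha>. \<bar>\<bar>c \<alpha>\<bar> * \<rho>' ^ deg L \<alpha>\<bar>) has_sum T) (mults L)" "T \<le> M" by blast
  have "cube L \<rho>' \<subseteq> cube L \<rho>"
    using \<rho> by (force simp: cube_def)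
  then show ?thesis
    unfolding power_series_on_def using T c \<rho>
    by (intro exI[of _ c] exI[of _ T]) (auto simp: abs_mult)
qed

lemma power_series_on_bound:
  assumes \<rho>: "0 < \<rho>" and \<phi>: "power_series_on L \<rho> N \<phi>" and u: "u \<in> cube L \<rho>"
  shows "\<bar>\<phi> u\<bar> \<le> N"
proof -
  obtain c M where c: "((\<lambda>\<alpha>. \<bar>c \<alpha>\<bar> * \<rho> ^ deg L \<alpha>) has_sum M) (mults L)" "M \<le> N"
     "\<And>u. u\<in>cube L \<rho> \<Longrightarrow> ((\<lambda>\<alpha>. c \<alpha> * mon L u \<alpha>) has_sum \<phi> u) (mults L)"
    using \<phi> unfolding power_series_on_def by blast
  have "\<bar>c \<alpha> * mon L u \<alpha>\<bar> \<le> \<bar>c \<alpha>\<bar> * \<rho> ^ deg L \<alpha>" for \<alpha>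
    by (simp add: abs_mult mult_left_mono mon_le[OF u])
  from has_sum_comparison[OF c(1) this]
  obtain T where T: "((\<lambda>\<alpha>. \<bar>c \<alpha> * mon L u \<alpha>\<bar>) has_sum T) (mults L)" "T \<le> M" by blast
  then show ?thesis
    using has_sum_abs_le[OF c(3)[OF u] T(1)] c(2) by linarith
qed


lemma mon_update:
  assumes "finite L" "d \<in> L"
  shows "mon L (u(d := t)) \<alpha> = t ^ \<alpha> d * (\<Prod>e\<in>L - {d}. u e ^ \<alpha> e)"
  unfolding mon_def by (subst prod.remove[OF assms]) (auto intro!: prod.cong)

text \<open>
  The formal derivative converges absolutely on a smaller cube, since \<open>n \<le> 2\<^sup>n\<close> is absorbed by a change of
  radius. It is the derivative because the errors of the difference quotients of the monomials, bounded by
  \<open>lemma_termdiff3\<close>, are absorbed in the same way and sum to \<open>O(h)\<close>.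
\<close>

lemma power_series_on_deriv:
  assumes fin: "finite L" and \<rho>: "\<rho> > 0" and \<phi>: "power_series_on L \<rho> N \<phi>" and d: "d \<in> L"
    and der: "\<And>u. u \<in> cube L (\<rho> / 8) \<Longrightarrow> ((\<lambda>t. \<phi> (u(d := t))) has_real_derivative \<psi> u) (at (u d))"
  shows "\<exists>N'. power_series_on L (\<rho> / 8) N' \<psi>"
proof -
  obtain c M where c: "((\<lambda>\<alpha>. \<bar>c \<alpha>\<bar> * \<rho> ^ deg L \<alpha>) has_sum M) (mults L)" "M \<le> N"
     "\<And>u. u\<in>cube L \<rho> \<Longrightarrow> ((\<lambda>\<alpha>. c \<alpha> * mon L u \<alpha>) has_sum \<phi> u) (mults L)"
    using \<phi> unfolding power_series_on_def by blast
  \<comment> \<open>The remainders cost a factor \<open>\<alpha> d * (\<alpha> d - 1) \<le> 4\<^bsup>\<alpha> d\<^esup>\<close>, hence the radius \<open>K = \<rho> / 4\<close>; points with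
      coordinates at most \<open>K / 2\<close> leave room for the increment \<open>h\<close>.\<close>
  define K where "K = \<rho> / 4"
  have K: "K > 0" "\<rho> = 4 * K" using \<rho> by (auto simp: K_def)
  define low where "low \<alpha> = \<alpha>(d := \<alpha> d - 1)" for \<alpha> :: "'a \<Rightarrow> nat"
  define rest where "rest u \<alpha> = (\<Prod>e\<in>L - {d}. u e ^ \<alpha> e)" for u :: "'a \<Rightarrow> real" and \<alpha> :: "'a \<Rightarrow> nat"
  have deg: "deg L \<alpha> = \<alpha> d + deg (L - {d}) \<alpha>" for \<alpha>
    using sum.remove[OF fin d, of \<alpha>] .
  have lowmon: "mon L u (low \<alpha>) = u d ^ (\<alpha> d - 1) * rest u \<alpha>" for u \<alpha>
    unfolding mon_def low_def rest_def by (subst prod.remove[OF fin d]) (auto intro!: prod.cong)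
  have degl: "deg L (low \<alpha>) = (\<alpha> d - 1) + deg (L - {d}) \<alpha>" for \<alpha>
    unfolding deg low_def by (auto intro!: sum.cong)
  have n4: "real n \<le> 2 ^ n" for n by (simp add: less_imp_le)
  have rest_le: "\<bar>rest u \<alpha>\<bar> \<le> K ^ deg (L - {d}) \<alpha>" if "\<And>e. e \<in> L \<Longrightarrow> \<bar>u e\<bar> \<le> K" for u \<alpha>
  proof -
    have "\<bar>rest u \<alpha>\<bar> = (\<Prod>e\<in>L - {d}. \<bar>u e\<bar> ^ \<alpha> e)" by (simp add: rest_def abs_prod power_abs)
    also have "\<dots> \<le> (\<Prod>e\<in>L - {d}. K ^ \<alpha> e)" using that by (intro prod_mono) (auto intro: power_mono)
    finally show ?thesis by (simp add: power_sum)
  qed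
  define b where "b \<alpha> = c \<alpha> * real (\<alpha> d)" for \<alpha>
  have b_le: "\<bar>\<bar>b \<alpha>\<bar> * K ^ deg L (low \<alpha>)\<bar> \<le> (1 / K) * (\<bar>c \<alpha>\<bar> * \<rho> ^ deg L \<alpha>)" for \<alpha>
  proof (cases "\<alpha> d")
    case (Suc n)
    have "real (\<alpha> d) * K ^ n \<le> 4 ^ Suc n * K ^ n"
    proof (rule mult_right_mono)
      have "(2::real) ^ Suc n \<le> 4 ^ Suc n" by (intro power_mono) auto
      then show "real (\<alpha> d) \<le> 4 ^ Suc n" using n4[of "Suc n"] unfolding Suc by linarith
    qed (use K in simp)
    then have "real (\<alpha> d) * K ^ n * K ^ deg (L - {d}) \<alpha> \<le> 4 ^ Suc n * K ^ n * (4 * K) ^ deg (L - {d}) \<alpha>"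
      using K by (intro mult_mono power_mono) auto
    then have "real (\<alpha> d) * K ^ deg L (low \<alpha>) \<le> (1 / K) * \<rho> ^ deg L \<alpha>"
      unfolding degl unfolding deg Suc using K(1) unfolding K(2)
          by (simp add: power_add power_mult_distrib field_simps)
    then have "\<bar>c \<alpha>\<bar> * (real (\<alpha> d) * K ^ deg L (low \<alpha>)) \<le> \<bar>c \<alpha>\<bar> * ((1 / K) * \<rho> ^ deg L \<alpha>)"
      by (rule mult_left_mono) auto
    then show ?thesis using K by (simp add: b_def abs_mult mult_ac)
  qed (use K in \<open>simp add: b_def\<close>)
  define G where "G u = infsum (\<lambda>\<alpha>. b \<alpha> * mon L u (low \<alpha>)) (mults L)" for u
  obtain B where B: "((\<lambda>\<alpha>. \<bar>b \<alpha>\<bar> * K ^ deg L (low \<alpha>)) has_sum B) (mults L)"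
    using has_sum_comparison[OF has_sum_cmult_right[OF c(1), of "1 / K"] b_le] K(1)
        by (simp add: abs_mult) blast
  have G: "((\<lambda>\<alpha>. b \<alpha> * mon L u (low \<alpha>)) has_sum G u) (mults L)" if u: "u \<in> cube L K" for u
  proof -
    have "\<bar>b \<alpha> * mon L u (low \<alpha>)\<bar> \<le> \<bar>b \<alpha>\<bar> * K ^ deg L (low \<alpha>)" for \<alpha>
      using mon_le[OF u] by (simp add: abs_mult mult_left_mono)
    from has_sum_comparison[OF B this]
    have "(\<lambda>\<alpha>. b \<alpha> * mon L u (low \<alpha>)) summable_on (mults L)"
      by (subst summable_on_iff_abs_summable_on_real) (auto dest: has_sum_imp_summable)
    then show ?thesis by (simp add: G_def)
  qed
  have "power_series_on L K B G"
    by (rule power_series_on_regroup[OF _ K(1) B G]) (auto simp: mults_def low_def)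
  then obtain a A where a: "((\<lambda>\<alpha>. \<bar>a \<alpha>\<bar> * K ^ deg L \<alpha>) has_sum A) (mults L)"
     "\<And>u. u\<in>cube L K \<Longrightarrow> ((\<lambda>\<alpha>. a \<alpha> * mon L u \<alpha>) has_sum G u) (mults L)"
    unfolding power_series_on_def by blast
  have GK: "\<psi> u = G u" if u: "u \<in> cube L (\<rho> / 8)" for u
  proof -
    have uK: "\<bar>u e\<bar> \<le> K / 2" if "e \<in> L" for e using u that by (auto simp: cube_def K_def)
    have uK': "\<bar>u e\<bar> \<le> K" if "e \<in> L" for e using uK[OF that] K by linarith
    have uc: "u \<in> cube L K" using u uK' by (auto simp: cube_def)
    have est: "\<bar>(\<phi> (u(d := u d + h)) - \<phi> u) / h - G u\<bar> \<le> M / K\<^sup>2 * 16 * \<bar>h\<bar>"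
      if h: "h \<noteq> 0" "\<bar>h\<bar> < K / 2" for h
    proof -
      have uh: "\<bar>u d + h\<bar> \<le> K" using uK[OF d] h by linarith
      have c1: "u(d := u d + h) \<in> cube L \<rho>" "u \<in> cube L \<rho>"
        using uc uh d K by (force simp: cube_def)+
      let ?q = "\<lambda>\<alpha>. c \<alpha> * rest u \<alpha> * (((u d + h) ^ \<alpha> d - u d ^ \<alpha> d) / h - real (\<alpha> d) * u d ^ (\<alpha> d - Suc
          0))"
      have "((\<lambda>\<alpha>. (c \<alpha> * mon L (u(d := u d + h)) \<alpha> + - (c \<alpha> * mon L u \<alpha>)) / h + - (b \<alpha> * mon L u (low
          \<alpha>)))
           has_sum ((\<phi> (u(d := u d + h)) + - \<phi> u) / h + - G u)) (mults L)"
        by (intro has_sum_add has_sum_divide_const has_sum_uminusI c(3) c1 G uc)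
      moreover have "(c \<alpha> * mon L (u(d := u d + h)) \<alpha> + - (c \<alpha> * mon L u \<alpha>)) / h + - (b \<alpha> * mon L u (low
          \<alpha>)) = ?q \<alpha>" for \<alpha>
        using mon_update[OF fin d, of u "u d" \<alpha>] mon_update[OF fin d, of u "u d + h" \<alpha>] h
        by (simp add: lowmon b_def rest_def[symmetric] field_simps)
      ultimately have 1: "(?q has_sum ((\<phi> (u(d := u d + h)) - \<phi> u) / h - G u)) (mults L)"
        by simp
      have q_le: "\<bar>?q \<alpha>\<bar> \<le> (16 / K\<^sup>2 * \<bar>h\<bar>) * (\<bar>c \<alpha>\<bar> * \<rho> ^ deg L \<alpha>)" for \<alpha>
      proof -
        let ?n = "\<alpha> d"
        have t: "\<bar>((u d + h) ^ ?n - u d ^ ?n) / h - real ?n * u d ^ (?n - Suc 0)\<bar>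
           \<le> real ?n * real (?n - Suc 0) * K ^ (?n - 2) * \<bar>h\<bar>"
          using lemma_termdiff3[of h "u d" K ?n] h uK'[OF d] uh by simp
        have t2: "real ?n * real (?n - Suc 0) * K ^ (?n - 2) \<le> 16 / K\<^sup>2 * \<rho> ^ ?n"
        proof (cases "?n \<ge> 2")
          case True
          then obtain m where m: "?n = m + 2" using le_Suc_ex by (metis add.commute)
          have "real (m + 2) * real (m + 1) \<le> 2 ^ (m + 2) * 2 ^ (m + 1)"
            using n4[of "m + 2"] n4[of "m + 1"] by (intro mult_mono) auto
          also have "\<dots> = 2 * 4 * (4::real) ^ m"
            by (simp add: power_mult_distrib[symmetric])
          also have "\<dots> \<le> 256 * 4 ^ m" by simp
          finally have "real (m + 2) * real (m + 1) * K ^ m \<le> (256 * 4 ^ m) * K ^ m"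
            using K(1) by (intro mult_right_mono) auto
          then show ?thesis unfolding m K(2) using K(1)
            by (simp add: power_add power_mult_distrib field_simps power2_eq_square)
        next
          case False
          then have "real ?n * real (?n - Suc 0) = 0" by auto
          then show ?thesis using \<rho> by (simp only: mult_zero_left) simp
        qed
        have "\<bar>?q \<alpha>\<bar> \<le> \<bar>c \<alpha>\<bar> * K ^ deg (L - {d}) \<alpha> * (16 / K\<^sup>2 * \<rho> ^ ?n * \<bar>h\<bar>)"
          unfolding abs_mult
          by (intro mult_mono mult_left_mono rest_le uK' order_trans[OF t] mult_right_mono t2) (use K in
              auto)
        also have "\<dots> \<le> \<bar>c \<alpha>\<bar> * \<rho> ^ deg (L - {d}) \<alpha> * (16 / K\<^sup>2 * \<rho> ^ ?n * \<bar>h\<bar>)"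
          using K by (intro mult_right_mono mult_left_mono power_mono) auto
        finally show ?thesis by (simp add: deg power_add mult_ac)
      qed
      obtain T where T: "((\<lambda>\<alpha>. \<bar>?q \<alpha>\<bar>) has_sum T) (mults L)" "T \<le> (16 / K\<^sup>2 * \<bar>h\<bar>) * M"
        using has_sum_comparison[OF has_sum_cmult_right[OF c(1), of "16 / K\<^sup>2 * \<bar>h\<bar>"] q_le] by blast
      show ?thesis using has_sum_abs_le[OF 1 T(1)] T(2) by (simp add: mult_ac)
    qed
    have "((\<lambda>t. \<phi> (u(d := t))) has_real_derivative G u) (at (u d))"
    proof -
      have "((\<lambda>h. (\<phi> (u(d := u d + h)) - \<phi> u) / h - G u) \<longlongrightarrow> 0) (at 0)"
      proof (rule Lim_null_comparison)
        show "((\<lambda>h. M / K\<^sup>2 * 16 * \<bar>h\<bar>) \<longlongrightarrow> 0) (at 0)"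
          by (intro tendsto_mult_right_zero tendsto_rabs_zero tendsto_ident_at)
        show "\<forall>\<^sub>F h in at 0. norm ((\<phi> (u(d := u d + h)) - \<phi> u) / h - G u) \<le> M / K\<^sup>2 * 16 * \<bar>h\<bar>"
          using est K(1) unfolding eventually_at by (intro exI[of _ "K / 2"]) auto
      qed
      then show ?thesis
        unfolding DERIV_def using LIM_zero_cancel by fastforce
    qed
    then show ?thesis using der[OF u] DERIV_unique by blast
  qed
  have "\<bar>\<bar>a \<alpha>\<bar> * (\<rho> / 8) ^ deg L \<alpha>\<bar> \<le> \<bar>a \<alpha>\<bar> * K ^ deg L \<alpha>" for \<alpha>
    using \<rho> by (auto simp: abs_mult K_def intro!: mult_left_mono power_mono)
  from has_sum_comparison[OF a(1) this]
  obtain A' where "((\<lambda>\<alpha>. \<bar>\<bar>a \<alpha>\<bar> * (\<rho> / 8) ^ deg L \<alpha>\<bar>) has_sum A') (mults L)"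
    by blast
  moreover have "((\<lambda>\<alpha>. a \<alpha> * mon L u \<alpha>) has_sum \<psi> u) (mults L)" if "u \<in> cube L (\<rho> / 8)" for u
  proof -
    have "u \<in> cube L K" using that \<rho> by (force simp: cube_def K_def)
    then show ?thesis using a(2) GK[OF that] by simp
  qed
  ultimately show ?thesis
    unfolding power_series_on_def using \<rho>
    by (intro exI[of _ A'] exI[of _ a] exI[of _ A']) (auto simp: abs_mult)
qed

section \<open>Partial derivatives on open sets of coordinate spaces\<close>

text \<open>
  A copy of Euclidean space inside a function type: like \<open>Euclidean_space n\<close>, but for any finite set of
  coordinate directions.
\<close>

definition coordspace :: "'d set \<Rightarrow> ('d \<Rightarrow> real) set" where
  "coordspace I = {p. \<forall>d. d \<notin> I \<longrightarrow> p d = 0}"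

text \<open>
  \<open>L\<close> and \<open>T\<close> are the leaf and the transversal directions.
\<close>

definition coord_domain :: "'d set \<Rightarrow> 'd set \<Rightarrow> ('d \<Rightarrow> real) set \<Rightarrow> bool" where
  "coord_domain L T V \<longleftrightarrow> finite L \<and> finite T \<and> L \<inter> T = {} \<and>
     openin (top_of_set (coordspace (L \<union> T))) V"

text \<open>
  As \<open>I\<close> is finite, the product topology has a uniform box around each point of an open set.
\<close>

lemma coordspace_openin_box:
  assumes fin: "finite I" and V: "openin (top_of_set (coordspace I)) V" and p: "p \<in> V"
  shows "\<exists>\<delta>>0. \<forall>q\<in>coordspace I. (\<forall>d\<in>I. \<bar>q d - p d\<bar> < \<delta>) \<longrightarrow> q \<in> V"
proof -
  obtain G where G: "open G" "V = coordspace I \<inter> G"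
    using V by (auto simp: openin_open)
  then have "openin (product_topology (\<lambda>_. euclideanreal) UNIV) G"
    by (simp add: euclidean_product_topology)
  from product_topology_open_contains_basis[OF this, of p] p G(2)
  obtain X where X: "p \<in> Pi\<^sub>E UNIV X" "\<And>i. open (X i)" "Pi\<^sub>E UNIV X \<subseteq> G" by auto
  have "\<exists>e>0. \<forall>t. \<bar>t - p d\<bar> < e \<longrightarrow> t \<in> X d" for d
    using X(1) X(2)[of d] by (force simp: open_dist dist_real_def)
  then obtain e where e: "\<And>d. e d > 0" "\<And>d t. \<bar>t - p d\<bar> < e d \<Longrightarrow> t \<in> X d" by metis
  define \<delta> where "\<delta> = Min (insert 1 (e ` I))"
  have \<delta>: "\<delta> > 0" "\<And>d. d \<in> I \<Longrightarrow> \<delta> \<le> e d"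
    using fin e(1) by (auto simp: \<delta>_def)
  have "q \<in> V" if q: "q \<in> coordspace I" "\<forall>d\<in>I. \<bar>q d - p d\<bar> < \<delta>" for q
  proof -
    have "q d \<in> X d" for d
    proof (cases "d \<in> I")
      case True then show ?thesis using q(2) \<delta>(2) e(2) by force
    next
      case False
      then have "q d = p d" using q(1) p G(2) by (auto simp: coordspace_def)
      then show ?thesis using e by auto
    qed
    then show ?thesis using q(1) G(2) X(3) by (auto simp: PiE_def Pi_def)
  qed
  with \<delta>(1) show ?thesis by blast
qed

lemma coord_domain_subset: "coord_domain L T V \<Longrightarrow> p \<in> V \<Longrightarrow> d \<notin> L \<union> T \<Longrightarrow> p d = 0"
  by (force simp: coord_domain_def coordspace_def openin_open)

lemma coord_domain_box:
  assumes "coord_domain L T V" "p \<in> V"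
  shows "\<exists>\<delta>>0. \<forall>q. (\<forall>d. d \<notin> L \<union> T \<longrightarrow> q d = p d) \<longrightarrow> (\<forall>d\<in>L \<union> T. \<bar>q d - p d\<bar> < \<delta>) \<longrightarrow> q \<in> V"
  using coordspace_openin_box[of "L \<union> T" V p] assms coord_domain_subset[OF assms]
  unfolding coord_domain_def coordspace_def by auto

lemma coord_domain_continuous_box:
  fixes f :: "('d \<Rightarrow> real) \<Rightarrow> real"
  assumes dom: "coord_domain L T V" and p: "p \<in> V" and f: "continuous_on V f" and \<epsilon>: "\<epsilon> > 0"
  shows "\<exists>\<delta>>0. \<forall>q. (\<forall>d. d \<notin> L \<union> T \<longrightarrow> q d = p d) \<longrightarrow> (\<forall>d\<in>L \<union> T. \<bar>q d - p d\<bar> < \<delta>) \<longrightarrow>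
    q \<in> V \<and> \<bar>f q - f p\<bar> < \<epsilon>"
proof -
  let ?V = "V \<inter> f -` ball (f p) \<epsilon>"
  have "openin (top_of_set V) ?V"
    by (rule continuous_openin_preimage_gen[OF f]) simp
  then have "coord_domain L T ?V"
    using dom unfolding coord_domain_def by (meson openin_trans)
  moreover have "p \<in> ?V" using p \<epsilon> by simp
  ultimately show ?thesis
    using coord_domain_box[of L T ?V p] by (simp add: dist_real_def abs_minus_commute)
qed

lemma coord_domain_line:
  assumes dom: "coord_domain L T V" and p: "p \<in> V" and d: "d \<in> L \<union> T"
  shows "\<forall>\<^sub>F t in nhds (p d). p(d := t) \<in> V"
proof -
  obtain \<delta> where \<delta>: "\<delta> > 0" "\<And>q. (\<forall>d. d \<notin> L \<union> T \<longrightarrow> q d = p d) \<Longrightarrow> (\<forall>d\<in>L \<union> T. \<bar>q d - p d\<bar> < \<delta>) \<Longrightarrow> q \<in> V"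
    using coord_domain_box[OF dom p] by blast
  show ?thesis
    unfolding eventually_nhds_metric using \<delta> d
    by (intro exI[of _ \<delta>] conjI allI impI \<delta>(2)) (auto simp: dist_real_def)
qed

definition partial_deriv :: "'d \<Rightarrow> ('d \<Rightarrow> real) set \<Rightarrow> (('d \<Rightarrow> real) \<Rightarrow> real) \<Rightarrow> (('d \<Rightarrow> real) \<Rightarrow> real) \<Rightarrow> bool"
    where
  "partial_deriv d V f g \<longleftrightarrow> (\<forall>p\<in>V. ((\<lambda>t. f (p(d := t))) has_real_derivative g p) (at (p d)))"

lemma partial_deriv_cong:
  assumes dom: "coord_domain L T V" and d: "d \<in> L \<union> T"
    and eq: "\<And>p. p \<in> V \<Longrightarrow> f p = f' p" "\<And>p. p \<in> V \<Longrightarrow> g p = g' p"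
  shows "partial_deriv d V f g \<longleftrightarrow> partial_deriv d V f' g'"
  unfolding partial_deriv_def
proof (rule ball_cong[OF refl])
  fix p assume p: "p \<in> V"
  have "\<forall>\<^sub>F t in nhds (p d). f (p(d := t)) = f' (p(d := t))"
    using coord_domain_line[OF dom p d] by eventually_elim (use eq in auto)
  then show "((\<lambda>t. f (p(d := t))) has_real_derivative g p) (at (p d)) \<longleftrightarrow>
    ((\<lambda>t. f' (p(d := t))) has_real_derivative g' p) (at (p d))"
    using p eq(2) by (intro DERIV_cong_ev) auto
qed

lemma mvt_between:
  fixes f :: "real \<Rightarrow> real"
  assumes "\<And>s. min a b \<le> s \<Longrightarrow> s \<le> max a b \<Longrightarrow> (f has_real_derivative f' s) (at s)"
  shows "\<exists>s. min a b \<le> s \<and> s \<le> max a b \<and> f a - f b = f' s * (a - b)"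
proof (cases a b rule: linorder_cases)
  case less
  then obtain z where "a < z" "z < b" "f b - f a = (b - a) * f' z"
    using MVT2[of a b f f'] assms by auto
  then show ?thesis by (intro exI[of _ z]) (auto simp: algebra_simps)
next
  case equal then show ?thesis by (intro exI[of _ a]) auto
next
  case greater
  then obtain z where "b < z" "z < a" "f a - f b = (a - b) * f' z"
    using MVT2[of b a f f'] assms by auto
  then show ?thesis by (intro exI[of _ z]) (auto simp: algebra_simps)
qed

text \<open>
  Only the directions \<open>J\<close> in which the curve moves need derivatives of \<open>g\<close>. This is essential when \<open>g\<close> is
  differentiable in the leaf variable only: a curve in a leaf is mapped into a leaf. The proof changes one
  coordinate at a time; each change is estimated by the mean value theorem and the continuity of one partial
  derivative.
\<close>

lemma chain_rule_along_curve:
  fixes c :: "real \<Rightarrow> 'd \<Rightarrow> real"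
  assumes dom: "coord_domain L T V" and J: "finite J" "J \<subseteq> L \<union> T"
    and g: "\<And>e. e \<in> J \<Longrightarrow> partial_deriv e V g (g' e)" "\<And>e. e \<in> J \<Longrightarrow> continuous_on V (g' e)"
    and c0: "c t0 \<in> V"
    and c: "\<And>e. e \<in> J \<Longrightarrow> ((\<lambda>t. c t e) has_real_derivative c' e) (at t0)"
    and const: "\<forall>\<^sub>F t in nhds t0. \<forall>e. e \<notin> J \<longrightarrow> c t e = c t0 e"
  shows "((\<lambda>t. g (c t)) has_real_derivative (\<Sum>e\<in>J. g' e (c t0) * c' e)) (at t0)"
  using J g c0 c const
proof (induction J arbitrary: c rule: finite_induct)
  case empty
  have "\<forall>\<^sub>F t in nhds t0. g (c t) = g (c t0)"
    using empty.prems(6) by eventually_elim (metis empty_iff ext)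
  then show ?case
    by (subst DERIV_cong_ev[OF refl _ refl, of _ "\<lambda>_. g (c t0)"]) auto
next
  case (insert e J)
  \<comment> \<open>\<open>c1\<close> moves in the directions \<open>J\<close> only; the remaining difference is a step in direction \<open>e\<close>.\<close>
  define c1 where "c1 t = (c t)(e := c t0 e)" for t
  have c10: "c1 t0 = c t0" by (simp add: c1_def)
  have 1: "((\<lambda>t. g (c1 t)) has_real_derivative (\<Sum>e\<in>J. g' e (c1 t0) * c' e)) (at t0)"
  proof (rule insert.IH)
    show "((\<lambda>t. c1 t i) has_real_derivative c' i) (at t0)" if "i \<in> J" for i
    proof -
      have "i \<noteq> e" using that insert.hyps by auto
      then show ?thesis using insert.prems(5)[of i] that by (simp add: c1_def)
    qed
    show "\<forall>\<^sub>F t in nhds t0. \<forall>i. i \<notin> J \<longrightarrow> c1 t i = c1 t0 i"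
      using insert.prems(6) by eventually_elim (auto simp: c1_def)
  qed (use insert.prems c10 in auto)
  have near: "\<forall>\<^sub>F t in nhds t0. (\<forall>i. i \<notin> L \<union> T \<longrightarrow> c t i = c t0 i) \<and> (\<forall>i\<in>L \<union> T. \<bar>c t i - c t0 i\<bar> < \<delta>)"
    if "\<delta> > 0" for \<delta>
  proof -
    have "\<forall>\<^sub>F t in nhds t0. \<forall>i\<in>insert e J. \<bar>c t i - c t0 i\<bar> < \<delta>"
    proof (intro eventually_ball_finite ballI)
      fix i assume "i \<in> insert e J"
      then have "isCont (\<lambda>t. c t i) t0" using insert.prems(5) DERIV_isCont by blast
      then have "((\<lambda>t. c t i) \<longlongrightarrow> c t0 i) (nhds t0)"
        by (simp add: isCont_def tendsto_at_iff_tendsto_nhds[of "\<lambda>t. c t i"])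
      then show "\<forall>\<^sub>F t in nhds t0. \<bar>c t i - c t0 i\<bar> < \<delta>"
        using \<open>\<delta> > 0\<close> by (auto simp: tendsto_iff dist_real_def)
    qed (use insert.hyps in auto)
    then show ?thesis
      using insert.prems(6) by eventually_elim (use that insert.prems(1) in force)
  qed
  obtain \<delta>0 where \<delta>0: "\<delta>0 > 0" "\<And>q. (\<forall>d. d \<notin> L \<union> T \<longrightarrow> q d = c t0 d) \<Longrightarrow> (\<forall>d\<in>L \<union> T. \<bar>q d - c t0 d\<bar> < \<delta>0) \<Longrightarrow>
      q \<in> V"
    using coord_domain_box[OF dom insert.prems(4)] by blast
  have e: "e \<in> L \<union> T" using insert.prems by auto
  define good where "good t s \<longleftrightarrow> \<bar>s - c t0 e\<bar> \<le> \<bar>c t e - c t0 e\<bar> \<and>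
      g (c t) - g (c1 t) = g' e ((c t)(e := s)) * (c t e - c t0 e)" for t s
  define s where "s t = (SOME s. good t s)" for t
  have "\<forall>\<^sub>F t in nhds t0. \<exists>s. good t s"
    using near[OF \<delta>0(1)]
  proof eventually_elim
    case (elim t)
    have "((\<lambda>s. g ((c t)(e := s))) has_real_derivative g' e ((c t)(e := s))) (at s)"
      if "min (c t e) (c t0 e) \<le> s" "s \<le> max (c t e) (c t0 e)" for s
    proof -
      have "\<bar>s - c t0 e\<bar> \<le> \<bar>c t e - c t0 e\<bar>" using that by linarith
      also have "\<dots> < \<delta>0" using elim e by blast
      finally have "(c t)(e := s) \<in> V"
        using elim e by (intro \<delta>0(2)) auto
      then show ?thesis
        using insert.prems(2)[of e] unfolding partial_deriv_def by fastforce
    qed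
    from mvt_between[OF this] obtain s where s: "min (c t e) (c t0 e) \<le> s" "s \<le> max (c t e) (c t0 e)"
      "g ((c t)(e := c t e)) - g ((c t)(e := c t0 e)) = g' e ((c t)(e := s)) * (c t e - c t0 e)"
          by blast
    have "\<bar>s - c t0 e\<bar> \<le> \<bar>c t e - c t0 e\<bar>" using s by linarith
    then show ?case using s by (auto simp: good_def c1_def)
  qed
  then have s: "\<forall>\<^sub>F t in nhds t0. good t (s t)"
    by (rule eventually_mono) (unfold s_def, rule someI_ex)
  have lim: "((\<lambda>t. g' e ((c t)(e := s t))) \<longlongrightarrow> g' e (c t0)) (at t0)"
  proof (rule tendstoI)
    fix \<epsilon> :: real assume "\<epsilon> > 0"
    then obtain \<delta> where \<delta>: "\<delta> > 0"
        "\<And>q. (\<forall>d. d \<notin> L \<union> T \<longrightarrow> q d = c t0 d) \<Longrightarrow> (\<forall>d\<in>L \<union> T. \<bar>q d - c t0 d\<bar> < \<delta>) \<Longrightarrow>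
            \<bar>g' e q - g' e (c t0)\<bar> < \<epsilon>"
      using coord_domain_continuous_box[OF dom insert.prems(4), of "g' e" \<epsilon>] insert.prems(3) by blast
    have "\<forall>\<^sub>F t in nhds t0. dist (g' e ((c t)(e := s t))) (g' e (c t0)) < \<epsilon>"
      using near[OF \<delta>(1)] s
    proof eventually_elim
      case (elim t)
      then have "\<bar>s t - c t0 e\<bar> < \<delta>" using e unfolding good_def by force
      then show ?case
        using elim e unfolding dist_real_def by (intro \<delta>(2)) auto
    qed
    then show "\<forall>\<^sub>F t in at t0. dist (g' e ((c t)(e := s t))) (g' e (c t0)) < \<epsilon>"
      by (simp add: eventually_at_filter eventually_mono)
  qed
  have "((\<lambda>t. (c t e - c t0 e) / (t - t0)) \<longlongrightarrow> c' e) (at t0)"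
    using insert.prems(5)[of e] by (simp add: has_field_derivative_iff)
  from tendsto_mult[OF lim this]
  have "((\<lambda>t. g' e ((c t)(e := s t)) * ((c t e - c t0 e) / (t - t0))) \<longlongrightarrow> g' e (c t0) * c' e) (at t0)" .
  moreover have "\<forall>\<^sub>F t in at t0. g' e ((c t)(e := s t)) * ((c t e - c t0 e) / (t - t0)) =
      ((g (c t) - g (c1 t)) - (g (c t0) - g (c1 t0))) / (t - t0)"
    using s unfolding eventually_at_filter
    by eventually_elim (auto simp: good_def c10)
  ultimately have "((\<lambda>t. ((g (c t) - g (c1 t)) - (g (c t0) - g (c1 t0))) / (t - t0)) \<longlongrightarrow> g' e (c t0) * c'
      e) (at t0)"
    by (rule Lim_transform_eventually)
  then have 2: "((\<lambda>t. g (c t) - g (c1 t)) has_real_derivative g' e (c t0) * c' e) (at t0)"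
    by (simp add: has_field_derivative_iff)
  from DERIV_add[OF 1 2] show ?case
    using insert.hyps by (simp add: c10 add.commute)
qed

text \<open>
  The second difference of \<open>f\<close> over a small square equals \<open>h\<^sup>2\<close> times a value of either mixed derivative, by
  two applications of the mean value theorem in either order; let the square shrink.
\<close>

lemma mixed_partials_commute:
  assumes dom: "coord_domain L T V" and d: "d \<in> L \<union> T" and e: "e \<in> L \<union> T" and ne: "d \<noteq> e"
    and D: "partial_deriv d V f fd" "partial_deriv e V f fe" "partial_deriv e V fd fde"
        "partial_deriv d V fe fed"
    and cont: "continuous_on V fde" "continuous_on V fed" and p: "p \<in> V"
  shows "fde p = fed p"
proof (rule ccontr)
  assume "fde p \<noteq> fed p"
  define \<epsilon> where "\<epsilon> = \<bar>fde p - fed p\<bar> / 2"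
  have \<epsilon>: "\<epsilon> > 0" using \<open>fde p \<noteq> fed p\<close> by (simp add: \<epsilon>_def)
  obtain \<delta>1 where \<delta>1: "\<delta>1 > 0" "\<And>q. (\<forall>d. d \<notin> L \<union> T \<longrightarrow> q d = p d) \<Longrightarrow> (\<forall>d\<in>L \<union> T. \<bar>q d - p d\<bar> < \<delta>1) \<Longrightarrow> q \<in> V \<and>
      \<bar>fde q - fde p\<bar> < \<epsilon>"
    using coord_domain_continuous_box[OF dom p cont(1) \<epsilon>] by blast
  obtain \<delta>2 where \<delta>2: "\<delta>2 > 0" "\<And>q. (\<forall>d. d \<notin> L \<union> T \<longrightarrow> q d = p d) \<Longrightarrow> (\<forall>d\<in>L \<union> T. \<bar>q d - p d\<bar> < \<delta>2) \<Longrightarrow> q \<in> V \<and>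
      \<bar>fed q - fed p\<bar> < \<epsilon>"
    using coord_domain_continuous_box[OF dom p cont(2) \<epsilon>] by blast
  define h where "h = min \<delta>1 \<delta>2 / 2"
  have h: "h > 0" "h < \<delta>1" "h < \<delta>2" using \<delta>1(1) \<delta>2(1) by (auto simp: h_def min_def)
  define q where "q s t = p(d := s, e := t)" for s t
  let ?a = "p d" and ?b = "p e"
  have near: "q s t \<in> V \<and> \<bar>fde (q s t) - fde p\<bar> < \<epsilon> \<and> \<bar>fed (q s t) - fed p\<bar> < \<epsilon>"
    if "?a \<le> s" "s \<le> ?a + h" "?b \<le> t" "t \<le> ?b + h" for s t
    using \<delta>1(2)[of "q s t"] \<delta>2(2)[of "q s t"] that h d e ne by (auto simp: q_def)
  have [simp]: "(q s t)(e := t') = q s t'" "(q s t)(d := s') = q s' t" "q s t d = s" "q s t e = t"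
      for s t s' t'
    using ne by (auto simp: q_def fun_eq_iff)
  have der: "((\<lambda>s. f (q s t)) has_real_derivative fd (q s t)) (at s)"
    "((\<lambda>t. f (q s t)) has_real_derivative fe (q s t)) (at t)"
    "((\<lambda>t. fd (q s t)) has_real_derivative fde (q s t)) (at t)"
    "((\<lambda>s. fe (q s t)) has_real_derivative fed (q s t)) (at s)"
    if "?a \<le> s" "s \<le> ?a + h" "?b \<le> t" "t \<le> ?b + h" for s t
  proof -
    have "q s t \<in> V" using near[OF that] by blast
    note * = D[unfolded partial_deriv_def, rule_format, OF this]
    show "((\<lambda>s. f (q s t)) has_real_derivative fd (q s t)) (at s)"
      "((\<lambda>t. f (q s t)) has_real_derivative fe (q s t)) (at t)"
      "((\<lambda>t. fd (q s t)) has_real_derivative fde (q s t)) (at t)"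
      "((\<lambda>s. fe (q s t)) has_real_derivative fed (q s t)) (at s)"
      using * by simp_all
  qed
  \<comment> \<open>The second difference over the square with corner \<open>p\<close> and side \<open>h\<close>.\<close>
  let ?\<Delta> = "f (q (?a + h) (?b + h)) - f (q (?a + h) ?b) - (f (q ?a (?b + h)) - f (q ?a ?b))"
  have "\<exists>s t. ?a \<le> s \<and> s \<le> ?a + h \<and> ?b \<le> t \<and> t \<le> ?b + h \<and> ?\<Delta> = h * (h * fde (q s t))"
  proof -
    have "\<exists>s>?a. s < ?a + h \<and> (f (q (?a + h) (?b + h)) - f (q (?a + h) ?b)) - (f (q ?a (?b + h)) - f (q
        ?a ?b))
        = (?a + h - ?a) * (fd (q s (?b + h)) - fd (q s ?b))"
      using h by (intro MVT2[of ?a "?a + h" "\<lambda>s. f (q s (?b + h)) - f (q s ?b)"] DERIV_diff der) auto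
    then obtain s where s: "?a < s" "s < ?a + h" "?\<Delta> = h * (fd (q s (?b + h)) - fd (q s ?b))" by auto
    have "\<exists>t>?b. t < ?b + h \<and> fd (q s (?b + h)) - fd (q s ?b) = (?b + h - ?b) * fde (q s t)"
      using h s by (intro MVT2[of ?b "?b + h"] der) auto
    then obtain t where "?b < t" "t < ?b + h" "fd (q s (?b + h)) - fd (q s ?b) = h * fde (q s t)"
        by auto
    then show ?thesis using s by (intro exI[of _ s] exI[of _ t]) auto
  qed
  moreover have "\<exists>s t. ?a \<le> s \<and> s \<le> ?a + h \<and> ?b \<le> t \<and> t \<le> ?b + h \<and> ?\<Delta> = h * (h * fed (q s t))"
  proof -
    have "\<exists>t>?b. t < ?b + h \<and> (f (q (?a + h) (?b + h)) - f (q ?a (?b + h))) - (f (q (?a + h) ?b) - f (q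
        ?a ?b))
        = (?b + h - ?b) * (fe (q (?a + h) t) - fe (q ?a t))"
      using h by (intro MVT2[of ?b "?b + h" "\<lambda>t. f (q (?a + h) t) - f (q ?a t)"] DERIV_diff der) auto
    then obtain t where t: "?b < t" "t < ?b + h" "?\<Delta> = h * (fe (q (?a + h) t) - fe (q ?a t))" by auto
    have "\<exists>s>?a. s < ?a + h \<and> fe (q (?a + h) t) - fe (q ?a t) = (?a + h - ?a) * fed (q s t)"
      using h t by (intro MVT2[of ?a "?a + h"] der) auto
    then obtain s where "?a < s" "s < ?a + h" "fe (q (?a + h) t) - fe (q ?a t) = h * fed (q s t)"
        by auto
    then show ?thesis using t by (intro exI[of _ s] exI[of _ t]) auto
  qed
  ultimately obtain s t s' t' where
    "?a \<le> s" "s \<le> ?a + h" "?b \<le> t" "t \<le> ?b + h" "?a \<le> s'" "s' \<le> ?a + h" "?b \<le> t'" "t' \<le> ?b + h"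
    "h * (h * fde (q s t)) = h * (h * fed (q s' t'))" by metis
  moreover from this have "fde (q s t) = fed (q s' t')" using h(1) by simp
  ultimately have "\<bar>fed (q s' t') - fde p\<bar> < \<epsilon>" "\<bar>fed (q s' t') - fed p\<bar> < \<epsilon>"
    using near[of s t] near[of s' t'] by auto
  then show False
    using abs_triangle_ineq4[of "fed (q s' t') - fed p" "fed (q s' t') - fde p"] unfolding \<epsilon>_def by simp
qed

section \<open>Real-analytic functions in some of the variables\<close>

text \<open>
  Analyticity in the directions \<open>L\<close> while all other coordinates are frozen. Depending on \<open>L\<close> this is
  leafwise analyticity or joint analyticity.
\<close>

definition real_analytic_in :: "'d set \<Rightarrow> ('d \<Rightarrow> real) set \<Rightarrow> (('d \<Rightarrow> real) \<Rightarrow> real) \<Rightarrow> bool" where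
  "real_analytic_in L V f \<longleftrightarrow>
     (\<forall>p\<in>V. \<exists>e>0. \<exists>c. \<forall>x\<in>V. (\<forall>d. d \<notin> L \<longrightarrow> x d = p d) \<longrightarrow> (\<forall>d\<in>L. \<bar>x d - p d\<bar> < e) \<longrightarrow>
        ((\<lambda>\<alpha>. c \<alpha> * mon L (\<lambda>d. x d - p d) \<alpha>) has_sum f x) (mults L))"

text \<open>
  On an open set, convergence of the expansion at the corner of a small cube already gives absolute
  convergence with a finite norm, so the power series algebra applies.
\<close>

lemma real_analytic_in_iff:
  assumes dom: "coord_domain I T V" and L: "L \<subseteq> I \<union> T"
  shows "real_analytic_in L V f \<longleftrightarrow>
    (\<forall>p\<in>V. \<exists>\<rho>>0. \<exists>N. power_series_on L \<rho> N (\<lambda>u. f (\<lambda>d. p d + u d)))"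
  unfolding real_analytic_in_def
proof (rule ball_cong[OF refl], rule iffI)
  fix p assume p: "p \<in> V"
  assume "\<exists>e>0. \<exists>c. \<forall>x\<in>V. (\<forall>d. d \<notin> L \<longrightarrow> x d = p d) \<longrightarrow> (\<forall>d\<in>L. \<bar>x d - p d\<bar> < e) \<longrightarrow>
        ((\<lambda>\<alpha>. c \<alpha> * mon L (\<lambda>d. x d - p d) \<alpha>) has_sum f x) (mults L)"
  then obtain e c where e: "e > 0" and c: "\<And>x. x \<in> V \<Longrightarrow> (\<forall>d. d \<notin> L \<longrightarrow> x d = p d) \<Longrightarrow>
      (\<forall>d\<in>L. \<bar>x d - p d\<bar> < e) \<Longrightarrow>
        ((\<lambda>\<alpha>. c \<alpha> * mon L (\<lambda>d. x d - p d) \<alpha>) has_sum f x) (mults L)" by blast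
  obtain \<delta> where \<delta>: "\<delta> > 0" "\<And>q. (\<forall>d. d \<notin> I \<union> T \<longrightarrow> q d = p d) \<Longrightarrow> (\<forall>d\<in>I \<union> T. \<bar>q d - p d\<bar> < \<delta>) \<Longrightarrow> q \<in> V"
    using coord_domain_box[OF dom p] by blast
  define \<rho> where "\<rho> = min e \<delta> / 2"
  have \<rho>: "\<rho> > 0" "\<rho> < e" "\<rho> < \<delta>" using e \<delta>(1) by (auto simp: \<rho>_def min_def)
  have sum: "((\<lambda>\<alpha>. c \<alpha> * mon L u \<alpha>) has_sum f (\<lambda>d. p d + u d)) (mults L)" if u: "u \<in> cube L \<rho>" for u
  proof -
    have "\<bar>u d\<bar> < \<delta>" for d
      using u \<rho> \<delta>(1) by (cases "d \<in> L") (force simp: cube_def)+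
    then have "(\<lambda>d. p d + u d) \<in> V"
      using u L by (intro \<delta>(2)) (auto simp: cube_def)
    from c[OF this] show ?thesis using u \<rho> by (force simp: cube_def)
  qed
  \<comment> \<open>At the corner \<open>u0\<close> of the cube, convergence of the real series is absolute convergence.\<close>
  define u0 where "u0 d = (if d \<in> L then \<rho> else 0)" for d
  have "u0 \<in> cube L \<rho>" using \<rho> by (auto simp: u0_def cube_def)
  from has_sum_imp_summable[OF sum[OF this]]
  have "(\<lambda>\<alpha>. \<bar>c \<alpha> * mon L u0 \<alpha>\<bar>) summable_on mults L"
    by (subst (asm) summable_on_iff_abs_summable_on_real) simp
  moreover have "mon L u0 \<alpha> = \<rho> ^ deg L \<alpha>" for \<alpha>
    by (simp add: mon_def u0_def power_sum)
  ultimately have "(\<lambda>\<alpha>. \<bar>c \<alpha>\<bar> * \<rho> ^ deg L \<alpha>) summable_on mults L"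
    using \<rho> by (simp add: abs_mult)
  then obtain M where "((\<lambda>\<alpha>. \<bar>c \<alpha>\<bar> * \<rho> ^ deg L \<alpha>) has_sum M) (mults L)"
    unfolding summable_on_def by blast
  then have "power_series_on L \<rho> M (\<lambda>u. f (\<lambda>d. p d + u d))"
    unfolding power_series_on_def using sum by blast
  then show "\<exists>\<rho>>0. \<exists>N. power_series_on L \<rho> N (\<lambda>u. f (\<lambda>d. p d + u d))"
    using \<rho>(1) by blast
next
  fix p assume p: "p \<in> V"
  assume "\<exists>\<rho>>0. \<exists>N. power_series_on L \<rho> N (\<lambda>u. f (\<lambda>d. p d + u d))"
  then obtain \<rho> c where \<rho>: "\<rho> > 0"
    and c: "\<And>u. u \<in> cube L \<rho> \<Longrightarrow> ((\<lambda>\<alpha>. c \<alpha> * mon L u \<alpha>) has_sum f (\<lambda>d. p d + u d)) (mults L)"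
    unfolding power_series_on_def by blast
  have "((\<lambda>\<alpha>. c \<alpha> * mon L (\<lambda>d. x d - p d) \<alpha>) has_sum f x) (mults L)"
    if "\<forall>d. d \<notin> L \<longrightarrow> x d = p d" "\<forall>d\<in>L. \<bar>x d - p d\<bar> < \<rho>" for x
    using c[of "\<lambda>d. x d - p d"] that by (simp add: cube_def less_imp_le)
  then show "\<exists>e>0. \<exists>c. \<forall>x\<in>V. (\<forall>d. d \<notin> L \<longrightarrow> x d = p d) \<longrightarrow> (\<forall>d\<in>L. \<bar>x d - p d\<bar> < e) \<longrightarrow>
        ((\<lambda>\<alpha>. c \<alpha> * mon L (\<lambda>d. x d - p d) \<alpha>) has_sum f x) (mults L)"
    using \<rho> by blast
qed

lemma real_analytic_in_leafwise_const:
  assumes "\<And>p q. p \<in> V \<Longrightarrow> q \<in> V \<Longrightarrow> (\<forall>d. d \<notin> L \<longrightarrow> p d = q d) \<Longrightarrow> f p = f q"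
  shows "real_analytic_in L V f"
  unfolding real_analytic_in_def
proof
  fix p assume p: "p \<in> V"
  have "((\<lambda>\<alpha>. (if \<alpha> = (\<lambda>_. 0) then f p else 0) * mon L (\<lambda>d. x d - p d) \<alpha>) has_sum f x) (mults L)"
    if "x \<in> V" "\<forall>d. d \<notin> L \<longrightarrow> x d = p d" for x
  proof (rule has_sum_finite_neutralI[of "{\<lambda>_. 0}"])
    show "f x = (\<Sum>\<alpha>\<in>{\<lambda>_. 0}. (if \<alpha> = (\<lambda>_. 0) then f p else 0) * mon L (\<lambda>d. x d - p d) \<alpha>)"
      using assms[of x p] that p by (simp add: mon_def)
  qed (auto simp: mults_def)
  then show "\<exists>e>0. \<exists>c. \<forall>x\<in>V. (\<forall>d. d \<notin> L \<longrightarrow> x d = p d) \<longrightarrow> (\<forall>d\<in>L. \<bar>x d - p d\<bar> < e) \<longrightarrow>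
        ((\<lambda>\<alpha>. c \<alpha> * mon L (\<lambda>d. x d - p d) \<alpha>) has_sum f x) (mults L)"
    by (intro exI[of _ "1::real"] conjI exI[of _ "\<lambda>\<alpha>. if \<alpha> = (\<lambda>_. 0) then f p else 0"]) auto
qed

lemma real_analytic_in_add:
  assumes dom: "coord_domain I T V" and L: "L \<subseteq> I \<union> T"
    and "real_analytic_in L V f" "real_analytic_in L V g"
  shows "real_analytic_in L V (\<lambda>p. f p + g p)"
  unfolding real_analytic_in_iff[OF dom L]
proof
  fix p assume p: "p \<in> V"
  obtain \<rho> N where f: "\<rho> > 0" "power_series_on L \<rho> N (\<lambda>u. f (\<lambda>d. p d + u d))"
    using assms(3) p unfolding real_analytic_in_iff[OF dom L] by blast
  obtain \<rho>' N' where g: "\<rho>' > 0" "power_series_on L \<rho>' N' (\<lambda>u. g (\<lambda>d. p d + u d))"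
    using assms(4) p unfolding real_analytic_in_iff[OF dom L] by blast
  have m: "0 < min \<rho> \<rho>'" "min \<rho> \<rho>' \<le> \<rho>" "min \<rho> \<rho>' \<le> \<rho>'" using f(1) g(1) by auto
  show "\<exists>\<rho>>0. \<exists>N. power_series_on L \<rho> N (\<lambda>u. f (\<lambda>d. p d + u d) + g (\<lambda>d. p d + u d))"
    using power_series_on_add[OF m(1) power_series_on_restrict[OF m(1) m(2) f(2)]
        power_series_on_restrict[OF m(1) m(3) g(2)]] m(1) by blast
qed

lemma real_analytic_in_mult:
  assumes dom: "coord_domain I T V" and L: "L \<subseteq> I \<union> T"
    and "real_analytic_in L V f" "real_analytic_in L V g"
  shows "real_analytic_in L V (\<lambda>p. f p * g p)"
  unfolding real_analytic_in_iff[OF dom L]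
proof
  fix p assume p: "p \<in> V"
  obtain \<rho> N where f: "\<rho> > 0" "power_series_on L \<rho> N (\<lambda>u. f (\<lambda>d. p d + u d))"
    using assms(3) p unfolding real_analytic_in_iff[OF dom L] by blast
  obtain \<rho>' N' where g: "\<rho>' > 0" "power_series_on L \<rho>' N' (\<lambda>u. g (\<lambda>d. p d + u d))"
    using assms(4) p unfolding real_analytic_in_iff[OF dom L] by blast
  have m: "0 < min \<rho> \<rho>'" "min \<rho> \<rho>' \<le> \<rho>" "min \<rho> \<rho>' \<le> \<rho>'" using f(1) g(1) by auto
  show "\<exists>\<rho>>0. \<exists>N. power_series_on L \<rho> N (\<lambda>u. f (\<lambda>d. p d + u d) * g (\<lambda>d. p d + u d))"
    using power_series_on_mult[OF m(1) power_series_on_restrict[OF m(1) m(2) f(2)]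
        power_series_on_restrict[OF m(1) m(3) g(2)]] m(1) by blast
qed

lemma coord_domain_finite: "coord_domain I T V \<Longrightarrow> L \<subseteq> I \<union> T \<Longrightarrow> finite L"
  unfolding coord_domain_def by (meson finite_Un finite_subset)

lemma real_analytic_in_partial_deriv:
  assumes dom: "coord_domain I T V" and L: "L \<subseteq> I \<union> T" and d: "d \<in> L"
    and f: "real_analytic_in L V f" and D: "partial_deriv d V f g"
  shows "real_analytic_in L V g"
  unfolding real_analytic_in_iff[OF dom L]
proof
  fix p assume p: "p \<in> V"
  obtain \<rho>0 N where f: "\<rho>0 > 0" "power_series_on L \<rho>0 N (\<lambda>u. f (\<lambda>d. p d + u d))"
    using f p unfolding real_analytic_in_iff[OF dom L] by blast
  obtain \<delta> where \<delta>: "\<delta> > 0" "\<And>q. (\<forall>d. d \<notin> I \<union> T \<longrightarrow> q d = p d) \<Longrightarrow> (\<forall>d\<in>I \<union> T. \<bar>q d - p d\<bar> < \<delta>) \<Longrightarrow> q \<in> V"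
    using coord_domain_box[OF dom p] by blast
  define \<rho> where "\<rho> = min \<rho>0 \<delta>"
  have \<rho>: "\<rho> > 0" "\<rho> \<le> \<rho>0" "\<rho> \<le> \<delta>" using f(1) \<delta>(1) by (auto simp: \<rho>_def)
  have "\<exists>N'. power_series_on L (\<rho> / 8) N' (\<lambda>u. g (\<lambda>d. p d + u d))"
  proof (rule power_series_on_deriv[OF coord_domain_finite[OF dom L] \<rho>(1) power_series_on_restrict[OF
      \<rho>(1,2) f(2)] d])
    fix u assume u: "u \<in> cube L (\<rho> / 8)"
    have "\<bar>u d\<bar> < \<delta>" for d
      using u \<rho> \<delta>(1) by (cases "d \<in> L") (force simp: cube_def)+
    then have "(\<lambda>d. p d + u d) \<in> V"
      using u L by (intro \<delta>(2)) (auto simp: cube_def)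
    then have "((\<lambda>t. f ((\<lambda>d. p d + u d)(d := t))) has_real_derivative g (\<lambda>d. p d + u d)) (at (p d + u
        d))"
      using D unfolding partial_deriv_def by blast
    then have "((\<lambda>t. f ((\<lambda>d. p d + u d)(d := t + p d))) has_real_derivative g (\<lambda>d. p d + u d)) (at (u
        d))"
      using DERIV_shift[of "\<lambda>t. f ((\<lambda>d. p d + u d)(d := t))" _ "u d" "p d"] by (simp add: add.commute)
    moreover have "(\<lambda>d. p d + u d)(d := t + p d) = (\<lambda>e. p e + (u(d := t)) e)" for t
      by (auto simp: fun_eq_iff)
    ultimately show "((\<lambda>t. f (\<lambda>e. p e + (u(d := t)) e)) has_real_derivative g (\<lambda>d. p d + u d)) (at (u
        d))"
      by simp
  qed
  then show "\<exists>\<rho>>0. \<exists>N. power_series_on L \<rho> N (\<lambda>u. g (\<lambda>d. p d + u d))"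
    using \<rho>(1) by (intro exI[of _ "\<rho> / 8"]) auto
qed

lemma finite_common_bound:
  fixes r :: "'d \<Rightarrow> real"
  assumes "finite A" "\<And>d. d \<in> A \<Longrightarrow> r d > 0"
  shows "\<exists>\<rho>>0. \<forall>d\<in>A. \<rho> \<le> r d"
  using assms by (intro exI[of _ "Min (insert 1 (r ` A))"]) auto

text \<open>
  Coordinates of \<open>F\<close> outside \<open>L'\<close> do not move, so they can be frozen in the expansion of \<open>g\<close>. The other
  coordinates, minus their values at the centre, are made small by shrinking the cube and substituted.
\<close>

lemma real_analytic_in_compose:
  fixes F :: "('c \<Rightarrow> real) \<Rightarrow> 'd \<Rightarrow> real"
  assumes dom: "coord_domain I T V" and L: "L \<subseteq> I \<union> T"
    and dom': "coord_domain I' T' V'" and L': "L' \<subseteq> I' \<union> T'"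
    and FV: "\<And>p. p \<in> V \<Longrightarrow> F p \<in> V'"
    and g: "real_analytic_in L' V' g"
    and F: "\<And>d. d \<in> L' \<Longrightarrow> real_analytic_in L V (\<lambda>p. F p d)"
    and const: "\<And>p q d. p \<in> V \<Longrightarrow> q \<in> V \<Longrightarrow> (\<forall>e. e \<notin> L \<longrightarrow> p e = q e) \<Longrightarrow> d \<notin> L' \<Longrightarrow> F p d = F q d"
  shows "real_analytic_in L V (\<lambda>p. g (F p))"
  unfolding real_analytic_in_iff[OF dom L]
proof
  fix p assume p: "p \<in> V"
  have finL: "finite L" and finL': "finite L'"
    using coord_domain_finite[OF dom L] coord_domain_finite[OF dom' L'] by auto
  obtain \<sigma> N where \<sigma>: "\<sigma> > 0" "power_series_on L' \<sigma> N (\<lambda>u. g (\<lambda>d. F p d + u d))"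
    using g FV[OF p] unfolding real_analytic_in_iff[OF dom' L'] by blast
  have "\<exists>\<rho>>0. power_series_on L \<rho> \<sigma> (\<lambda>u. F (\<lambda>e. p e + u e) d - F p d)" if d: "d \<in> L'" for d
  proof -
    obtain \<rho> M where \<rho>: "\<rho> > 0" "power_series_on L \<rho> M (\<lambda>u. F (\<lambda>e. p e + u e) d)"
      using F[OF d] p unfolding real_analytic_in_iff[OF dom L] by blast
    define M' where "M' = \<bar>M\<bar> + \<bar>- F p d\<bar> + 1"
    have "power_series_on L \<rho> M' (\<lambda>u. F (\<lambda>e. p e + u e) d + - F p d)"
      by (rule power_series_on_mono[OF power_series_on_add[OF \<rho> power_series_on_const[OF \<rho>(1)]]])
        (auto simp: M'_def)
    then have ps: "power_series_on L \<rho> M' (\<lambda>u. F (\<lambda>e. p e + u e) d - F p d)" by simp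
    \<comment> \<open>The factor by which the cube is shrunk, so that the norm \<open>t * M'\<close> is at most the radius \<open>\<sigma>\<close>.\<close>
    define t where "t = min 1 (\<sigma> / M')"
    have M': "M' > 0" by (auto simp: M'_def)
    have t: "0 < t" "t \<le> 1" "t * M' \<le> \<sigma>"
      using \<sigma>(1) M' by (auto simp: t_def min_def field_simps)
    have "power_series_on L (t * \<rho>) (t * M') (\<lambda>u. F (\<lambda>e. p e + u e) d - F p d)"
      by (rule power_series_on_shrink[OF finL \<rho>(1) ps _ t(1,2)]) simp
    then show ?thesis using t \<rho>(1) power_series_on_mono
      by (intro exI[of _ "t * \<rho>"]) auto
  qed
  then obtain r where r: "\<And>d. d \<in> L' \<Longrightarrow> r d > 0"
    "\<And>d. d \<in> L' \<Longrightarrow> power_series_on L (r d) \<sigma> (\<lambda>u. F (\<lambda>e. p e + u e) d - F p d)" by metis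
  obtain \<rho>0 where \<rho>0: "\<rho>0 > 0" "\<And>d. d \<in> L' \<Longrightarrow> \<rho>0 \<le> r d"
    using finite_common_bound[of L' r] finL' r(1) by blast
  obtain \<delta> where \<delta>: "\<delta> > 0" "\<And>q. (\<forall>d. d \<notin> I \<union> T \<longrightarrow> q d = p d) \<Longrightarrow> (\<forall>d\<in>I \<union> T. \<bar>q d - p d\<bar> < \<delta>) \<Longrightarrow> q \<in> V"
    using coord_domain_box[OF dom p] by blast
  define \<rho> where "\<rho> = min \<rho>0 (\<delta> / 2)"
  have \<rho>: "\<rho> > 0" "\<rho> < \<delta>" "\<And>d. d \<in> L' \<Longrightarrow> \<rho> \<le> r d"
    using \<rho>0 \<delta>(1) by (force simp: \<rho>_def)+
  define \<phi> where "\<phi> u d = (if d \<in> L' then F (\<lambda>e. p e + u e) d - F p d else 0)" for u d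
  have \<phi>: "power_series_on L \<rho> \<sigma> (\<lambda>u. \<phi> u d)" if "d \<in> L'" for d
    using power_series_on_restrict[OF \<rho>(1) \<rho>(3) r(2)] that by (simp add: \<phi>_def)
  have "power_series_on L \<rho> N (\<lambda>u. g (\<lambda>d. F p d + \<phi> u d))"
  proof (rule power_series_on_compose[OF \<rho>(1) finL' \<sigma>(2) \<phi>])
    show "\<phi> u \<in> cube L' \<sigma>" if "u \<in> cube L \<rho>" for u
      using power_series_on_bound[OF \<rho>(1) \<phi> that] by (auto simp: cube_def) (simp add: \<phi>_def)
  qed
  then have "power_series_on L \<rho> N (\<lambda>u. g (F (\<lambda>e. p e + u e)))"
  proof (rule power_series_on_cong)
    fix u assume u: "u \<in> cube L \<rho>"
    have "\<bar>u d\<bar> < \<delta>" for d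
      using u \<rho> \<delta>(1) by (cases "d \<in> L") (force simp: cube_def)+
    then have V: "(\<lambda>d. p d + u d) \<in> V"
      using u L by (intro \<delta>(2)) (auto simp: cube_def)
    have "F p d = F (\<lambda>e. p e + u e) d" if "d \<notin> L'" for d
      by (rule const[OF p V _ that]) (use u in \<open>auto simp: cube_def\<close>)
    then have "(\<lambda>d. F p d + \<phi> u d) = F (\<lambda>e. p e + u e)"
      by (auto simp: \<phi>_def fun_eq_iff)
    then show "g (\<lambda>d. F p d + \<phi> u d) = g (F (\<lambda>e. p e + u e))" by simp
  qed
  then show "\<exists>\<rho>>0. \<exists>N. power_series_on L \<rho> N (\<lambda>u. g (F (\<lambda>d. p d + u d)))"
    using \<rho>(1) by blast
qed

section \<open>Functions with two budgets of derivatives\<close>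

definition base_regular :: "'d set \<Rightarrow> bool \<Rightarrow> ('d \<Rightarrow> real) set \<Rightarrow> (('d \<Rightarrow> real) \<Rightarrow> real) \<Rightarrow> bool" where
  "base_regular L an V f \<longleftrightarrow> continuous_on V f \<and> (an \<longrightarrow> real_analytic_in L V f)"

text \<open>
  At most \<open>a\<close> derivatives in total, of which at most \<open>b\<close> are transversal, exist and are continuous; with the
  flag \<open>an\<close> all of them are moreover analytic along the leaves. Unlike a family of partial derivatives
  indexed by multi-indices, this form can be established for a composite by one application of the
  chain rule in each step.
\<close>

primrec regular_to_order ::
    "'d set \<Rightarrow> 'd set \<Rightarrow> bool \<Rightarrow> ('d \<Rightarrow> real) set \<Rightarrow> nat \<Rightarrow> nat \<Rightarrow> (('d \<Rightarrow> real) \<Rightarrow> real) \<Rightarrow> bool" where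
  "regular_to_order L T an V 0 = (\<lambda>b f. base_regular L an V f)"
| "regular_to_order L T an V (Suc a) = (\<lambda>b f. base_regular L an V f \<and>
     (\<forall>d\<in>L. \<exists>g. partial_deriv d V f g \<and> regular_to_order L T an V a b g) \<and>
     (\<forall>d\<in>T. 0 < b \<longrightarrow> (\<exists>g. partial_deriv d V f g \<and> regular_to_order L T an V a (b - 1) g)))"

lemma regular_imp_base: "regular_to_order L T an V a b f \<Longrightarrow> base_regular L an V f"
  by (cases a) auto

lemma regular_mono:
  assumes "regular_to_order L T an V a b f" "a' \<le> a" "b' \<le> b"
  shows "regular_to_order L T an V a' b' f"
  using assms
proof (induction a' arbitrary: a b b' f)
  case 0 then show ?case using regular_imp_base by auto
next
  case (Suc a')
  then obtain a0 where a: "a = Suc a0" "a' \<le> a0" by (cases a) auto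
  have f: "base_regular L an V f"
    "\<And>d. d \<in> L \<Longrightarrow> \<exists>g. partial_deriv d V f g \<and> regular_to_order L T an V a0 b g"
    "\<And>d. d \<in> T \<Longrightarrow> 0 < b \<Longrightarrow> \<exists>g. partial_deriv d V f g \<and> regular_to_order L T an V a0 (b - 1) g"
    using Suc.prems(1) unfolding a by auto
  show ?case
    unfolding regular_to_order.simps
  proof (intro conjI ballI impI)
    fix d assume "d \<in> L" then show "\<exists>g. partial_deriv d V f g \<and> regular_to_order L T an V a' b' g"
      using f(2) Suc.IH a(2) Suc.prems(3) by blast
  next
    fix d assume d: "d \<in> T" "0 < b'"
    then have "0 < b" "b' - 1 \<le> b - 1" using Suc.prems(3) by auto
    then show "\<exists>g. partial_deriv d V f g \<and> regular_to_order L T an V a' (b' - 1) g"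
      using f(3)[OF d(1)] Suc.IH a(2) by blast
  qed (rule f(1))
qed

lemma base_regular_cong:
  assumes "\<And>p. p \<in> V \<Longrightarrow> f p = f' p"
  shows "base_regular L an V f \<longleftrightarrow> base_regular L an V f'"
proof -
  have "continuous_on V f \<longleftrightarrow> continuous_on V f'" by (rule continuous_on_cong) (use assms in auto)
  moreover have "real_analytic_in L V f \<longleftrightarrow> real_analytic_in L V f'"
    using assms unfolding real_analytic_in_def by simp
  ultimately show ?thesis by (simp add: base_regular_def)
qed

lemma regular_cong:
  assumes dom: "coord_domain L T V" and eq: "\<And>p. p \<in> V \<Longrightarrow> f p = f' p"
  shows "regular_to_order L T an V a b f \<longleftrightarrow> regular_to_order L T an V a b f'"
proof (cases a)
  case (Suc a')
  have "partial_deriv d V f g \<longleftrightarrow> partial_deriv d V f' g" if "d \<in> L \<union> T" for d g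
    by (rule partial_deriv_cong[OF dom that eq]) auto
  then show ?thesis using base_regular_cong[of V f f' L an] eq Suc by auto
qed (use base_regular_cong[of V f f' L an] eq in auto)

lemma regular_const: "regular_to_order L T an V a b (\<lambda>_. k)"
proof (induction a arbitrary: b k)
  case 0 then show ?case by (auto simp: base_regular_def real_analytic_in_leafwise_const)
next
  case (Suc a)
  have "partial_deriv d V (\<lambda>_. k) (\<lambda>_. 0)" for d :: 'a
    by (simp add: partial_deriv_def)
  then show ?case
    using Suc by (auto simp: base_regular_def real_analytic_in_leafwise_const)
qed

lemma regular_add:
  assumes dom: "coord_domain L T V"
  shows "regular_to_order L T an V a b f \<Longrightarrow> regular_to_order L T an V a b g \<Longrightarrow>
    regular_to_order L T an V a b (\<lambda>p. f p + g p)"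
proof (induction a arbitrary: b f g)
  case 0 then show ?case
    using real_analytic_in_add[OF dom, of L] by (auto simp: base_regular_def intro: continuous_on_add)
next
  case (Suc a)
  have base: "base_regular L an V (\<lambda>p. f p + g p)"
    using Suc.prems real_analytic_in_add[OF dom, of L]
        by (auto simp: base_regular_def intro: continuous_on_add)
  have D: "partial_deriv d V (\<lambda>p. f p + g p) (\<lambda>p. f' p + g' p)"
    if "partial_deriv d V f f'" "partial_deriv d V g g'" for d f' g'
    using that unfolding partial_deriv_def by (auto intro: DERIV_add)
  show ?case
    unfolding regular_to_order.simps
  proof (intro conjI ballI impI base)
    fix d assume "d \<in> L"
    then obtain f' g' where "partial_deriv d V f f'" "partial_deriv d V g g'"
      "regular_to_order L T an V a b f'" "regular_to_order L T an V a b g'"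
          using Suc.prems by (auto 0 3)
    then show "\<exists>h. partial_deriv d V (\<lambda>p. f p + g p) h \<and> regular_to_order L T an V a b h"
      using D Suc.IH by blast
  next
    fix d assume "d \<in> T" "0 < b"
    then obtain f' g' where "partial_deriv d V f f'" "partial_deriv d V g g'"
      "regular_to_order L T an V a (b - 1) f'" "regular_to_order L T an V a (b - 1) g'"
      using Suc.prems by (auto 0 3)
    then show "\<exists>h. partial_deriv d V (\<lambda>p. f p + g p) h \<and> regular_to_order L T an V a (b - 1) h"
      using D Suc.IH by blast
  qed
qed

lemma regular_mult:
  assumes dom: "coord_domain L T V"
  shows "regular_to_order L T an V a b f \<Longrightarrow> regular_to_order L T an V a b g \<Longrightarrow>
    regular_to_order L T an V a b (\<lambda>p. f p * g p)"
proof (induction a arbitrary: b f g)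
  case 0 then show ?case
    using real_analytic_in_mult[OF dom, of L] by (auto simp: base_regular_def intro: continuous_on_mult)
next
  case (Suc a)
  have base: "base_regular L an V (\<lambda>p. f p * g p)"
    using Suc.prems real_analytic_in_mult[OF dom, of L]
        by (auto simp: base_regular_def intro: continuous_on_mult)
  have D: "partial_deriv d V (\<lambda>p. f p * g p) (\<lambda>p. f' p * g p + f p * g' p)"
    if "partial_deriv d V f f'" "partial_deriv d V g g'" for d f' g'
    unfolding partial_deriv_def
  proof
    fix p assume "p \<in> V"
    with that have "((\<lambda>t. f (p(d := t))) has_real_derivative f' p) (at (p d))"
      "((\<lambda>t. g (p(d := t))) has_real_derivative g' p) (at (p d))" by (auto simp: partial_deriv_def)
    from DERIV_mult[OF this]
    show "((\<lambda>t. f (p(d := t)) * g (p(d := t))) has_real_derivative f' p * g p + f p * g' p) (at (p d))"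
      by (simp add: mult.commute add.commute)
  qed
  have R: "regular_to_order L T an V a b' (\<lambda>p. f' p * g p + f p * g' p)"
    if "regular_to_order L T an V a b' f'" "regular_to_order L T an V a b' g'" "b' \<le> b" for b' f' g'
    by (intro regular_add[OF dom] Suc.IH that regular_mono[OF Suc.prems(1)] regular_mono[OF
        Suc.prems(2)]) (use that in auto)
  show ?case
    unfolding regular_to_order.simps
  proof (intro conjI ballI impI base)
    fix d assume "d \<in> L"
    then obtain f' g' where "partial_deriv d V f f'" "partial_deriv d V g g'"
      "regular_to_order L T an V a b f'" "regular_to_order L T an V a b g'"
          using Suc.prems by (auto 0 3)
    then show "\<exists>h. partial_deriv d V (\<lambda>p. f p * g p) h \<and> regular_to_order L T an V a b h"
      using D R by blast
  next
    fix d assume "d \<in> T" "0 < b"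
    then obtain f' g' where "partial_deriv d V f f'" "partial_deriv d V g g'"
      "regular_to_order L T an V a (b - 1) f'" "regular_to_order L T an V a (b - 1) g'"
      using Suc.prems by (auto 0 3)
    then show "\<exists>h. partial_deriv d V (\<lambda>p. f p * g p) h \<and> regular_to_order L T an V a (b - 1) h"
      using D R[of "b - 1"] by (metis diff_le_self)
  qed
qed

lemma regular_sum:
  assumes dom: "coord_domain L T V" and "finite J"
    and "\<And>e. e \<in> J \<Longrightarrow> regular_to_order L T an V a b (f e)"
  shows "regular_to_order L T an V a b (\<lambda>p. \<Sum>e\<in>J. f e p)"
  using assms(2,3)
proof (induction J rule: finite_induct)
  case empty then show ?case by (simp add: regular_const)
next
  case (insert x F)
  then show ?case using regular_add[OF dom, of an a b "f x"] by simp
qed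

text \<open>
  The hypothesis \<open>const\<close> says that \<open>F\<close> maps leaves to leaves. A leaf derivative of \<open>g \<circ> F\<close> then involves leaf
  derivatives of \<open>g\<close> only and uses no transversal budget. A transversal derivative involves all
  derivatives of \<open>g\<close>, and those in leaf directions have transversal budget to spare.
\<close>

lemma regular_compose:
  fixes F :: "('c \<Rightarrow> real) \<Rightarrow> 'd \<Rightarrow> real"
  assumes dom: "coord_domain L T V" and dom': "coord_domain L' T' V'"
    and FV: "\<And>p. p \<in> V \<Longrightarrow> F p \<in> V'"
    and const: "\<And>p q d. p \<in> V \<Longrightarrow> q \<in> V \<Longrightarrow> (\<forall>e. e \<notin> L \<longrightarrow> p e = q e) \<Longrightarrow> d \<notin> L' \<Longrightarrow> F p d = F q d"
  shows "regular_to_order L' T' an V' a b g \<Longrightarrow>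
     (\<And>d. d \<in> L' \<union> T' \<Longrightarrow> regular_to_order L T an V a b (\<lambda>p. F p d)) \<Longrightarrow>
     regular_to_order L T an V a b (\<lambda>p. g (F p))"
proof (induction a arbitrary: b g)
  case 0
  then have g: "base_regular L' an V' g" and F: "\<And>d. d \<in> L' \<union> T' \<Longrightarrow> base_regular L an V (\<lambda>p. F p d)"
      by auto
  have "base_regular L an V (\<lambda>p. g (F p))"
    unfolding base_regular_def
  proof (intro conjI impI)
    have "continuous_on V (\<lambda>p. F p d)" for d
    proof (cases "d \<in> L' \<union> T'")
      case True then show ?thesis using F by (auto simp: base_regular_def)
    next
      case False
      then have "continuous_on V (\<lambda>p. F p d) \<longleftrightarrow> continuous_on V (\<lambda>_. 0 :: real)"
        using coord_domain_subset[OF dom'] FV by (intro continuous_on_cong) auto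
      then show ?thesis by simp
    qed
    then have "continuous_on V F" by (rule continuous_on_coordinatewise_then_product)
    then show "continuous_on V (\<lambda>p. g (F p))"
      using continuous_on_compose2[of V' g V F] g FV by (simp add: base_regular_def image_subset_iff)
    assume an
    show "real_analytic_in L V (\<lambda>p. g (F p))"
    proof (rule real_analytic_in_compose[where F = F and g = g, OF dom Un_upper1 dom' Un_upper1])
      show "F p \<in> V'" if "p \<in> V" for p by (rule FV[OF that])
      show "F p d = F q d" if "p \<in> V" "q \<in> V" "\<forall>e. e \<notin> L \<longrightarrow> p e = q e" "d \<notin> L'" for p q d
        by (rule const[OF that])
      show "real_analytic_in L' V' g" using g \<open>an\<close> by (simp add: base_regular_def)
      show "real_analytic_in L V (\<lambda>p. F p d)" if "d \<in> L'" for d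
        using F[of d] that \<open>an\<close> by (simp add: base_regular_def)
    qed
  qed
  then show ?case by simp
next
  case (Suc a)
  have g: "base_regular L' an V' g"
    "\<And>d. d \<in> L' \<Longrightarrow> \<exists>h. partial_deriv d V' g h \<and> regular_to_order L' T' an V' a b h"
    "\<And>d. d \<in> T' \<Longrightarrow> 0 < b \<Longrightarrow> \<exists>h. partial_deriv d V' g h \<and> regular_to_order L' T' an V' a (b - 1) h"
    using Suc.prems(1) by auto
  have F: "\<And>d e. d \<in> L \<Longrightarrow> e \<in> L' \<union> T' \<Longrightarrow> \<exists>h. partial_deriv d V (\<lambda>p. F p e) h \<and>
      regular_to_order L T an V a b h"
    "\<And>d e. d \<in> T \<Longrightarrow> 0 < b \<Longrightarrow> e \<in> L' \<union> T' \<Longrightarrow> \<exists>h. partial_deriv d V (\<lambda>p. F p e) h \<and>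
        regular_to_order L T an V a (b - 1) h"
    using Suc.prems(2) by auto
  have fin: "finite L'" "finite T'" using dom' by (auto simp: coord_domain_def)
  have "regular_to_order L T an V a b (\<lambda>p. g (F p))"
    by (rule Suc.IH[OF regular_mono[OF Suc.prems(1)] regular_mono[OF Suc.prems(2)]]) simp_all
  then have base: "base_regular L an V (\<lambda>p. g (F p))" by (rule regular_imp_base)
  have R: "regular_to_order L T an V a b' (\<lambda>p. \<Sum>e\<in>J. g' e (F p) * F' e p)"
    if "finite J" "b' \<le> b" "\<And>e. e \<in> J \<Longrightarrow> regular_to_order L' T' an V' a b' (g' e)"
      "\<And>e. e \<in> J \<Longrightarrow> regular_to_order L T an V a b' (F' e)" for J b' g' F'
  proof (rule regular_sum[OF dom that(1)], rule regular_mult[OF dom _ that(4)])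
    fix e assume "e \<in> J"
    show "regular_to_order L T an V a b' (\<lambda>p. g' e (F p))"
      by (rule Suc.IH[OF that(3)[OF \<open>e \<in> J\<close>] regular_mono[OF Suc.prems(2)]]) (use that(2) in simp_all)
  qed
  show ?case
    unfolding regular_to_order.simps
  proof (intro conjI ballI impI base)
    fix d assume d: "d \<in> L"
    then have dLT: "d \<in> L \<union> T" by simp
    obtain g' where g': "\<And>e. e \<in> L' \<Longrightarrow> partial_deriv e V' g (g' e)"
        "\<And>e. e \<in> L' \<Longrightarrow> regular_to_order L' T' an V' a b (g' e)"
      using g(2) by metis
    obtain F' where F': "\<And>e. e \<in> L' \<Longrightarrow> partial_deriv d V (\<lambda>p. F p e) (F' e)"
        "\<And>e. e \<in> L' \<Longrightarrow> regular_to_order L T an V a b (F' e)"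
      using F(1)[OF d] by (metis UnI1)
    have "partial_deriv d V (\<lambda>p. g (F p)) (\<lambda>p. \<Sum>e\<in>L'. g' e (F p) * F' e p)"
      unfolding partial_deriv_def
    proof
      fix p assume p: "p \<in> V"
      have "((\<lambda>t. g (F (p(d := t)))) has_real_derivative (\<Sum>e\<in>L'. g' e (F (p(d := p d))) * F' e p)) (at
          (p d))"
      proof (rule chain_rule_along_curve[where c = "\<lambda>t. F (p(d := t))" and g = g, OF dom' fin(1)])
        show "\<forall>\<^sub>F t in nhds (p d). \<forall>e. e \<notin> L' \<longrightarrow> F (p(d := t)) e = F (p(d := p d)) e"
          using coord_domain_line[OF dom p dLT]
        proof eventually_elim
          case (elim t)
          have "F (p(d := t)) e = F (p(d := p d)) e" if "e \<notin> L'" for e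
            by (rule const[OF elim _ _ that]) (use p d in auto)
          then show ?case by blast
        qed
        show "((\<lambda>t. F (p(d := t)) e) has_real_derivative F' e p) (at (p d))" if "e \<in> L'" for e
          using F'(1)[OF that] p by (simp add: partial_deriv_def)
        show "continuous_on V' (g' e)" if "e \<in> L'" for e
          using regular_imp_base[OF g'(2)[OF that]] by (simp add: base_regular_def)
      qed (use g' FV p in auto)
      then show "((\<lambda>t. g (F (p(d := t)))) has_real_derivative (\<Sum>e\<in>L'. g' e (F p) * F' e p)) (at (p d))"
          by simp
    qed
    moreover have "regular_to_order L T an V a b (\<lambda>p. \<Sum>e\<in>L'. g' e (F p) * F' e p)"
      by (rule R[OF fin(1) order_refl g'(2) F'(2)])
    ultimately show "\<exists>h. partial_deriv d V (\<lambda>p. g (F p)) h \<and> regular_to_order L T an V a b h"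
      by blast
  next
    fix d assume d: "d \<in> T" and b: "0 < b"
    then have dLT: "d \<in> L \<union> T" by simp
    let ?J = "L' \<union> T'"
    have "\<exists>h. partial_deriv e V' g h \<and> regular_to_order L' T' an V' a (b - 1) h" if eJ: "e \<in> ?J" for e
    proof (cases "e \<in> T'")
      case False
      then obtain h where "partial_deriv e V' g h" "regular_to_order L' T' an V' a b h"
        using g(2)[of e] eJ by blast
      moreover from this(2) have "regular_to_order L' T' an V' a (b - 1) h"
        by (rule regular_mono) auto
      ultimately show ?thesis by blast
    qed (use g(3) b in blast)
    then obtain g' where g': "\<And>e. e \<in> ?J \<Longrightarrow> partial_deriv e V' g (g' e)"
      "\<And>e. e \<in> ?J \<Longrightarrow> regular_to_order L' T' an V' a (b - 1) (g' e)" by metis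
    obtain F' where F': "\<And>e. e \<in> ?J \<Longrightarrow> partial_deriv d V (\<lambda>p. F p e) (F' e)"
        "\<And>e. e \<in> ?J \<Longrightarrow> regular_to_order L T an V a (b - 1) (F' e)"
      using F(2)[OF d b] by metis
    have "partial_deriv d V (\<lambda>p. g (F p)) (\<lambda>p. \<Sum>e\<in>?J. g' e (F p) * F' e p)"
      unfolding partial_deriv_def
    proof
      fix p assume p: "p \<in> V"
      have "((\<lambda>t. g (F (p(d := t)))) has_real_derivative (\<Sum>e\<in>?J. g' e (F (p(d := p d))) * F' e p)) (at
          (p d))"
      proof (rule chain_rule_along_curve[where c = "\<lambda>t. F (p(d := t))" and g = g, OF dom'])
        show "\<forall>\<^sub>F t in nhds (p d). \<forall>e. e \<notin> ?J \<longrightarrow> F (p(d := t)) e = F (p(d := p d)) e"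
          using coord_domain_line[OF dom p dLT]
        proof eventually_elim
          case (elim t)
          then show ?case
            using coord_domain_subset[OF dom' FV[OF elim]] coord_domain_subset[OF dom' FV[OF p]] by simp
        qed
        show "((\<lambda>t. F (p(d := t)) e) has_real_derivative F' e p) (at (p d))" if "e \<in> ?J" for e
          using F'(1)[OF that] p by (simp add: partial_deriv_def)
        show "continuous_on V' (g' e)" if "e \<in> ?J" for e
          using regular_imp_base[OF g'(2)[OF that]] by (simp add: base_regular_def)
      qed (use g' FV p fin in auto)
      then show "((\<lambda>t. g (F (p(d := t)))) has_real_derivative (\<Sum>e\<in>?J. g' e (F p) * F' e p)) (at (p d))"
          by simp
    qed
    moreover have "finite ?J" "b - 1 \<le> b" using fin by auto
    then have "regular_to_order L T an V a (b - 1) (\<lambda>p. \<Sum>e\<in>?J. g' e (F p) * F' e p)"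
      by (rule R[OF _ _ g'(2) F'(2)])
    ultimately show "\<exists>h. partial_deriv d V (\<lambda>p. g (F p)) h \<and> regular_to_order L T an V a (b - 1) h"
      by blast
  qed
qed

section \<open>From iterated derivatives to families of partial derivatives and back\<close>

text \<open>
  Only the transversal derivatives are assumed analytic; every leaf derivative is reached from them one
  step at a time.
\<close>

lemma real_analytic_in_all_partials:
  assumes dom: "coord_domain L T V"
    and an: "\<And>\<gamma>. \<gamma> \<in> mults (L \<union> T) \<Longrightarrow> deg T \<gamma> \<le> b \<Longrightarrow> deg L \<gamma> + deg T \<gamma> \<le> a \<Longrightarrow> deg L \<gamma> = 0 \<Longrightarrow>
      real_analytic_in L V (D \<gamma>)"
    and D: "\<And>\<gamma> d. \<gamma> \<in> mults (L \<union> T) \<Longrightarrow> d \<in> L \<Longrightarrow> deg T \<gamma> \<le> b \<Longrightarrow>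
      Suc (deg L \<gamma> + deg T \<gamma>) \<le> a \<Longrightarrow> partial_deriv d V (D \<gamma>) (D (\<gamma>(d := Suc (\<gamma> d))))"
  shows "\<gamma> \<in> mults (L \<union> T) \<Longrightarrow> deg T \<gamma> \<le> b \<Longrightarrow> deg L \<gamma> + deg T \<gamma> \<le> a \<Longrightarrow> real_analytic_in L V (D \<gamma>)"
proof (induction "deg L \<gamma>" arbitrary: \<gamma>)
  case 0 then show ?case using an by simp
next
  case (Suc n)
  have fin: "finite L" and dis: "L \<inter> T = {}" using dom by (auto simp: coord_domain_def)
  obtain d where d: "d \<in> L" "\<gamma> d \<noteq> 0"
    using Suc.hyps(2) by (metis nat.distinct(1) sum.neutral)
  define \<gamma>' where "\<gamma>' = \<gamma>(d := \<gamma> d - 1)"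
  have up: "\<gamma> = \<gamma>'(d := Suc (\<gamma>' d))" using d by (simp add: \<gamma>'_def)
  have "deg L \<gamma> = \<gamma> d + deg (L - {d}) \<gamma>" "deg L \<gamma>' = \<gamma>' d + deg (L - {d}) \<gamma>'"
    using sum.remove[OF fin d(1)] by auto
  moreover have "deg (L - {d}) \<gamma> = deg (L - {d}) \<gamma>'" by (auto simp: \<gamma>'_def)
  moreover have "\<gamma> d = Suc (\<gamma>' d)" using d by (simp add: \<gamma>'_def)
  ultimately have n: "n = deg L \<gamma>'" using Suc.hyps(2) by linarith
  have T: "deg T \<gamma>' = deg T \<gamma>" using d dis by (auto simp: \<gamma>'_def intro!: sum.cong)
  have m: "\<gamma>' \<in> mults (L \<union> T)" using Suc.prems(1) by (auto simp: mults_def \<gamma>'_def)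
  have "real_analytic_in L V (D \<gamma>')"
    by (rule Suc.hyps(1)[OF n m]) (use Suc.prems n T Suc.hyps(2) in linarith)+
  moreover have "partial_deriv d V (D \<gamma>') (D \<gamma>)"
    by (rule D[OF m d(1), folded up]) (use Suc.prems n T Suc.hyps(2) in linarith)+
  ultimately show ?case
    by (rule real_analytic_in_partial_deriv[OF dom Un_upper1 d(1)])
qed

lemma deg_bump:
  assumes "finite A"
  shows "deg A (\<gamma>(d := Suc (\<gamma> d))) = deg A \<gamma> + (if d \<in> A then 1 else 0)"
proof (cases "d \<in> A")
  case True
  have "deg (A - {d}) (\<gamma>(d := Suc (\<gamma> d))) = deg (A - {d}) \<gamma>" by (rule sum.cong) auto
  then show ?thesis using sum.remove[OF assms True, of \<gamma>] sum.remove[OF assms True, of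
      "\<gamma>(d := Suc (\<gamma> d))"] True by simp
qed (auto intro: sum.cong)

text \<open>
  The second form is the one the simplifier produces inside sums.
\<close>

lemmas deg_bumps = deg_bump deg_bump[unfolded fun_upd_def]

lemma regular_of_partials:
  assumes dom: "coord_domain L T V"
    and base: "\<And>\<gamma>. \<gamma> \<in> mults (L \<union> T) \<Longrightarrow> deg T \<gamma> \<le> b \<Longrightarrow> deg L \<gamma> + deg T \<gamma> \<le> a \<Longrightarrow> continuous_on V (D \<gamma>)"
    and an: "\<And>\<gamma>. an \<Longrightarrow> \<gamma> \<in> mults (L \<union> T) \<Longrightarrow> deg T \<gamma> \<le> b \<Longrightarrow> deg L \<gamma> + deg T \<gamma> \<le> a \<Longrightarrow> deg L \<gamma> = 0 \<Longrightarrow>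
      real_analytic_in L V (D \<gamma>)"
    and D: "\<And>\<gamma> d. \<gamma> \<in> mults (L \<union> T) \<Longrightarrow> d \<in> L \<union> T \<Longrightarrow> deg T (\<gamma>(d := Suc (\<gamma> d))) \<le> b \<Longrightarrow>
      deg L (\<gamma>(d := Suc (\<gamma> d))) + deg T (\<gamma>(d := Suc (\<gamma> d))) \<le> a \<Longrightarrow>
          partial_deriv d V (D \<gamma>) (D (\<gamma>(d := Suc (\<gamma> d))))"
    and f: "\<And>p. p \<in> V \<Longrightarrow> D (\<lambda>_. 0) p = f p"
  shows "regular_to_order L T an V a b f"
proof -
  have fin: "finite L" "finite T" and dis: "L \<inter> T = {}" using dom by (auto simp: coord_domain_def)
  have *: "regular_to_order L T an V n (b - deg T \<gamma>) (D \<gamma>)"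
    if "\<gamma> \<in> mults (L \<union> T)" "deg T \<gamma> \<le> b" "deg L \<gamma> + deg T \<gamma> + n \<le> a" for \<gamma> n
    using that
  proof (induction n arbitrary: \<gamma>)
    case 0
    have "real_analytic_in L V (D \<gamma>)" if "an"
    proof (rule real_analytic_in_all_partials[OF dom an[OF that] D, of b])
      show "deg T \<gamma> \<le> b" "deg L \<gamma> + deg T \<gamma> \<le> a" "\<gamma> \<in> mults (L \<union> T)" using 0 by auto
    qed (use dis in \<open>auto simp: deg_bumps fin\<close>)
    then show ?case using base 0 by (auto simp: base_regular_def)
  next
    case (Suc n)
    have b: "base_regular L an V (D \<gamma>)"
      by (rule regular_imp_base[OF Suc.IH]) (use Suc.prems in auto)
    show ?case
      unfolding regular_to_order.simps
    proof (intro conjI ballI impI b)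
      fix d assume d: "d \<in> L"
      let ?g = "\<gamma>(d := Suc (\<gamma> d))"
      have dT: "d \<notin> T" using d dis by auto
      have m: "?g \<in> mults (L \<union> T)" using Suc.prems(1) d by (auto simp: mults_def)
      have "partial_deriv d V (D \<gamma>) (D ?g)"
        by (rule D) (use Suc.prems d dT in \<open>auto simp: deg_bumps fin\<close>)
      moreover have "regular_to_order L T an V n (b - deg T ?g) (D ?g)"
        by (rule Suc.IH[OF m]) (use Suc.prems d dT in \<open>auto simp: deg_bumps fin\<close>)
      ultimately show "\<exists>g. partial_deriv d V (D \<gamma>) g \<and> regular_to_order L T an V n (b - deg T \<gamma>) g"
        using dT by (auto simp: deg_bumps fin)
    next
      fix d assume d: "d \<in> T" "0 < b - deg T \<gamma>"
      let ?g = "\<gamma>(d := Suc (\<gamma> d))"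
      have dT: "d \<notin> L" using d dis by auto
      have m: "?g \<in> mults (L \<union> T)" using Suc.prems(1) d by (auto simp: mults_def)
      have "partial_deriv d V (D \<gamma>) (D ?g)"
        by (rule D) (use Suc.prems d dT in \<open>auto simp: deg_bumps fin\<close>)
      moreover have "regular_to_order L T an V n (b - deg T ?g) (D ?g)"
        by (rule Suc.IH[OF m]) (use Suc.prems d dT in \<open>auto simp: deg_bumps fin\<close>)
      ultimately show "\<exists>g. partial_deriv d V (D \<gamma>) g \<and> regular_to_order L T an V n (b - deg T \<gamma> - 1) g"
        using d(1) by (auto simp: deg_bumps fin)
    qed
  qed
  have "regular_to_order L T an V a (b - deg T (\<lambda>_. 0)) (D (\<lambda>_. 0))"
    by (rule *) (auto simp: mults_def)
  then show ?thesis
    using regular_cong[of L T V "D (\<lambda>_. 0)" f an a b] dom f by simp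
qed

text \<open>
  The derivative as an operator, total with arbitrary values where \<open>f\<close> is not differentiable, so that it
  can be iterated.
\<close>

definition pd :: "'d \<Rightarrow> (('d \<Rightarrow> real) \<Rightarrow> real) \<Rightarrow> ('d \<Rightarrow> real) \<Rightarrow> real" where
  "pd d f p = deriv (\<lambda>t. f (p(d := t))) (p d)"

lemma partial_deriv_pd: "partial_deriv d V f g \<Longrightarrow> p \<in> V \<Longrightarrow> pd d f p = g p"
  unfolding partial_deriv_def pd_def by (simp add: DERIV_imp_deriv)

lemma regular_pd:
  assumes dom: "coord_domain L T V" and f: "regular_to_order L T an V (Suc a) b f"
    and d: "d \<in> L \<union> T" "d \<in> T \<Longrightarrow> 0 < b"
  shows "partial_deriv d V f (pd d f)"
    and "regular_to_order L T an V a (b - (if d \<in> T then 1 else 0)) (pd d f)"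
proof -
  have dis: "L \<inter> T = {}" using dom by (auto simp: coord_domain_def)
  obtain g where g: "partial_deriv d V f g"
      "regular_to_order L T an V a (b - (if d \<in> T then 1 else 0)) g"
    using f d dis by (cases "d \<in> T") auto
  note eq = partial_deriv_pd[OF g(1)]
  show "partial_deriv d V f (pd d f)"
    using g(1) partial_deriv_cong[of L T V d f f g "pd d f", OF dom d(1)] eq by auto
  show "regular_to_order L T an V a (b - (if d \<in> T then 1 else 0)) (pd d f)"
    using g(2) regular_cong[of L T V "pd d f" g] dom eq by auto
qed

lemma pd_cong:
  assumes dom: "coord_domain L T V" and d: "d \<in> L \<union> T" and eq: "\<And>p. p \<in> V \<Longrightarrow> f p = g p" and p: "p \<in> V"
  shows "pd d f p = pd d g p"
proof -
  have "\<forall>\<^sub>F t in nhds (p d). f (p(d := t)) = g (p(d := t))"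
    using coord_domain_line[OF dom p d] by eventually_elim (use eq in auto)
  then show ?thesis unfolding pd_def by (rule deriv_cong_ev) simp
qed

lemma pd_commute:
  assumes dom: "coord_domain L T V" and d: "d \<in> L \<union> T" and e: "e \<in> L \<union> T"
    and f: "regular_to_order L T an V a b f" and a: "2 \<le> a"
    and b: "(if d \<in> T then 1 else 0) + (if e \<in> T then 1 else 0) \<le> b"
    and p: "p \<in> V"
  shows "pd d (pd e f) p = pd e (pd d f) p"
proof (cases "d = e")
  case False
  have f': "regular_to_order L T an V (Suc (Suc 0)) b f"
    using f by (rule regular_mono) (use a in auto)
  have b': "d \<in> T \<Longrightarrow> 0 < b" "e \<in> T \<Longrightarrow> 0 < b" "d \<in> T \<Longrightarrow> 0 < b - (if e \<in> T then 1 else 0)"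
     "e \<in> T \<Longrightarrow> 0 < b - (if d \<in> T then 1 else 0)" using b by auto
  note D = regular_pd[OF dom f' d b'(1)]
  note E = regular_pd[OF dom f' e b'(2)]
  note DE = regular_pd[OF dom E(2) d b'(3)]
  note ED = regular_pd[OF dom D(2) e b'(4)]
  show ?thesis
    using mixed_partials_commute[OF dom d e False D(1) E(1) ED(1) DE(1) _ _ p]
      regular_imp_base[OF DE(2)] regular_imp_base[OF ED(2)]
    by (simp add: base_regular_def)
qed simp

abbreviation pds :: "'d list \<Rightarrow> (('d \<Rightarrow> real) \<Rightarrow> real) \<Rightarrow> ('d \<Rightarrow> real) \<Rightarrow> real" where
  "pds xs f \<equiv> foldr pd xs f"

abbreviation trans_length :: "'d set \<Rightarrow> 'd list \<Rightarrow> nat" where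
  "trans_length T xs \<equiv> length (filter (\<lambda>d. d \<in> T) xs)"

lemma regular_pds:
  assumes dom: "coord_domain L T V" and f: "regular_to_order L T an V a b f"
    and xs: "set xs \<subseteq> L \<union> T" "length xs \<le> a" "trans_length T xs \<le> b"
  shows "regular_to_order L T an V (a - length xs) (b - trans_length T xs) (pds xs f)"
  using xs
proof (induction xs)
  case Nil then show ?case using f by simp
next
  case (Cons d xs)
  have "regular_to_order L T an V (Suc (a - length (d # xs))) (b - trans_length T xs) (pds xs f)"
    using Cons by (simp add: Suc_diff_Suc split: if_splits)
  from regular_pd(2)[OF dom this, of d] Cons.prems
  show ?case by (auto split: if_splits)
qed

lemma pds_move_front:
  assumes dom: "coord_domain L T V" and f: "regular_to_order L T an V a b f"
  shows "set (us @ x # vs) \<subseteq> L \<union> T \<Longrightarrow> length (us @ x # vs) \<le> a \<Longrightarrow> trans_length T (us @ x # vs) \<le> b \<Longrightarrow>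
    p \<in> V \<Longrightarrow> pds (us @ x # vs) f p = pds (x # us @ vs) f p"
proof (induction us arbitrary: p)
  case (Cons u us)
  have "pds (u # us @ x # vs) f p = pd u (pds (x # us @ vs) f) p"
    unfolding foldr.simps o_def
    by (rule pd_cong[OF dom]) (use Cons in \<open>auto split: if_splits\<close>)
  also have "\<dots> = pd u (pd x (pds (us @ vs) f)) p" by simp
  also have "\<dots> = pd x (pd u (pds (us @ vs) f)) p"
    by (rule pd_commute[OF dom _ _ regular_pds[OF dom f]])
       (use Cons.prems in \<open>auto split: if_splits\<close>)
  finally show ?case by simp
qed simp

text \<open>
  Iterated derivatives depend only on the multiset of directions: neighbouring directions may be exchanged
  by \<open>mixed_partials_commute\<close>.
\<close>

lemma pds_permute:
  assumes dom: "coord_domain L T V" and f: "regular_to_order L T an V a b f"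
  shows "set xs \<subseteq> L \<union> T \<Longrightarrow> length xs \<le> a \<Longrightarrow> trans_length T xs \<le> b \<Longrightarrow> mset ys = mset xs \<Longrightarrow>
    p \<in> V \<Longrightarrow> pds ys f p = pds xs f p"
proof (induction xs arbitrary: ys p)
  case (Cons x xs)
  then have "x \<in> set ys" by (metis list.set_intros(1) mset_eq_setD)
  then obtain us vs where ys: "ys = us @ x # vs" by (meson split_list)
  have m: "mset (us @ vs) = mset xs" using Cons.prems(4) ys by simp
  have s: "set ys = set (x # xs)" "length ys = length (x # xs)"
      "trans_length T ys = trans_length T (x # xs)"
    using Cons.prems(4) by (metis mset_eq_setD) (metis Cons.prems(4) size_mset, metis Cons.prems(4)
        mset_filter size_mset)
  have "pds ys f p = pds (x # us @ vs) f p"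
    unfolding ys by (rule pds_move_front[OF dom f]) (use Cons.prems s ys in auto)
  also have "\<dots> = pds (x # xs) f p"
    unfolding foldr.simps o_def
    by (rule pd_cong[OF dom]) (use Cons.prems Cons.IH[OF _ _ _ m] in \<open>auto split: if_splits\<close>)
  finally show ?case .
qed simp

lemma ex_list_count:
  assumes "finite A" "\<gamma> \<in> mults A"
  shows "\<exists>xs. count (mset xs) = \<gamma>"
proof -
  have "finite {d. 0 < \<gamma> d}"
    by (rule finite_subset[OF _ assms(1)]) (use assms(2) in \<open>auto simp: mults_def\<close>)
  then have "count (Abs_multiset \<gamma>) = \<gamma>" by (simp add: count_Abs_multiset)
  moreover obtain xs where "mset xs = Abs_multiset \<gamma>" by (metis ex_mset)
  ultimately show ?thesis by metis
qed

text \<open>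
  The family is obtained by differentiating along a chosen word with the given numbers of letters. By
  \<open>pds_permute\<close> the choice is immaterial, so one more derivative in any direction leads to the next
  member of the family. The predicate \<open>adm\<close> allows infinite orders: one family serves all finite budgets at
  once.
\<close>

lemma partials_of_regular:
  assumes dom: "coord_domain L T V"
    and f: "\<And>a b. adm a b \<Longrightarrow> regular_to_order L T an V a b f"
  obtains D where "D (\<lambda>_. 0) = f"
    "\<And>\<gamma>. \<gamma> \<in> mults (L \<union> T) \<Longrightarrow> adm (deg L \<gamma> + deg T \<gamma>) (deg T \<gamma>) \<Longrightarrow> base_regular L an V (D \<gamma>)"
    "\<And>\<gamma> d. \<gamma> \<in> mults (L \<union> T) \<Longrightarrow> d \<in> L \<union> T \<Longrightarrow>
      adm (deg L (\<gamma>(d := Suc (\<gamma> d))) + deg T (\<gamma>(d := Suc (\<gamma> d)))) (deg T (\<gamma>(d := Suc (\<gamma> d)))) \<Longrightarrow>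
      partial_deriv d V (D \<gamma>) (D (\<gamma>(d := Suc (\<gamma> d))))"
proof -
  have fin: "finite L" "finite T" "finite (L \<union> T)" and dis: "L \<inter> T = {}"
      using dom by (auto simp: coord_domain_def)
  define w where "w \<gamma> = (SOME xs. count (mset xs) = \<gamma>)" for \<gamma> :: "'a \<Rightarrow> nat"
  have w: "count (mset (w \<gamma>)) = \<gamma>" if "\<gamma> \<in> mults (L \<union> T)" for \<gamma>
    unfolding w_def using ex_list_count[OF fin(3) that] by (rule someI_ex)
  have set: "set (w \<gamma>) \<subseteq> L \<union> T" if "\<gamma> \<in> mults (L \<union> T)" for \<gamma>
    using that w[OF that] by (auto simp: mults_def) (metis count_mset_0_iff)
  have len: "length (w \<gamma>) = deg L \<gamma> + deg T \<gamma>" if "\<gamma> \<in> mults (L \<union> T)" for \<gamma>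
    using sum_count_set[OF set[OF that] fin(3)] w[OF that] sum.union_disjoint[OF fin(1,2) dis, of \<gamma>]
    by (metis count_mset ext)
  have tlen: "trans_length T (w \<gamma>) = deg T \<gamma>" if "\<gamma> \<in> mults (L \<union> T)" for \<gamma>
  proof -
    have "count_list (filter (\<lambda>d. d \<in> T) (w \<gamma>)) d = \<gamma> d" if "d \<in> T" for d
      using fun_cong[OF w[OF \<open>\<gamma> \<in> mults (L \<union> T)\<close>], of d] that
      by (metis count_filter_mset count_mset mset_filter)
    moreover have "set (filter (\<lambda>d. d \<in> T) (w \<gamma>)) \<subseteq> T" by auto
    ultimately show ?thesis
      using sum_count_set[of "filter (\<lambda>d. d \<in> T) (w \<gamma>)" T] fin(2) by simp
  qed
  define D where "D \<gamma> = pds (w \<gamma>) f" for \<gamma>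
  show ?thesis
  proof (rule that[of D])
    have "w (\<lambda>_. 0) = []"
        using w[of "\<lambda>_. 0"] by (auto simp: mults_def zero_multiset.rep_eq[symmetric] count_inject
            fun_eq_iff)
    then show "D (\<lambda>_. 0) = f" by (simp add: D_def)
  next
    fix \<gamma> assume \<gamma>: "\<gamma> \<in> mults (L \<union> T)" and "adm (deg L \<gamma> + deg T \<gamma>) (deg T \<gamma>)"
    from regular_pds[OF dom f[OF this(2)] set[OF \<gamma>]]
    show "base_regular L an V (D \<gamma>)"
      using len[OF \<gamma>] tlen[OF \<gamma>] by (auto simp: D_def intro: regular_imp_base)
  next
    fix \<gamma> d assume \<gamma>: "\<gamma> \<in> mults (L \<union> T)" and d: "d \<in> L \<union> T"
      and "adm (deg L (\<gamma>(d := Suc (\<gamma> d))) + deg T (\<gamma>(d := Suc (\<gamma> d)))) (deg T (\<gamma>(d := Suc (\<gamma> d))))"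
    let ?g = "\<gamma>(d := Suc (\<gamma> d))"
    note r = f[OF \<open>adm (deg L ?g + deg T ?g) (deg T ?g)\<close>]
    have g: "?g \<in> mults (L \<union> T)" using \<gamma> d by (auto simp: mults_def)
    have m: "mset (w ?g) = mset (d # w \<gamma>)"
      by (rule multiset_eqI) (simp add: w[OF g] w[OF \<gamma>])
    have len': "length (w ?g) = Suc (length (w \<gamma>))" "trans_length T (w ?g) = trans_length T (d # w \<gamma>)"
      using m by (metis length_Cons size_mset) (metis m mset_filter size_mset)
    have "regular_to_order L T an V (Suc 0) (deg T ?g - trans_length T (w \<gamma>)) (D \<gamma>)"
      unfolding D_def using regular_pds[OF dom r set[OF \<gamma>]] len' len[OF g] tlen[OF g]
      by (auto split: if_splits)
    then have "partial_deriv d V (D \<gamma>) (pd d (D \<gamma>))"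
      by (rule regular_pd(1)[OF dom _ d]) (use tlen[OF g] len' in auto)
    moreover have "pd d (D \<gamma>) p = D ?g p" if "p \<in> V" for p
    proof -
      have "pds (d # w \<gamma>) f p = pds (w ?g) f p"
        by (rule pds_permute[OF dom r set[OF g]]) (use len[OF g] tlen[OF g] m that in auto)
      then show ?thesis by (simp add: D_def)
    qed
    ultimately show "partial_deriv d V (D \<gamma>) (D ?g)"
      using partial_deriv_cong[of L T V d "D \<gamma>" "D \<gamma>" "pd d (D \<gamma>)" "D ?g"] dom d by blast
  qed
qed

section \<open>The classes of functions of one and of two groups of variables\<close>

text \<open>
  Used for the integer parts of the transition maps of the torus.
\<close>

lemma locally_constant_regular:
  assumes dom: "coord_domain L T V"
    and n: "\<And>p. p \<in> V \<Longrightarrow> \<exists>\<delta>>0. \<forall>q\<in>V. (\<forall>d\<in>L \<union> T. \<bar>q d - p d\<bar> < \<delta>) \<longrightarrow> n q = n p"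
  shows "regular_to_order L T an V a b n" and "L' \<subseteq> L \<union> T \<Longrightarrow> real_analytic_in L' V n"
proof -
  show an: "real_analytic_in L' V n" if L': "L' \<subseteq> L \<union> T" for L'
    unfolding real_analytic_in_def
  proof
    fix p assume p: "p \<in> V"
    obtain \<delta> where \<delta>: "\<delta> > 0" "\<And>q. q \<in> V \<Longrightarrow> (\<forall>d\<in>L \<union> T. \<bar>q d - p d\<bar> < \<delta>) \<Longrightarrow> n q = n p"
      using n[OF p] by blast
    have "((\<lambda>\<alpha>. (if \<alpha> = (\<lambda>_. 0) then n p else 0) * mon L' (\<lambda>d. x d - p d) \<alpha>) has_sum n x) (mults L')"
      if "x \<in> V" "\<forall>d. d \<notin> L' \<longrightarrow> x d = p d" "\<forall>d\<in>L'. \<bar>x d - p d\<bar> < \<delta>" for x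
    proof (rule has_sum_finite_neutralI[of "{\<lambda>_. 0}"])
      have "\<bar>x d - p d\<bar> < \<delta>" for d using that \<delta>(1) by (cases "d \<in> L'") auto
      then show "n x = (\<Sum>\<alpha>\<in>{\<lambda>_. 0}. (if \<alpha> = (\<lambda>_. 0) then n p else 0) * mon L' (\<lambda>d. x d - p d) \<alpha>)"
        using \<delta>(2)[OF that(1)] by (simp add: mon_def)
    qed (auto simp: mults_def)
    then show "\<exists>e>0. \<exists>c. \<forall>x\<in>V. (\<forall>d. d \<notin> L' \<longrightarrow> x d = p d) \<longrightarrow> (\<forall>d\<in>L'. \<bar>x d - p d\<bar> < e) \<longrightarrow>
        ((\<lambda>\<alpha>. c \<alpha> * mon L' (\<lambda>d. x d - p d) \<alpha>) has_sum n x) (mults L')"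
      using \<delta>(1) by (intro exI[of _ \<delta>] conjI exI[of _ "\<lambda>\<alpha>. if \<alpha> = (\<lambda>_. 0) then n p else 0"]) auto
  qed
  have cont: "continuous_on V n"
    unfolding continuous_on_def
  proof
    fix p assume p: "p \<in> V"
    obtain \<delta> where \<delta>: "\<delta> > 0" "\<And>q. q \<in> V \<Longrightarrow> (\<forall>d\<in>L \<union> T. \<bar>q d - p d\<bar> < \<delta>) \<Longrightarrow> n q = n p"
      using n[OF p] by blast
    have "((\<lambda>q. q d) \<longlongrightarrow> p d) (at p within V)" for d
      using continuous_on_subset[OF continuous_on_product_coordinates, of V d] p
          unfolding continuous_on_def by blast
    then have "\<forall>\<^sub>F q in at p within V. \<forall>d\<in>L \<union> T. \<bar>q d - p d\<bar> < \<delta>"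
      using dom \<delta>(1) by (intro eventually_ball_finite) (auto simp: coord_domain_def tendsto_iff
          dist_real_def)
    moreover have "\<forall>\<^sub>F q in at p within V. q \<in> V" by (simp add: eventually_at_filter)
    ultimately have "\<forall>\<^sub>F q in at p within V. n p = n q"
      by eventually_elim (use \<delta>(2) in auto)
    then show "(n \<longlongrightarrow> n p) (at p within V)"
      by (rule Lim_transform_eventually[OF tendsto_const])
  qed
  have "partial_deriv d V n (\<lambda>_. 0)" if d: "d \<in> L \<union> T" for d
    unfolding partial_deriv_def
  proof
    fix p assume p: "p \<in> V"
    obtain \<delta> where \<delta>: "\<delta> > 0" "\<And>q. q \<in> V \<Longrightarrow> (\<forall>d\<in>L \<union> T. \<bar>q d - p d\<bar> < \<delta>) \<Longrightarrow> n q = n p"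
      using n[OF p] by blast
    have "\<forall>\<^sub>F t in nhds (p d). \<bar>t - p d\<bar> < \<delta>"
      unfolding eventually_nhds_metric using \<delta>(1) by (auto simp: dist_real_def)
    then have "\<forall>\<^sub>F t in nhds (p d). n (p(d := t)) = n p"
      using coord_domain_line[OF dom p d] by eventually_elim (use \<delta> in auto)
    then show "((\<lambda>t. n (p(d := t))) has_real_derivative 0) (at (p d))"
      by (subst DERIV_cong_ev[OF refl _ refl, of _ "\<lambda>_. n p"]) auto
  qed
  then show "regular_to_order L T an V a b n"
    using cont an[of L] regular_const[of L T an V _ _ 0] by (cases a) (auto simp: base_regular_def)
qed

lemma coord_analytic:
  assumes dom: "coord_domain L T V" and L': "L' \<subseteq> L \<union> T"
  shows "real_analytic_in L' V (\<lambda>p. p d)"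
proof (cases "d \<in> L'")
  case True
  let ?\<alpha> = "\<lambda>e. if e = d then 1 else (0 :: nat)"
  have fin: "finite L'" by (rule coord_domain_finite[OF dom L'])
  have "(\<Prod>e\<in>L'. u e ^ ?\<alpha> e) = u d" for u :: "'a \<Rightarrow> real"
    by (subst prod.remove[OF fin True]) (simp add: prod.neutral)
  then have m: "mon L' u ?\<alpha> = u d" for u by (simp add: mon_def)
  have "?\<alpha> \<in> mults L'" using True by (auto simp: mults_def)
  then have "power_series_on L' 1 (\<bar>p d\<bar> + (\<bar>1\<bar> * 1 ^ deg L' ?\<alpha>)) (\<lambda>u. p d + 1 * mon L' u ?\<alpha>)" for p
    by (intro power_series_on_add power_series_on_const power_series_on_monomial) auto
  then show ?thesis
    unfolding real_analytic_in_iff[OF dom L'] m by (intro ballI exI[of _ 1]) auto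
next
  case False
  then show ?thesis by (intro real_analytic_in_leafwise_const) auto
qed

lemma coord_regular:
  assumes dom: "coord_domain L T V"
  shows "regular_to_order L T an V a b (\<lambda>p. p d)"
proof -
  have base: "base_regular L an V (\<lambda>p. p d)"
    using coord_analytic[OF dom Un_upper1] continuous_on_subset[OF continuous_on_product_coordinates,
        of V d] by (auto simp: base_regular_def)
  have "partial_deriv e V (\<lambda>p. p d) (\<lambda>_. if e = d then 1 else 0)" for e
    by (auto simp: partial_deriv_def)
  then show ?thesis
    using base regular_const[of L T an V] by (cases a) (auto, blast+)
qed

text \<open>
  A function of the transversal variable alone has no leaf derivatives to be constrained, so its total
  budget is arbitrary and its order counts against the transversal budget.
\<close>

lemma regular_transversal:
  "regular_to_order L {} an V b 0 g \<Longrightarrow> regular_to_order {} L an' V a b g"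
proof (induction a arbitrary: b g)
  case 0
  then show ?case
    using regular_imp_base[OF 0] real_analytic_in_leafwise_const[of V "{}" g]
    by (auto simp: base_regular_def fun_eq_iff[symmetric])
next
  case (Suc a)
  have base: "base_regular {} an' V g"
    using regular_imp_base[OF Suc.prems] real_analytic_in_leafwise_const[of V "{}" g]
    by (auto simp: base_regular_def fun_eq_iff[symmetric])
  show ?case
    unfolding regular_to_order.simps
  proof (intro conjI ballI impI base)
    fix d assume "d \<in> L" "0 < b"
    then obtain b' where "b = Suc b'" by (cases b) auto
    then obtain h where "partial_deriv d V g h" "regular_to_order L {} an V b' 0 h"
      using Suc.prems \<open>d \<in> L\<close> by auto
    then show "\<exists>h. partial_deriv d V g h \<and> regular_to_order {} L an' V a (b - 1) h"
      using Suc.IH \<open>b = Suc b'\<close> by auto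
  qed auto
qed

lemma mults_multi: "mults {..<n} = multi n"
  by (auto simp: mults_def multi_def)

lemma topspace_coordspace: "topspace (Euclidean_space n) = coordspace {..<n}"
  by (auto simp: topspace_Euclidean_space coordspace_def)

lemma Euclidean_space_top_of_set: "Euclidean_space n = top_of_set (coordspace {..<n})"
  unfolding Euclidean_space_def euclidean_product_topology[symmetric]
  by (rule arg_cong2[of _ _ _ _ subtopology]) (auto simp: coordspace_def euclidean_product_topology)

lemma open_coord_domain: "openin (Euclidean_space n) V \<Longrightarrow> coord_domain {..<n} {} V"
  by (simp add: coord_domain_def Euclidean_space_top_of_set)

lemma continuous_map_Euclidean_iff:
  assumes "openin (Euclidean_space n) V"
  shows "continuous_map (subtopology (Euclidean_space n) V) euclideanreal f \<longleftrightarrow> continuous_on V f"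
proof -
  have "coordspace {..<n} \<inter> V = V"
    using openin_subset[OF assms] by (auto simp: topspace_coordspace)
  then show ?thesis
    by (simp add: Euclidean_space_top_of_set subtopology_subtopology)
qed

lemma analytic_fun_iff:
  assumes "openin (Euclidean_space n) V"
  shows "analytic_fun n V f \<longleftrightarrow> real_analytic_in {..<n} V f"
proof -
  have same: "x d = p d" if "x \<in> V" "p \<in> V" "n \<le> d" for x p :: point and d
    using coord_domain_subset[OF open_coord_domain[OF assms] that(1), of d]
      coord_domain_subset[OF open_coord_domain[OF assms] that(2), of d] that(3) by simp
  show ?thesis
    unfolding analytic_fun_def real_analytic_in_def mults_multi mpow_def mon_def
    by (intro ball_cong refl ex_cong1 conj_cong) (use same in \<open>auto simp: Ball_def not_less\<close>)
qed

lemma Fin_le_mono: "Fin b \<le> s \<Longrightarrow> a \<le> b \<Longrightarrow> Fin a \<le> s"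
  by (cases s) auto

text \<open>
  A single group of variables is treated as a space without transversal directions.
\<close>

lemma C_fun_iff:
  assumes V: "openin (Euclidean_space n) V"
  shows "C_fun n s V f \<longleftrightarrow> (\<forall>a. Fin a \<le> s \<longrightarrow> regular_to_order {..<n} {} (s = Omega) V a 0 f)"
proof
  note dom = open_coord_domain[OF V]
  assume "C_fun n s V f"
  then obtain D where D: "partials n s V f D" and an: "s = Omega \<Longrightarrow> real_analytic_in {..<n} V f"
    unfolding C_fun_def analytic_fun_iff[OF V] by blast
  show "\<forall>a. Fin a \<le> s \<longrightarrow> regular_to_order {..<n} {} (s = Omega) V a 0 f"
  proof (intro allI impI)
    fix a assume a: "Fin a \<le> s"
    show "regular_to_order {..<n} {} (s = Omega) V a 0 f"
    proof (rule regular_of_partials[OF dom, where D = D])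
      fix \<gamma> :: "nat \<Rightarrow> nat" assume g: "\<gamma> \<in> mults ({..<n} \<union> {})" "deg {..<n} \<gamma> + deg {} \<gamma> \<le> a"
      then have "Fin (mdeg n \<gamma>) \<le> s" using Fin_le_mono[OF a] by (simp add: mdeg_def)
      then show "continuous_on V (D \<gamma>)"
        using D g continuous_map_Euclidean_iff[OF V] by (simp add: partials_def mults_multi)
    next
      fix \<gamma> :: "nat \<Rightarrow> nat" assume g: "\<gamma> \<in> mults ({..<n} \<union> {})" "deg {..<n} \<gamma> = 0" and s: "s = Omega"
      then have "\<gamma> d = 0" for d by (cases "d < n") (auto simp: mults_def)
      then have "\<gamma> = (\<lambda>_. 0)" by auto
      then have "\<And>p. p \<in> V \<Longrightarrow> D \<gamma> p = f p" using D by (simp add: partials_def)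
      then show "real_analytic_in {..<n} V (D \<gamma>)"
        using an[OF s] unfolding real_analytic_in_def by simp
    next
      fix \<gamma> :: "nat \<Rightarrow> nat" and d assume g: "\<gamma> \<in> mults ({..<n} \<union> {})" "d \<in> {..<n} \<union> {}"
        "deg {..<n} (\<gamma>(d := Suc (\<gamma> d))) + deg {} (\<gamma>(d := Suc (\<gamma> d))) \<le> a"
      then have "Fin (mdeg n (bump \<gamma> d)) \<le> s" "Fin (mdeg n \<gamma>) \<le> s"
        using Fin_le_mono[OF a] by (auto simp: mdeg_def bump_def deg_bumps)
      then show "partial_deriv d V (D \<gamma>) (D (\<gamma>(d := Suc (\<gamma> d))))"
        using D g by (simp add: partials_def partial_deriv_def mults_multi bump_def)
    qed (use D in \<open>auto simp: partials_def\<close>)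
  qed
next
  note dom = open_coord_domain[OF V]
  assume R: "\<forall>a. Fin a \<le> s \<longrightarrow> regular_to_order {..<n} {} (s = Omega) V a 0 f"
  then obtain D where D: "D (\<lambda>_. 0) = f"
    "\<And>\<gamma>. \<gamma> \<in> mults ({..<n} \<union> {}) \<Longrightarrow> Fin (deg {..<n} \<gamma> + deg {} \<gamma>) \<le> s \<and> deg {} \<gamma> = 0 \<Longrightarrow>
        base_regular {..<n} (s = Omega) V (D \<gamma>)"
    "\<And>\<gamma> d. \<gamma> \<in> mults ({..<n} \<union> {}) \<Longrightarrow> d \<in> {..<n} \<union> {} \<Longrightarrow>
      Fin (deg {..<n} (\<gamma>(d := Suc (\<gamma> d))) + deg {} (\<gamma>(d := Suc (\<gamma> d)))) \<le> s \<and>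
          deg {} (\<gamma>(d := Suc (\<gamma> d))) = 0 \<Longrightarrow>
      partial_deriv d V (D \<gamma>) (D (\<gamma>(d := Suc (\<gamma> d))))"
    using partials_of_regular[OF dom, of "\<lambda>a b. Fin a \<le> s \<and> b = 0" "s = Omega" f] by blast
  have "partials n s V f D"
    unfolding partials_def
  proof (intro conjI ballI impI allI)
    fix \<beta> assume b: "\<beta> \<in> multi n" "Fin (mdeg n \<beta>) \<le> s"
    then show "continuous_map (subtopology (Euclidean_space n) V) euclideanreal (D \<beta>)"
      unfolding continuous_map_Euclidean_iff[OF V]
      using D(2)[of \<beta>] by (simp add: mults_multi mdeg_def base_regular_def)
    fix j p assume j: "j < n" "Fin (mdeg n (bump \<beta> j)) \<le> s" and p: "p \<in> V"
    have "partial_deriv j V (D \<beta>) (D (bump \<beta> j))"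
      unfolding bump_def
      by (rule D(3)) (use b j in \<open>simp_all add: mults_multi mdeg_def bump_def\<close>)
    then show "((\<lambda>t. D \<beta> (p(j := t))) has_real_derivative D (bump \<beta> j) p) (at (p j))"
      using p by (simp add: partial_deriv_def)
  qed (use D(1) in auto)
  moreover have "analytic_fun n V f" if "s = Omega"
    using R[rule_format, of 0] that by (simp add: analytic_fun_iff[OF V] base_regular_def)
  ultimately show "C_fun n s V f"
    unfolding C_fun_def by blast
qed

abbreviation leaf_dirs :: "nat \<Rightarrow> (nat + nat) set" where "leaf_dirs k \<equiv> Inl ` {..<k}"
abbreviation trans_dirs :: "nat \<Rightarrow> (nat + nat) set" where "trans_dirs l \<equiv> Inr ` {..<l}"

lemma mem_dirs [simp]: "Inl i \<in> leaf_dirs k \<longleftrightarrow> i < k" "Inr j \<in> trans_dirs l \<longleftrightarrow> j < l"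
  "Inl i \<notin> trans_dirs l" "Inr j \<notin> leaf_dirs k"
  by auto

text \<open>
  A pair of points is encoded as one point whose directions are the disjoint union of the leaf and the
  transversal indices, so that both variables are handled by the theory of one space.
\<close>

definition glue :: "(nat \<Rightarrow> 'b) \<times> (nat \<Rightarrow> 'b) \<Rightarrow> nat + nat \<Rightarrow> 'b" where
  "glue p = case_sum (fst p) (snd p)"

definition unglue :: "(nat + nat \<Rightarrow> 'b) \<Rightarrow> (nat \<Rightarrow> 'b) \<times> (nat \<Rightarrow> 'b)" where
  "unglue q = (q \<circ> Inl, q \<circ> Inr)"

lemma unglue_glue [simp]: "unglue (glue p) = p"
  by (cases p) (simp add: unglue_def glue_def comp_def)

lemma glue_unglue [simp]: "glue (unglue q) = q"
  by (simp add: unglue_def glue_def fun_eq_iff split: sum.split)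

lemma glue_comp [simp]: "glue p \<circ> Inl = fst p" "glue p \<circ> Inr = snd p" "glue (q \<circ> Inl, q \<circ> Inr) = q"
  by (auto simp: glue_def fun_eq_iff split: sum.split)

lemma glue_simps [simp]: "glue p (Inl i) = fst p i" "glue p (Inr j) = snd p j"
  by (auto simp: glue_def)

lemma unglue_update: "unglue ((glue p)(Inl i := t)) = ((fst p)(i := t), snd p)"
  "unglue ((glue p)(Inr j := t)) = (fst p, (snd p)(j := t))"
  by (auto simp: unglue_def fun_eq_iff)

lemma glue_bump: "(glue (\<alpha>, \<beta>))(Inl i := Suc (glue (\<alpha>, \<beta>) (Inl i))) = glue (bump \<alpha> i, \<beta>)"
  "(glue (\<alpha>, \<beta>))(Inr j := Suc (glue (\<alpha>, \<beta>) (Inr j))) = glue (\<alpha>, bump \<beta> j)"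
  by (auto simp: glue_def bump_def fun_eq_iff split: sum.split)

lemma deg_glue: "deg (leaf_dirs k) \<gamma> = mdeg k (\<gamma> \<circ> Inl)" "deg (trans_dirs l) \<gamma> = mdeg l (\<gamma> \<circ> Inr)"
  by (simp_all add: mdeg_def sum.reindex inj_on_def o_def)

lemma mon_glue: "mon (leaf_dirs k) u \<gamma> = mpow k (\<lambda>i. u (Inl i)) (\<gamma> \<circ> Inl)"
  "mon (leaf_dirs k \<union> trans_dirs l) u \<gamma> = mpow k (\<lambda>i. u (Inl i)) (\<gamma> \<circ> Inl) * mpow l (\<lambda>j. u (Inr j)) (\<gamma> \<circ>
      Inr)"
proof -
  show "mon (leaf_dirs k) u \<gamma> = mpow k (\<lambda>i. u (Inl i)) (\<gamma> \<circ> Inl)"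
    by (simp add: mpow_def mon_def prod.reindex inj_on_def o_def)
  have "mon (leaf_dirs k \<union> trans_dirs l) u \<gamma> = mon (leaf_dirs k) u \<gamma> * mon (trans_dirs l) u \<gamma>"
    unfolding mon_def by (rule prod.union_disjoint) auto
  then show "mon (leaf_dirs k \<union> trans_dirs l) u \<gamma> = mpow k (\<lambda>i. u (Inl i)) (\<gamma> \<circ> Inl) * mpow l (\<lambda>j. u
      (Inr j)) (\<gamma> \<circ> Inr)"
    by (simp add: mpow_def mon_def prod.reindex inj_on_def o_def)
qed

lemma mults_glue: "glue (\<alpha>, \<beta>) \<in> mults (leaf_dirs k \<union> trans_dirs l) \<longleftrightarrow> \<alpha> \<in> multi k \<and> \<beta> \<in> multi l"
  "\<gamma> \<in> mults (leaf_dirs k \<union> trans_dirs l) \<longleftrightarrow> \<gamma> \<circ> Inl \<in> multi k \<and> \<gamma> \<circ> Inr \<in> multi l"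
  unfolding mults_def multi_def by (auto simp: split_sum_all not_less)

lemma prod_Euclidean_topspace:
  "p \<in> topspace (prod_Euclidean k l) \<longleftrightarrow> glue p \<in> coordspace (leaf_dirs k \<union> trans_dirs l)"
  by (cases p) (auto simp: topspace_Euclidean_space coordspace_def split_sum_all not_less)

lemma continuous_map_unglue: "continuous_map (top_of_set (coordspace (leaf_dirs k \<union> trans_dirs l)))
    (prod_Euclidean k l) unglue"
proof -
  let ?C = "coordspace (leaf_dirs k \<union> trans_dirs l)"
  have c: "continuous_on ?C (\<lambda>q. q d)" for d
    by (rule continuous_on_subset[OF continuous_on_product_coordinates]) simp
  have "continuous_map (top_of_set ?C) (Euclidean_space k) (\<lambda>q. q \<circ> Inl)"
    unfolding Euclidean_space_def
  proof (rule continuous_map_into_subtopology)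
    show "continuous_map (top_of_set ?C) (powertop_real UNIV) (\<lambda>q. q \<circ> Inl)"
      by (simp add: continuous_map_componentwise_UNIV c)
  qed (auto simp: coordspace_def)
  moreover have "continuous_map (top_of_set ?C) (Euclidean_space l) (\<lambda>q. q \<circ> Inr)"
    unfolding Euclidean_space_def
  proof (rule continuous_map_into_subtopology)
    show "continuous_map (top_of_set ?C) (powertop_real UNIV) (\<lambda>q. q \<circ> Inr)"
      by (simp add: continuous_map_componentwise_UNIV c)
  qed (auto simp: coordspace_def)
  ultimately show ?thesis
    unfolding unglue_def by (simp add: continuous_map_paired)
qed

lemma continuous_map_glue: "continuous_map (prod_Euclidean k l) (top_of_set (coordspace (leaf_dirs k \<union>
    trans_dirs l))) glue"
proof (rule continuous_map_into_subtopology)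
  have E: "continuous_map (Euclidean_space n) euclideanreal (\<lambda>x. x i)" for n i
    unfolding Euclidean_space_def
    by (intro continuous_map_from_subtopology continuous_map_product_projection) simp
  have 1: "continuous_map (prod_Euclidean k l) euclideanreal (\<lambda>p. fst p i)" for i
    using continuous_map_compose[OF continuous_map_fst E] by (simp add: o_def)
  have 2: "continuous_map (prod_Euclidean k l) euclideanreal (\<lambda>p. snd p i)" for i
    using continuous_map_compose[OF continuous_map_snd E] by (simp add: o_def)
  have "continuous_map (prod_Euclidean k l) (powertop_real UNIV) glue"
    unfolding continuous_map_componentwise_UNIV
    by (auto simp: split_sum_all 1 2)
  then show "continuous_map (prod_Euclidean k l) euclidean glue"
    by (simp add: euclidean_product_topology)
  show "glue \<in> topspace (prod_Euclidean k l) \<rightarrow> coordspace (leaf_dirs k \<union> trans_dirs l)"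
    using prod_Euclidean_topspace by blast
qed

lemma glue_image: "glue ` \<Omega> = unglue -` \<Omega>"
  by (auto intro: image_eqI[of _ _ "unglue _"])

lemma open_glue:
  assumes "openin (prod_Euclidean k l) \<Omega>"
  shows "coord_domain (leaf_dirs k) (trans_dirs l) (glue ` \<Omega>)"
proof -
  have "openin (top_of_set (coordspace (leaf_dirs k \<union> trans_dirs l))) {q \<in> coordspace (leaf_dirs k \<union>
      trans_dirs l). unglue q \<in> \<Omega>}"
    using openin_continuous_map_preimage[OF continuous_map_unglue assms] by simp
  moreover have "{q \<in> coordspace (leaf_dirs k \<union> trans_dirs l). unglue q \<in> \<Omega>} = glue ` \<Omega>"
  proof (intro set_eqI iffI)
    fix q assume "q \<in> glue ` \<Omega>"
    then obtain p where p: "p \<in> \<Omega>" "q = glue p" by blast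
    then have "p \<in> topspace (prod_Euclidean k l)" using openin_subset[OF assms] by blast
    then show "q \<in> {q \<in> coordspace (leaf_dirs k \<union> trans_dirs l). unglue q \<in> \<Omega>}"
      using p prod_Euclidean_topspace by simp
  qed (simp add: glue_image)
  moreover have "leaf_dirs k \<inter> trans_dirs l = {}" by blast
  ultimately show ?thesis by (simp add: coord_domain_def)
qed

lemma continuous_glue_iff:
  assumes "openin (prod_Euclidean k l) \<Omega>"
  shows "continuous_map (subtopology (prod_Euclidean k l) \<Omega>) euclideanreal f \<longleftrightarrow>
      continuous_on (glue ` \<Omega>) (f \<circ> unglue)"
proof
  have sub: "glue ` \<Omega> \<subseteq> coordspace (leaf_dirs k \<union> trans_dirs l)"
    using open_glue[OF assms] unfolding coord_domain_def by (meson openin_imp_subset)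
  assume f: "continuous_map (subtopology (prod_Euclidean k l) \<Omega>) euclideanreal f"
  have "continuous_map (top_of_set (glue ` \<Omega>)) (prod_Euclidean k l) unglue"
    using continuous_map_from_subtopology_mono[OF continuous_map_unglue, of "glue ` \<Omega>" k l]
      continuous_map_from_subtopology[OF continuous_map_unglue, of k l "glue ` \<Omega>"] sub
    by (simp add: subtopology_subtopology Int_absorb1)
  then have "continuous_map (top_of_set (glue ` \<Omega>)) (subtopology (prod_Euclidean k l) \<Omega>) unglue"
    by (rule continuous_map_into_subtopology) auto
  from continuous_map_compose[OF this f]
  show "continuous_on (glue ` \<Omega>) (f \<circ> unglue)" by simp
next
  assume f: "continuous_on (glue ` \<Omega>) (f \<circ> unglue)"
  have "continuous_map (subtopology (prod_Euclidean k l) \<Omega>) euclidean glue"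
    by (rule continuous_map_from_subtopology[OF continuous_map_into_fulltopology[OF
        continuous_map_glue]])
  then have "continuous_map (subtopology (prod_Euclidean k l) \<Omega>) (top_of_set (glue ` \<Omega>)) glue"
    by (rule continuous_map_into_subtopology) auto
  from continuous_map_compose[OF this, of euclideanreal "f \<circ> unglue"] f
  show "continuous_map (subtopology (prod_Euclidean k l) \<Omega>) euclideanreal f" by (simp add: o_def)
qed

lemma partial_glue_iff:
  "partial_deriv (Inl i) (glue ` \<Omega>) (f \<circ> unglue) (g \<circ> unglue) \<longleftrightarrow>
    (\<forall>(x, y)\<in>\<Omega>. ((\<lambda>t. f (x(i := t), y)) has_real_derivative g (x, y)) (at (x i)))"
  "partial_deriv (Inr i) (glue ` \<Omega>) (f \<circ> unglue) (g \<circ> unglue) \<longleftrightarrow>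
    (\<forall>(x, y)\<in>\<Omega>. ((\<lambda>t. f (x, y(i := t))) has_real_derivative g (x, y)) (at (y i)))"
  by (auto simp: partial_deriv_def unglue_update)

lemma glue_ball: "(\<forall>x\<in>glue ` \<Omega>. P x) \<longleftrightarrow> (\<forall>p\<in>\<Omega>. P (glue p))"
  by simp

lemma analytic_fun2_alt:
  "analytic_fun2 k l \<Omega> f \<longleftrightarrow> (\<forall>p\<in>\<Omega>. \<exists>e>0. \<exists>c. \<forall>q\<in>\<Omega>.
     (\<forall>i<k. \<bar>fst q i - fst p i\<bar> < e) \<and> (\<forall>j<l. \<bar>snd q j - snd p j\<bar> < e) \<longrightarrow>
     ((\<lambda>z. c (fst z) (snd z) * mpow k (\<lambda>i. fst q i - fst p i) (fst z) * mpow l (\<lambda>j. snd q j - snd p j)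
         (snd z))
        has_sum f q) (multi k \<times> multi l))"
  unfolding analytic_fun2_def case_prod_beta by simp

text \<open>
  Double series over pairs of multi-indices are series over multi-indices of the glued space.
\<close>

lemma analytic_fun2_iff:
  assumes \<Omega>: "openin (prod_Euclidean k l) \<Omega>"
  shows "analytic_fun2 k l \<Omega> f \<longleftrightarrow> real_analytic_in (leaf_dirs k \<union> trans_dirs l) (glue ` \<Omega>) (f \<circ> unglue)"
proof -
  let ?I = "leaf_dirs k \<union> trans_dirs l"
  have same: "glue q d = glue p d" if "p \<in> \<Omega>" "q \<in> \<Omega>" "d \<notin> ?I" for p q d
  proof -
    have "glue p d = 0" "glue q d = 0"
      using that by (intro coord_domain_subset[OF open_glue[OF \<Omega>]]; simp)+
    then show ?thesis by simp
  qed
  have near: "(\<forall>d\<in>?I. \<bar>glue q d - glue p d\<bar> < e) \<longleftrightarrow>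
      (\<forall>i<k. \<bar>fst q i - fst p i\<bar> < e) \<and> (\<forall>j<l. \<bar>snd q j - snd p j\<bar> < e)" for p q :: "point \<times> point" and
          e
    by (auto simp: ball_Un)
  have sumiff: "((\<lambda>\<gamma>. c' \<gamma> * mon ?I (\<lambda>d. glue q d - glue p d) \<gamma>) has_sum S) (mults ?I) \<longleftrightarrow>
    ((\<lambda>z. c (fst z) (snd z) * mpow k (\<lambda>i. fst q i - fst p i) (fst z) * mpow l (\<lambda>j. snd q j - snd p j)
        (snd z)) has_sum S) (multi k \<times> multi l)"
    if "\<And>\<gamma>. c' \<gamma> = c (\<gamma> \<circ> Inl) (\<gamma> \<circ> Inr)" for c' :: "(nat + nat \<Rightarrow> nat) \<Rightarrow> real"
        and c and q p :: "point \<times> point" and S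
    by (rule has_sum_reindex_bij_witness[of _ glue unglue])
       (auto simp: mults_glue mon_glue that unglue_def mult.assoc)
  show ?thesis
    unfolding analytic_fun2_alt real_analytic_in_def glue_ball
  proof (intro ball_cong refl iffI; elim exE conjE)
    fix p e c assume p: "p \<in> \<Omega>" and e: "(0::real) < e" and c: "\<forall>q\<in>\<Omega>.
     (\<forall>i<k. \<bar>fst q i - fst p i\<bar> < e) \<and> (\<forall>j<l. \<bar>snd q j - snd p j\<bar> < e) \<longrightarrow>
     ((\<lambda>z. c (fst z) (snd z) * mpow k (\<lambda>i. fst q i - fst p i) (fst z) * mpow l (\<lambda>j. snd q j - snd p j)
         (snd z))
        has_sum f q) (multi k \<times> multi l)"
    have "((\<lambda>\<alpha>. c (\<alpha> \<circ> Inl) (\<alpha> \<circ> Inr) * mon ?I (\<lambda>d. glue q d - glue p d) \<alpha>) has_sum (f \<circ> unglue) (glue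
        q)) (mults ?I)"
      if "q \<in> \<Omega>" "\<forall>d\<in>?I. \<bar>glue q d - glue p d\<bar> < e" for q
      using that c unfolding near by (subst sumiff[of _ c]) simp_all
    then show "\<exists>e>0. \<exists>c. \<forall>q\<in>\<Omega>. (\<forall>d. d \<notin> ?I \<longrightarrow> glue q d = glue p d) \<longrightarrow> (\<forall>d\<in>?I. \<bar>glue q d - glue p d\<bar> < e) \<longrightarrow>
        ((\<lambda>\<alpha>. c \<alpha> * mon ?I (\<lambda>d. glue q d - glue p d) \<alpha>) has_sum (f \<circ> unglue) (glue q)) (mults ?I)"
      using e by (intro exI[of _ e] conjI exI[of _ "\<lambda>\<gamma>. c (\<gamma> \<circ> Inl) (\<gamma> \<circ> Inr)"]) blast+
  next
    fix p e c assume p: "p \<in> \<Omega>" and e: "(0::real) < e"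
      and c: "\<forall>q\<in>\<Omega>. (\<forall>d. d \<notin> ?I \<longrightarrow> glue q d = glue p d) \<longrightarrow> (\<forall>d\<in>?I. \<bar>glue q d - glue p d\<bar> < e) \<longrightarrow>
        ((\<lambda>\<alpha>. c \<alpha> * mon ?I (\<lambda>d. glue q d - glue p d) \<alpha>) has_sum (f \<circ> unglue) (glue q)) (mults ?I)"
    have cc: "c \<gamma> = c (glue (\<gamma> \<circ> Inl, \<gamma> \<circ> Inr))" for \<gamma> by simp
    have "((\<lambda>z. c (glue (fst z, snd z)) * mpow k (\<lambda>i. fst q i - fst p i) (fst z) * mpow l (\<lambda>j. snd q j -
        snd p j) (snd z))
        has_sum f q) (multi k \<times> multi l)"
      if q: "q \<in> \<Omega>" and n: "(\<forall>i<k. \<bar>fst q i - fst p i\<bar> < e) \<and> (\<forall>j<l. \<bar>snd q j - snd p j\<bar> < e)" for q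
    proof -
      have "((\<lambda>\<alpha>. c \<alpha> * mon ?I (\<lambda>d. glue q d - glue p d) \<alpha>) has_sum (f \<circ> unglue) (glue q)) (mults ?I)"
        using c q n[folded near] same[OF p q] by blast
      then show ?thesis
        unfolding sumiff[of c "\<lambda>\<alpha> \<beta>. c (glue (\<alpha>, \<beta>))", OF cc] by simp
    qed
    then show "\<exists>e>0. \<exists>c. \<forall>q\<in>\<Omega>.
     (\<forall>i<k. \<bar>fst q i - fst p i\<bar> < e) \<and> (\<forall>j<l. \<bar>snd q j - snd p j\<bar> < e) \<longrightarrow>
     ((\<lambda>z. c (fst z) (snd z) * mpow k (\<lambda>i. fst q i - fst p i) (fst z) * mpow l (\<lambda>j. snd q j - snd p j)
         (snd z))
        has_sum f q) (multi k \<times> multi l)"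
      using e by (intro exI[of _ e] conjI exI[of _ "\<lambda>\<alpha> \<beta>. c (glue (\<alpha>, \<beta>))"]) blast+
  qed
qed

lemma slice_ball: "(\<forall>x\<in>{x. (x, y) \<in> \<Omega>}. R x) \<longleftrightarrow> (\<forall>q\<in>\<Omega>. snd q = y \<longrightarrow> R (fst q))"
  by force

lemma slices_ball: "(\<forall>y. \<forall>q\<in>\<Omega>. snd q = y \<longrightarrow> P q y) \<longleftrightarrow> (\<forall>q\<in>\<Omega>. P q (snd q))"
  by blast

lemma analytic_leafwise_alt:
  "(\<forall>y. analytic_fun k {x. (x, y) \<in> \<Omega>} (\<lambda>x. f (x, y))) \<longleftrightarrow> (\<forall>p\<in>\<Omega>. \<exists>e>0. \<exists>c. \<forall>q\<in>\<Omega>. snd q = snd p \<longrightarrow>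
     (\<forall>i<k. \<bar>fst q i - fst p i\<bar> < e) \<longrightarrow>
     ((\<lambda>\<alpha>. c \<alpha> * mpow k (\<lambda>i. fst q i - fst p i) \<alpha>) has_sum f (fst q, snd p)) (multi k))"
  unfolding analytic_fun_def slice_ball slices_ball ..

text \<open>
  Freezing the transversal coordinates of the glued space is restricting to a slice.
\<close>

lemma analytic_leafwise_iff:
  assumes \<Omega>: "openin (prod_Euclidean k l) \<Omega>"
  shows "(\<forall>y. analytic_fun k {x. (x, y) \<in> \<Omega>} (\<lambda>x. f (x, y))) \<longleftrightarrow>
    real_analytic_in (leaf_dirs k) (glue ` \<Omega>) (f \<circ> unglue)"
proof -
  let ?I = "leaf_dirs k"
  have same: "(\<forall>d. d \<notin> ?I \<longrightarrow> glue q d = glue p d) \<longleftrightarrow> snd q = snd p" if "p \<in> \<Omega>" "q \<in> \<Omega>" for p q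
  proof -
    have "glue p (Inl i) = 0" "glue q (Inl i) = 0" if "\<not> i < k" for i
      using that \<open>p \<in> \<Omega>\<close> \<open>q \<in> \<Omega>\<close> by (intro coord_domain_subset[OF open_glue[OF \<Omega>]]; simp)+
    then show ?thesis by (auto simp: split_sum_all fun_eq_iff)
  qed
  have near: "(\<forall>d\<in>?I. \<bar>glue q d - glue p d\<bar> < e) \<longleftrightarrow> (\<forall>i<k. \<bar>fst q i - fst p i\<bar> < e)"
    for p q :: "point \<times> point" and e by auto
  have sumiff: "((\<lambda>\<gamma>. c' \<gamma> * mon ?I (\<lambda>d. glue q d - glue p d) \<gamma>) has_sum S) (mults ?I) \<longleftrightarrow>
    ((\<lambda>\<alpha>. c \<alpha> * mpow k (\<lambda>i. fst q i - fst p i) \<alpha>) has_sum S) (multi k)"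
    if "\<And>\<alpha>. c' (glue (\<alpha>, \<lambda>_. 0)) = c \<alpha>" for c' :: "(nat + nat \<Rightarrow> nat) \<Rightarrow> real"
        and c and p q :: "point \<times> point" and S
  proof (rule has_sum_reindex_bij_witness[of _ "\<lambda>\<alpha>. glue (\<alpha>, \<lambda>_. 0)" "\<lambda>\<gamma>. \<gamma> \<circ> Inl"])
    fix \<gamma> assume "\<gamma> \<in> mults ?I"
    then have "\<gamma> \<circ> Inr = (\<lambda>_. 0)" by (auto simp: mults_def fun_eq_iff)
    then have "glue (\<gamma> \<circ> Inl, \<lambda>_. 0) = \<gamma>" using glue_comp(3)[of \<gamma>] by simp
    then show "glue (\<gamma> \<circ> Inl, \<lambda>_. 0) = \<gamma>"
        "c (\<gamma> \<circ> Inl) * mpow k (\<lambda>i. fst q i - fst p i) (\<gamma> \<circ> Inl) = c' \<gamma> * mon ?I (\<lambda>d. glue q d - glue p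
            d) \<gamma>"
      using that[of "\<gamma> \<circ> Inl"] by (simp_all add: mon_glue)
    show "\<gamma> \<circ> Inl \<in> multi k"
        using \<open>\<gamma> \<in> mults ?I\<close> by (auto simp: mults_def multi_def split_sum_all not_less)
  qed (auto simp: mults_def multi_def split_sum_all not_less)
  show ?thesis
    unfolding analytic_leafwise_alt real_analytic_in_def glue_ball
  proof (intro ball_cong refl iffI; elim exE conjE)
    fix p e c assume p: "p \<in> \<Omega>" and e: "(0::real) < e" and c: "\<forall>q\<in>\<Omega>. snd q = snd p \<longrightarrow>
     (\<forall>i<k. \<bar>fst q i - fst p i\<bar> < e) \<longrightarrow>
     ((\<lambda>\<alpha>. c \<alpha> * mpow k (\<lambda>i. fst q i - fst p i) \<alpha>) has_sum f (fst q, snd p)) (multi k)"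
    have "((\<lambda>\<alpha>. c (\<alpha> \<circ> Inl) * mon ?I (\<lambda>d. glue q d - glue p d) \<alpha>) has_sum (f \<circ> unglue) (glue q)) (mults
        ?I)"
      if "q \<in> \<Omega>" "\<forall>d. d \<notin> ?I \<longrightarrow> glue q d = glue p d" "\<forall>d\<in>?I. \<bar>glue q d - glue p d\<bar> < e" for q
    proof -
      have "((\<lambda>\<alpha>. c \<alpha> * mpow k (\<lambda>i. fst q i - fst p i) \<alpha>) has_sum f (fst q, snd p)) (multi k)"
        using c that(1,3) that(2)[unfolded same[OF p that(1)]] unfolding near by blast
      moreover have "(fst q, snd p) = q" using that(2)[unfolded same[OF p that(1)]]
          by (metis prod.collapse)
      ultimately show ?thesis by (subst sumiff[of _ c]) simp_all
    qed
    then show "\<exists>e>0. \<exists>c. \<forall>q\<in>\<Omega>. (\<forall>d. d \<notin> ?I \<longrightarrow> glue q d = glue p d) \<longrightarrow> (\<forall>d\<in>?I. \<bar>glue q d - glue p d\<bar> < e) \<longrightarrow>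
        ((\<lambda>\<alpha>. c \<alpha> * mon ?I (\<lambda>d. glue q d - glue p d) \<alpha>) has_sum (f \<circ> unglue) (glue q)) (mults ?I)"
      using e by (intro exI[of _ e] conjI exI[of _ "\<lambda>\<gamma>. c (\<gamma> \<circ> Inl)"]) blast+
  next
    fix p e c assume p: "p \<in> \<Omega>" and e: "(0::real) < e"
      and c: "\<forall>q\<in>\<Omega>. (\<forall>d. d \<notin> ?I \<longrightarrow> glue q d = glue p d) \<longrightarrow> (\<forall>d\<in>?I. \<bar>glue q d - glue p d\<bar> < e) \<longrightarrow>
        ((\<lambda>\<alpha>. c \<alpha> * mon ?I (\<lambda>d. glue q d - glue p d) \<alpha>) has_sum (f \<circ> unglue) (glue q)) (mults ?I)"
    have "((\<lambda>\<alpha>. c (glue (\<alpha>, \<lambda>_. 0)) * mpow k (\<lambda>i. fst q i - fst p i) \<alpha>) has_sum f (fst q,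
        snd p)) (multi k)"
      if q: "q \<in> \<Omega>" "snd q = snd p" and n: "\<forall>i<k. \<bar>fst q i - fst p i\<bar> < e" for q
    proof -
      have "((\<lambda>\<alpha>. c \<alpha> * mon ?I (\<lambda>d. glue q d - glue p d) \<alpha>) has_sum (f \<circ> unglue) (glue q)) (mults ?I)"
        using c q(1) n[folded near] q(2)[folded same[OF p q(1)]] by blast
      moreover have "(fst q, snd p) = q" using q(2) by (metis prod.collapse)
      ultimately show ?thesis
        unfolding sumiff[of c "\<lambda>\<alpha>. c (glue (\<alpha>, \<lambda>_. 0))", OF refl] by simp
    qed
    then show "\<exists>e>0. \<exists>c. \<forall>q\<in>\<Omega>. snd q = snd p \<longrightarrow>
     (\<forall>i<k. \<bar>fst q i - fst p i\<bar> < e) \<longrightarrow>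
     ((\<lambda>\<alpha>. c \<alpha> * mpow k (\<lambda>i. fst q i - fst p i) \<alpha>) has_sum f (fst q, snd p)) (multi k)"
      using e by (intro exI[of _ e] conjI exI[of _ "\<lambda>\<alpha>. c (glue (\<alpha>, \<lambda>_. 0))"]) blast+
  qed
qed

section \<open>Composition of maps of foliated form\<close>

lemma upd_comp: "(\<gamma>(Inl i := Suc (\<gamma> (Inl i)))) \<circ> Inl = bump (\<gamma> \<circ> Inl) i"
    "(\<gamma>(Inl i := n)) \<circ> Inr = \<gamma> \<circ> Inr"
  "(\<gamma>(Inr j := Suc (\<gamma> (Inr j)))) \<circ> Inr = bump (\<gamma> \<circ> Inr) j" "(\<gamma>(Inr j := n)) \<circ> Inl = \<gamma> \<circ> Inl"
  by (auto simp: bump_def fun_eq_iff)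

lemma comp_glue_unglue [simp]: "f \<circ> glue \<circ> unglue = f"
  by (simp add: fun_eq_iff)

text \<open>
  The budgets \<open>a \<le> r\<close> and \<open>b \<le> s\<close> run over natural numbers only, which covers finite and infinite orders
  uniformly; \<open>regular_to_order\<close> with \<open>an\<close> accounts for \<open>r = \<omega>\<close>, and the last conjunct for \<open>s = \<omega>\<close>.
\<close>

lemma C_rs_fun_iff:
  assumes \<Omega>: "openin (prod_Euclidean k l) \<Omega>"
  shows "C_rs_fun k l r s \<Omega> f \<longleftrightarrow>
    (\<forall>a b. Fin a \<le> r \<and> Fin b \<le> s \<longrightarrow>
       regular_to_order (leaf_dirs k) (trans_dirs l) (r = Omega) (glue ` \<Omega>) a b (f \<circ> unglue)) \<and>
    (s = Omega \<longrightarrow> real_analytic_in (leaf_dirs k \<union> trans_dirs l) (glue ` \<Omega>) (f \<circ> unglue))"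
  (is "?C \<longleftrightarrow> ?R \<and> ?A")
proof (intro iffI conjI)
  note dom = open_glue[OF \<Omega>]
  let ?V = "glue ` \<Omega>"
  assume ?C
  then show ?A unfolding C_rs_fun_def analytic_fun2_iff[OF \<Omega>] by blast
  from \<open>?C\<close> obtain D where D: "rs_partials k l r s \<Omega> f D"
    and an: "\<And>\<beta>. r = Omega \<Longrightarrow> \<beta> \<in> multi l \<Longrightarrow> Fin (mdeg l \<beta>) \<le> s \<Longrightarrow>
       (\<forall>y. analytic_fun k {x. (x, y) \<in> \<Omega>} (\<lambda>x. D (\<lambda>_. 0) \<beta> (x, y)))"
    unfolding C_rs_fun_def by blast
  define D' where "D' \<gamma> = D (\<gamma> \<circ> Inl) (\<gamma> \<circ> Inr) \<circ> unglue" for \<gamma>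
  show ?R
  proof (intro allI impI, elim conjE)
    fix a b assume ab: "Fin a \<le> r" "Fin b \<le> s"
    have idx: "rs_index k l r s (\<gamma> \<circ> Inl) (\<gamma> \<circ> Inr)"
      if "deg (trans_dirs l) \<gamma> \<le> b" "deg (leaf_dirs k) \<gamma> + deg (trans_dirs l) \<gamma> \<le> a" for \<gamma>
      using Fin_le_mono[OF ab(1)] Fin_le_mono[OF ab(2)] that by (simp add: rs_index_def deg_glue)
    show "regular_to_order (leaf_dirs k) (trans_dirs l) (r = Omega) ?V a b (f \<circ> unglue)"
    proof (rule regular_of_partials[OF dom, where D = D'])
      fix \<gamma> assume g: "\<gamma> \<in> mults (leaf_dirs k \<union> trans_dirs l)"
        "deg (trans_dirs l) \<gamma> \<le> b" "deg (leaf_dirs k) \<gamma> + deg (trans_dirs l) \<gamma> \<le> a"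
      show "continuous_on ?V (D' \<gamma>)"
        using D idx[OF g(2,3)] g(1) unfolding D'_def continuous_glue_iff[OF \<Omega>, symmetric]
        by (simp add: rs_partials_def mults_glue)
      assume r: "r = Omega" and L: "deg (leaf_dirs k) \<gamma> = 0"
      have "\<gamma> (Inl i) = 0" for i
        using L g(1) by (cases "i < k") (auto simp: mults_def)
      then have "\<gamma> \<circ> Inl = (\<lambda>_. 0)" by auto
      then show "real_analytic_in (leaf_dirs k) ?V (D' \<gamma>)"
        unfolding D'_def analytic_leafwise_iff[OF \<Omega>, symmetric]
        using an[OF r, of "\<gamma> \<circ> Inr"] g(1) idx[OF g(2,3)] by (simp add: mults_glue rs_index_def)
    next
      fix \<gamma> d assume g: "\<gamma> \<in> mults (leaf_dirs k \<union> trans_dirs l)" and d: "d \<in> leaf_dirs k \<union> trans_dirs l"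
        and le: "deg (trans_dirs l) (\<gamma>(d := Suc (\<gamma> d))) \<le> b"
          "deg (leaf_dirs k) (\<gamma>(d := Suc (\<gamma> d))) + deg (trans_dirs l) (\<gamma>(d := Suc (\<gamma> d))) \<le> a"
      note idx' = idx[OF le]
      have "deg (trans_dirs l) \<gamma> \<le> b" "deg (leaf_dirs k) \<gamma> + deg (trans_dirs l) \<gamma> \<le> a"
        using le unfolding deg_bump[OF finite_imageI[OF finite_lessThan]] by (auto split: if_splits)
      note idx0 = idx[OF this]
      show "partial_deriv d ?V (D' \<gamma>) (D' (\<gamma>(d := Suc (\<gamma> d))))"
        using d
      proof
        assume "d \<in> leaf_dirs k"
        then obtain i where i: "d = Inl i" "i < k" by auto
        show ?thesis
          using D idx' idx0 g i unfolding D'_def i(1) upd_comp partial_glue_iff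
          by (simp add: rs_partials_def mults_glue)
      next
        assume "d \<in> trans_dirs l"
        then obtain i where i: "d = Inr i" "i < l" by auto
        show ?thesis
          using D idx' idx0 g i unfolding D'_def i(1) upd_comp partial_glue_iff
          by (simp add: rs_partials_def mults_glue)
      qed
    next
      show "D' (\<lambda>_. 0) p = (f \<circ> unglue) p" if "p \<in> ?V" for p
        using D that by (auto simp: D'_def rs_partials_def o_def)
    qed
  qed
next
  note dom = open_glue[OF \<Omega>]
  let ?V = "glue ` \<Omega>"
  let ?L = "leaf_dirs k" and ?T = "trans_dirs l"
  assume RA: "?R \<and> ?A"
  then obtain D where D: "D (\<lambda>_. 0) = f \<circ> unglue"
    "\<And>\<gamma>. \<gamma> \<in> mults (?L \<union> ?T) \<Longrightarrow> Fin (deg ?L \<gamma> + deg ?T \<gamma>) \<le> r \<and> Fin (deg ?T \<gamma>) \<le> s \<Longrightarrow>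
        base_regular ?L (r = Omega) ?V (D \<gamma>)"
    "\<And>\<gamma> d. \<gamma> \<in> mults (?L \<union> ?T) \<Longrightarrow> d \<in> ?L \<union> ?T \<Longrightarrow>
      Fin (deg ?L (\<gamma>(d := Suc (\<gamma> d))) + deg ?T (\<gamma>(d := Suc (\<gamma> d)))) \<le> r \<and>
          Fin (deg ?T (\<gamma>(d := Suc (\<gamma> d)))) \<le> s \<Longrightarrow>
      partial_deriv d ?V (D \<gamma>) (D (\<gamma>(d := Suc (\<gamma> d))))"
    using partials_of_regular[OF dom, of "\<lambda>a b. Fin a \<le> r \<and> Fin b \<le> s" "r = Omega"
        "f \<circ> unglue"] by blast
  define D' where "D' \<alpha> \<beta> = D (glue (\<alpha>, \<beta>)) \<circ> glue" for \<alpha> \<beta>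
  have base: "base_regular ?L (r = Omega) ?V (D' \<alpha> \<beta> \<circ> unglue)"
    if "\<alpha> \<in> multi k" "\<beta> \<in> multi l" "rs_index k l r s \<alpha> \<beta>" for \<alpha> \<beta>
    using D(2)[of "glue (\<alpha>, \<beta>)"] that by (simp add: D'_def mults_glue deg_glue rs_index_def)
  have "rs_partials k l r s \<Omega> f D'"
    unfolding rs_partials_def
  proof (intro conjI ballI impI allI)
    have "glue (\<lambda>_. 0, \<lambda>_. 0) = (\<lambda>_. 0 :: nat)" by (auto simp: glue_def fun_eq_iff split: sum.split)
    then show "D' (\<lambda>_. 0) (\<lambda>_. 0) p = f p" for p using D(1) by (simp add: D'_def)
  next
    fix \<alpha> \<beta> assume ab: "\<alpha> \<in> multi k" "\<beta> \<in> multi l" "rs_index k l r s \<alpha> \<beta>"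
    show "continuous_map (subtopology (prod_Euclidean k l) \<Omega>) euclideanreal (D' \<alpha> \<beta>)"
      unfolding continuous_glue_iff[OF \<Omega>] using base[OF ab] by (simp add: base_regular_def)
    fix i p assume i: "i < k" "rs_index k l r s (bump \<alpha> i) \<beta>" and p: "p \<in> \<Omega>"
    have "partial_deriv (Inl i) ?V (D (glue (\<alpha>, \<beta>))) (D (glue (bump \<alpha> i, \<beta>)))"
      unfolding glue_bump[symmetric]
      by (rule D(3)) (use ab i in \<open>simp_all only: glue_bump deg_glue glue_comp mults_glue fst_conv
          snd_conv rs_index_def, auto\<close>)
    then have "partial_deriv (Inl i) ?V (D' \<alpha> \<beta> \<circ> unglue) (D' (bump \<alpha> i) \<beta> \<circ> unglue)"
        by (simp add: D'_def)
    then show "case p of (x, y) \<Rightarrow> ((\<lambda>t. D' \<alpha> \<beta> (x(i := t), y)) has_real_derivative D' (bump \<alpha> i) \<beta> (x,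
        y)) (at (x i))"
      unfolding partial_glue_iff using p by blast
  next
    fix \<alpha> \<beta> i p assume ab: "\<alpha> \<in> multi k" "\<beta> \<in> multi l" "rs_index k l r s \<alpha> \<beta>"
      and i: "i < l" "rs_index k l r s \<alpha> (bump \<beta> i)" and p: "p \<in> \<Omega>"
    have "partial_deriv (Inr i) ?V (D (glue (\<alpha>, \<beta>))) (D (glue (\<alpha>, bump \<beta> i)))"
      unfolding glue_bump[symmetric]
      by (rule D(3)) (use ab i in \<open>simp_all only: glue_bump deg_glue glue_comp mults_glue fst_conv
          snd_conv rs_index_def, auto\<close>)
    then have "partial_deriv (Inr i) ?V (D' \<alpha> \<beta> \<circ> unglue) (D' \<alpha> (bump \<beta> i) \<circ> unglue)"
        by (simp add: D'_def)
    then show "case p of (x, y) \<Rightarrow> ((\<lambda>t. D' \<alpha> \<beta> (x, y(i := t))) has_real_derivative D' \<alpha> (bump \<beta> i) (x,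
        y)) (at (y i))"
      unfolding partial_glue_iff using p by blast
  qed
  moreover have "\<forall>y. analytic_fun k {x. (x, y) \<in> \<Omega>} (\<lambda>x. D' (\<lambda>_. 0) \<beta> (x, y))"
    if "r = Omega" "\<beta> \<in> multi l" "Fin (mdeg l \<beta>) \<le> s" for \<beta>
  proof -
    have "base_regular ?L (r = Omega) ?V (D' (\<lambda>_. 0) \<beta> \<circ> unglue)"
      by (rule base) (use that in \<open>auto simp: multi_def rs_index_def\<close>)
    then show ?thesis
      unfolding analytic_leafwise_iff[OF \<Omega>] using that by (simp add: base_regular_def)
  qed
  ultimately show ?C
    unfolding C_rs_fun_def analytic_fun2_iff[OF \<Omega>] using RA by blast
qed

lemma open_snd_image:
  assumes "openin (prod_Euclidean k l) \<Omega>"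
  shows "openin (Euclidean_space l) (snd ` \<Omega>)"
  using open_map_snd[of "Euclidean_space k" "Euclidean_space l"] assms by (simp add: open_map_def)

text \<open>
  The \<open>C\<^sup>s\<close> component \<open>Y\<close> of a foliated map, regarded as a function of both variables.
\<close>

lemma transversal_regular:
  assumes \<Omega>: "openin (prod_Euclidean k l) \<Omega>" and Y: "C_fun l s (snd ` \<Omega>) Y"
  shows "Fin b \<le> s \<Longrightarrow> regular_to_order (leaf_dirs k) (trans_dirs l) an (glue ` \<Omega>) a b (\<lambda>q. Y (q \<circ> Inr))"
    and "s = Omega \<Longrightarrow> real_analytic_in (leaf_dirs k \<union> trans_dirs l) (glue ` \<Omega>) (\<lambda>q. Y (q \<circ> Inr))"
proof -
  note dom = open_glue[OF \<Omega>]
  have dom': "coord_domain {} {..<l} (snd ` \<Omega>)" "coord_domain {..<l} {} (snd ` \<Omega>)"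
    using open_coord_domain[OF open_snd_image[OF \<Omega>]] by (auto simp: coord_domain_def)
  have R: "regular_to_order {..<l} {} (s = Omega) (snd ` \<Omega>) b 0 Y" if "Fin b \<le> s" for b
    using Y that unfolding C_fun_iff[OF open_snd_image[OF \<Omega>]] by blast
  have im: "q \<circ> Inr \<in> snd ` \<Omega>" if "q \<in> glue ` \<Omega>" for q
    using that by (auto intro: rev_image_eqI)
  show "regular_to_order (leaf_dirs k) (trans_dirs l) an (glue ` \<Omega>) a b (\<lambda>q. Y (q \<circ> Inr))"
      if b: "Fin b \<le> s"
  proof (rule regular_compose[where F = "\<lambda>q. q \<circ> Inr" and g = Y, OF dom dom'(1)])
    show "regular_to_order {} {..<l} an (snd ` \<Omega>) a b Y"
      by (rule regular_transversal[OF R[OF b]])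
    show "(p \<circ> Inr) d = (q \<circ> Inr) d" if "\<forall>e. e \<notin> leaf_dirs k \<longrightarrow> p e = q e" for p q :: "nat + nat \<Rightarrow> real"
        and d
      using that by simp
    show "regular_to_order (leaf_dirs k) (trans_dirs l) an (glue ` \<Omega>) a b (\<lambda>p. (p \<circ> Inr) d)" for d
      using coord_regular[OF dom] by simp
  qed (use im in auto)
  assume s: "s = Omega"
  have "real_analytic_in {..<l} (snd ` \<Omega>) Y"
    using R[of 0] s by (simp add: base_regular_def)
  then show "real_analytic_in (leaf_dirs k \<union> trans_dirs l) (glue ` \<Omega>) (\<lambda>q. Y (q \<circ> Inr))"
  proof (rule real_analytic_in_compose[where F = "\<lambda>q. q \<circ> Inr"
      and g = Y, OF dom order_refl dom'(2), rotated 2])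
    show "real_analytic_in (leaf_dirs k \<union> trans_dirs l) (glue ` \<Omega>) (\<lambda>p. (p \<circ> Inr) d)" for d
      using coord_analytic[OF dom order_refl] by simp
    show "(p \<circ> Inr) d = (q \<circ> Inr) d" if "p \<in> glue ` \<Omega>" "q \<in> glue ` \<Omega>" "d \<notin> {..<l}" for p q d
      using coord_domain_subset[OF dom'(2) im[OF that(1)], of d] coord_domain_subset[OF dom'(2) im[OF
          that(2)], of d] that(3)
      by simp
  qed (use im in auto)
qed

lemma fol_form_cong: "fol_form k l r s \<Omega> f \<Longrightarrow> (\<And>p. p \<in> \<Omega> \<Longrightarrow> f p = g p) \<Longrightarrow> fol_form k l r s \<Omega> g"
  unfolding fol_form_def by (elim exE conjE, intro exI conjI, auto)

text \<open>
  The leaf component of the composite is \<open>X'(X(x, y), Y(y))\<close> and the transversal one is \<open>Y'(Y(y))\<close>. Both are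
  covered by \<open>regular_compose\<close> and \<open>real_analytic_in_compose\<close>; the second map is evaluated along \<open>F\<close>, the
  first map in glued coordinates.
\<close>

lemma fol_form_compose:
  assumes \<Omega>: "openin (prod_Euclidean k l) \<Omega>" and \<Omega>': "openin (prod_Euclidean k l) \<Omega>'"
    and f: "fol_form k l r s \<Omega> f" and g: "fol_form k l r s \<Omega>' g" and im: "f ` \<Omega> \<subseteq> \<Omega>'"
  shows "fol_form k l r s \<Omega> (g \<circ> f)"
proof -
  let ?L = "leaf_dirs k" and ?T = "trans_dirs l"
  note dom = open_glue[OF \<Omega>] and dom' = open_glue[OF \<Omega>']
  obtain X Y where f: "\<And>p. p \<in> \<Omega> \<Longrightarrow> f p = (X p, Y (snd p))"
    and X: "\<And>i. i < k \<Longrightarrow> C_rs_fun k l r s \<Omega> (\<lambda>p. X p i)"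
    and Y: "\<And>j. j < l \<Longrightarrow> C_fun l s (snd ` \<Omega>) (\<lambda>y. Y y j)"
    using f unfolding fol_form_def case_prod_beta by (metis prod.collapse)
  obtain X' Y' where g: "\<And>p. p \<in> \<Omega>' \<Longrightarrow> g p = (X' p, Y' (snd p))"
    and X': "\<And>i. i < k \<Longrightarrow> C_rs_fun k l r s \<Omega>' (\<lambda>p. X' p i)"
    and Y': "\<And>j. j < l \<Longrightarrow> C_fun l s (snd ` \<Omega>') (\<lambda>y. Y' y j)"
    using g unfolding fol_form_def case_prod_beta by (metis prod.collapse)
  define F where "F q = glue (X (unglue q), Y (q \<circ> Inr))" for q
  have Fim: "F q \<in> glue ` \<Omega>'" if "q \<in> glue ` \<Omega>" for q
    using that im f by (fastforce simp: F_def)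
  have F0: "F q d = 0" if "q \<in> glue ` \<Omega>" "d \<notin> ?L \<union> ?T" for q d
    using coord_domain_subset[OF dom' Fim[OF that(1)] that(2)] .
  have FR: "regular_to_order ?L ?T (r = Omega) (glue ` \<Omega>) a b (\<lambda>q. F q d)"
    if "Fin a \<le> r" "Fin b \<le> s" "d \<in> ?L \<union> ?T" for a b d
    using that(3)
  proof
    assume "d \<in> ?L"
    then obtain i where i: "d = Inl i" "i < k" by auto
    then show ?thesis using X[OF i(2)] that(1,2) unfolding C_rs_fun_iff[OF \<Omega>] by (simp add: F_def o_def)
  next
    assume "d \<in> ?T"
    then obtain j where j: "d = Inr j" "j < l" by auto
    then show ?thesis using transversal_regular(1)[OF \<Omega> Y[OF j(2)] that(2)] by (simp add: F_def)
  qed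
  have FA: "real_analytic_in (?L \<union> ?T) (glue ` \<Omega>) (\<lambda>q. F q d)" if "s = Omega" "d \<in> ?L \<union> ?T" for d
    using that(2)
  proof
    assume "d \<in> ?L"
    then obtain i where i: "d = Inl i" "i < k" by auto
    then show ?thesis using X[OF i(2)] that(1) unfolding C_rs_fun_iff[OF \<Omega>] by (simp add: F_def o_def)
  next
    assume "d \<in> ?T"
    then obtain j where j: "d = Inr j" "j < l" by auto
    then show ?thesis using transversal_regular(2)[OF \<Omega> Y[OF j(2)] that(1)] by (simp add: F_def)
  qed
  have comp: "((\<lambda>p. X' (X p, Y (snd p)) i) \<circ> unglue) = (\<lambda>q. ((\<lambda>p. X' p i) \<circ> unglue) (F q))" for i
    by (auto simp: F_def fun_eq_iff) (simp add: unglue_def)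
  have "C_rs_fun k l r s \<Omega> (\<lambda>p. X' (X p, Y (snd p)) i)" if i: "i < k" for i
    unfolding C_rs_fun_iff[OF \<Omega>] comp
  proof (intro conjI allI impI; (elim conjE)?)
    fix a b assume ab: "Fin a \<le> r" "Fin b \<le> s"
    show "regular_to_order ?L ?T (r = Omega) (glue ` \<Omega>) a b (\<lambda>q. ((\<lambda>p. X' p i) \<circ> unglue) (F q))"
    proof (rule regular_compose[where F = F and g = "(\<lambda>p. X' p i) \<circ> unglue", OF dom dom' Fim])
      show "regular_to_order ?L ?T (r = Omega) (glue ` \<Omega>') a b ((\<lambda>p. X' p i) \<circ> unglue)"
        using X'[OF i] ab unfolding C_rs_fun_iff[OF \<Omega>'] by blast
      show "F p d = F q d" if pq: "p \<in> glue ` \<Omega>" "q \<in> glue ` \<Omega>" "\<forall>e. e \<notin> ?L \<longrightarrow> p e = q e" "d \<notin> ?L"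
          for p q d
      proof (cases d)
        case (Inl i)
        then have "d \<notin> ?L \<union> ?T" using pq(4) by auto
        then show ?thesis using F0 pq by simp
      next
        case (Inr j)
        have "p \<circ> Inr = q \<circ> Inr" using pq(3) by (auto simp: fun_eq_iff)
        then show ?thesis by (simp add: F_def Inr)
      qed
    qed (use FR ab in auto)
  next
    assume s: "s = Omega"
    show "real_analytic_in (?L \<union> ?T) (glue ` \<Omega>) (\<lambda>q. ((\<lambda>p. X' p i) \<circ> unglue) (F q))"
    proof (rule real_analytic_in_compose[where F = F and g =
        "(\<lambda>p. X' p i) \<circ> unglue", OF dom order_refl dom' order_refl Fim])
      show "real_analytic_in (?L \<union> ?T) (glue ` \<Omega>') ((\<lambda>p. X' p i) \<circ> unglue)"
        using X'[OF i] s unfolding C_rs_fun_iff[OF \<Omega>'] by blast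
    qed (use F0 FA[OF s] in auto)
  qed
  moreover have "C_fun l s (snd ` \<Omega>) (\<lambda>y. Y' (Y y) j)" if j: "j < l" for j
  proof -
    note S = open_snd_image[OF \<Omega>] and S' = open_snd_image[OF \<Omega>']
    have Yim: "Y y \<in> snd ` \<Omega>'" if "y \<in> snd ` \<Omega>" for y
      using that im f by (force intro: rev_image_eqI)
    show ?thesis
      unfolding C_fun_iff[OF S]
    proof (intro allI impI)
      fix a assume a: "Fin a \<le> s"
      show "regular_to_order {..<l} {} (s = Omega) (snd ` \<Omega>) a 0 (\<lambda>y. Y' (Y y) j)"
      proof (rule regular_compose[where F = Y and g =
          "\<lambda>y. Y' y j", OF open_coord_domain[OF S] open_coord_domain[OF S'] Yim])
        show "regular_to_order {..<l} {} (s = Omega) (snd ` \<Omega>') a 0 (\<lambda>y. Y' y j)"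
          using Y'[OF j] a unfolding C_fun_iff[OF S'] by blast
        show "regular_to_order {..<l} {} (s = Omega) (snd ` \<Omega>) a 0 (\<lambda>y. Y y d)" if "d \<in> {..<l} \<union> {}"
            for d
          using Y[of d] that a unfolding C_fun_iff[OF S] by simp
        show "Y p d = Y q d" if "p \<in> snd ` \<Omega>" "q \<in> snd ` \<Omega>" "d \<notin> {..<l}" for p q d
          using coord_domain_subset[OF open_coord_domain[OF S'] Yim[OF that(1)], of d]
            coord_domain_subset[OF open_coord_domain[OF S'] Yim[OF that(2)], of d] that(3) by simp
      qed auto
    qed
  qed
  moreover have "(g \<circ> f) p = (X' (X p, Y (snd p)), Y' (Y (snd p)))" if "p \<in> \<Omega>" for p
    using f[OF that] g[of "f p"] im that by auto
  ultimately show ?thesis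
    unfolding fol_form_def
    by (intro exI[of _ "\<lambda>p. X' (X p, Y (snd p))"] exI[of _ "\<lambda>y. Y' (Y y)"]) auto
qed

lemma regular_subset:
  assumes "V' \<subseteq> V"
  shows "regular_to_order L T an V a b f \<Longrightarrow> regular_to_order L T an V' a b f"
    and real_analytic_in_subset: "real_analytic_in L' V f \<Longrightarrow> real_analytic_in L' V' f"
proof -
  have A: "real_analytic_in L' V' f" if f: "real_analytic_in L' V f" for L' f
    unfolding real_analytic_in_def
  proof
    fix p assume "p \<in> V'"
    then have "p \<in> V" using assms by blast
    from bspec[OF f[unfolded real_analytic_in_def] this]
    obtain e c where e: "e > 0" and c: "\<forall>x\<in>V. (\<forall>d. d \<notin> L' \<longrightarrow> x d = p d) \<longrightarrow> (\<forall>d\<in>L'. \<bar>x d - p d\<bar> < e) \<longrightarrow>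
        ((\<lambda>\<alpha>. c \<alpha> * mon L' (\<lambda>d. x d - p d) \<alpha>) has_sum f x) (mults L')" by blast
    have "\<forall>x\<in>V'. (\<forall>d. d \<notin> L' \<longrightarrow> x d = p d) \<longrightarrow> (\<forall>d\<in>L'. \<bar>x d - p d\<bar> < e) \<longrightarrow>
        ((\<lambda>\<alpha>. c \<alpha> * mon L' (\<lambda>d. x d - p d) \<alpha>) has_sum f x) (mults L')" using c assms by blast
    with e show "\<exists>e>0. \<exists>c. \<forall>x\<in>V'. (\<forall>d. d \<notin> L' \<longrightarrow> x d = p d) \<longrightarrow> (\<forall>d\<in>L'. \<bar>x d - p d\<bar> < e) \<longrightarrow>
        ((\<lambda>\<alpha>. c \<alpha> * mon L' (\<lambda>d. x d - p d) \<alpha>) has_sum f x) (mults L')"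
      by blast
  qed
  show "real_analytic_in L' V f \<Longrightarrow> real_analytic_in L' V' f" by (rule A)
  have B: "base_regular L an V' f" if "base_regular L an V f" for f
    using that A continuous_on_subset[OF _ assms] by (auto simp: base_regular_def)
  have P: "partial_deriv d V' f g" if "partial_deriv d V f g" for d f g
    using that assms by (auto simp: partial_deriv_def)
  show "regular_to_order L T an V a b f \<Longrightarrow> regular_to_order L T an V' a b f"
  proof (induction a arbitrary: b f)
    case (Suc a)
    show ?case
      unfolding regular_to_order.simps
    proof (intro conjI ballI impI)
      show "base_regular L an V' f" using Suc.prems B by simp
      fix d assume "d \<in> L"
      then obtain g where "partial_deriv d V f g" "regular_to_order L T an V a b g"
          using Suc.prems by auto
      then show "\<exists>g. partial_deriv d V' f g \<and> regular_to_order L T an V' a b g" using P Suc.IH by blast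
    next
      fix d assume "d \<in> T" "0 < b"
      then obtain g where "partial_deriv d V f g" "regular_to_order L T an V a (b - 1) g"
          using Suc.prems by auto
      then show "\<exists>g. partial_deriv d V' f g \<and> regular_to_order L T an V' a (b - 1) g"
          using P Suc.IH by blast
    qed
  qed (use B in simp)
qed

lemma fol_form_restrict:
  assumes \<Omega>: "openin (prod_Euclidean k l) \<Omega>" and \<Omega>': "openin (prod_Euclidean k l) \<Omega>'" and sub: "\<Omega>' \<subseteq> \<Omega>"
    and f: "fol_form k l r s \<Omega> f"
  shows "fol_form k l r s \<Omega>' f"
proof -
  obtain X Y where XY: "\<forall>(x, y)\<in>\<Omega>. f (x, y) = (X (x, y), Y y)"
    and X: "\<And>i. i < k \<Longrightarrow> C_rs_fun k l r s \<Omega> (\<lambda>p. X p i)"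
    and Y: "\<And>j. j < l \<Longrightarrow> C_fun l s (snd ` \<Omega>) (\<lambda>y. Y y j)"
    using f unfolding fol_form_def by blast
  have sub1: "glue ` \<Omega>' \<subseteq> glue ` \<Omega>" "snd ` \<Omega>' \<subseteq> snd ` \<Omega>" using sub by auto
  have "C_rs_fun k l r s \<Omega>' (\<lambda>p. X p i)" if "i < k" for i
    using X[OF that] regular_subset[OF sub1(1)] unfolding C_rs_fun_iff[OF \<Omega>] C_rs_fun_iff[OF \<Omega>']
        by blast
  moreover have "C_fun l s (snd ` \<Omega>') (\<lambda>y. Y y j)" if "j < l" for j
    using Y[OF that] regular_subset(1)[OF sub1(2)]
        unfolding C_fun_iff[OF open_snd_image[OF \<Omega>]] C_fun_iff[OF open_snd_image[OF \<Omega>']] by blast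
  ultimately show ?thesis
    unfolding fol_form_def using XY sub by (intro exI[of _ X] exI[of _ Y]) auto
qed

section \<open>Equivalence of pre-solenoids\<close>

text \<open>
  The coordinate expression of a map, stated through its values at points of the manifold. This avoids the
  inverse of a chart, which depends on the domain chosen for the chart.
\<close>

definition local_form :: "nat \<Rightarrow> nat \<Rightarrow> smoothness \<Rightarrow> smoothness \<Rightarrow> 'a set \<Rightarrow> ('a \<Rightarrow> point \<times> point) \<Rightarrow> ('a \<Rightarrow>
    point \<times> point) \<Rightarrow> bool" where
  "local_form k l r s N \<phi> G \<longleftrightarrow> (\<exists>h. fol_form k l r s (\<phi> ` N) h \<and> (\<forall>p\<in>N. h (\<phi> p) = G p))"

lemma foliated_chart:
  assumes W: "foliated_manifold k l r s W" and U: "(U, \<phi>) \<in> fol_atlas W"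
  shows "openin (fol_top W) U" "inj_on \<phi> U"
    "homeomorphic_map (subtopology (fol_top W) U) (subtopology (prod_Euclidean k l) (\<phi> ` U)) \<phi>"
    "openin (fol_top W) N \<Longrightarrow> N \<subseteq> U \<Longrightarrow> openin (prod_Euclidean k l) (\<phi> ` N)"
proof -
  have c: "openin (fol_top W) U" "openin (prod_Euclidean k l) (\<phi> ` U)"
    and h: "homeomorphic_map (subtopology (fol_top W) U) (subtopology (prod_Euclidean k l) (\<phi> ` U)) \<phi>"
    using W U unfolding foliated_manifold_def by auto
  show "openin (fol_top W) U" by fact
  show "homeomorphic_map (subtopology (fol_top W) U) (subtopology (prod_Euclidean k l) (\<phi> ` U)) \<phi>"
      by fact
  show "inj_on \<phi> U"
    using homeomorphic_imp_injective_map[OF h] openin_subset[OF c(1)] by (simp add: Int_absorb1)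
  assume N: "openin (fol_top W) N" "N \<subseteq> U"
  then have "openin (subtopology (fol_top W) U) N" using openin_open_subtopology[OF c(1)] by blast
  then have "openin (subtopology (prod_Euclidean k l) (\<phi> ` U)) (\<phi> ` N)"
    using homeomorphic_imp_open_map[OF h] by (simp add: open_map_def)
  then show "openin (prod_Euclidean k l) (\<phi> ` N)" using openin_trans_full c(2) by blast
qed

lemma local_form_iff:
  assumes "inj_on \<phi> U" "N \<subseteq> U"
  shows "local_form k l r s N \<phi> G \<longleftrightarrow> fol_form k l r s (\<phi> ` N) (G \<circ> inv_into U \<phi>)"
proof
  have inv: "inv_into U \<phi> (\<phi> p) = p" if "p \<in> N" for p using assms that by (auto intro: inv_into_f_f)
  show "fol_form k l r s (\<phi> ` N) (G \<circ> inv_into U \<phi>)" if "local_form k l r s N \<phi> G"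
    using that inv unfolding local_form_def by (auto elim!: fol_form_cong)
  show "local_form k l r s N \<phi> G" if "fol_form k l r s (\<phi> ` N) (G \<circ> inv_into U \<phi>)"
    using that inv unfolding local_form_def by auto
qed

lemma local_form_restrict:
  assumes "local_form k l r s N \<phi> G" "N' \<subseteq> N"
    and "openin (prod_Euclidean k l) (\<phi> ` N)" "openin (prod_Euclidean k l) (\<phi> ` N')"
  shows "local_form k l r s N' \<phi> G"
proof -
  obtain h where h: "fol_form k l r s (\<phi> ` N) h" "\<And>p. p \<in> N \<Longrightarrow> h (\<phi> p) = G p"
    using assms(1) unfolding local_form_def by blast
  then have "fol_form k l r s (\<phi> ` N') h"
    using fol_form_restrict[OF assms(3,4) image_mono[OF assms(2)]] by blast
  then show ?thesis unfolding local_form_def using h(2) assms(2) by blast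
qed

lemma local_form_compose:
  assumes "local_form k l r s N \<phi> (\<psi> \<circ> f)" "local_form k l r s M \<psi> H" "f ` N \<subseteq> M"
    and "openin (prod_Euclidean k l) (\<phi> ` N)" "openin (prod_Euclidean k l) (\<psi> ` M)"
  shows "local_form k l r s N \<phi> (H \<circ> f)"
proof -
  obtain h where h: "fol_form k l r s (\<phi> ` N) h" "\<And>p. p \<in> N \<Longrightarrow> h (\<phi> p) = \<psi> (f p)"
    using assms(1) unfolding local_form_def by auto
  obtain h' where h': "fol_form k l r s (\<psi> ` M) h'" "\<And>p. p \<in> M \<Longrightarrow> h' (\<psi> p) = H p"
    using assms(2) unfolding local_form_def by auto
  have "fol_form k l r s (\<phi> ` N) (h' \<circ> h)"
    by (rule fol_form_compose[OF assms(4,5) h(1) h'(1)]) (use h(2) assms(3) in auto)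
  moreover have "(h' \<circ> h) (\<phi> p) = (H \<circ> f) p" if "p \<in> N" for p
    using h(2)[OF that] h'(2)[of "f p"] that assms(3) by auto
  ultimately show ?thesis unfolding local_form_def by blast
qed

lemma transition_form:
  assumes W: "foliated_manifold k l r s W" and U: "(U, \<phi>) \<in> fol_atlas W" "(V, \<psi>) \<in> fol_atlas W"
  shows "local_form k l r s (U \<inter> V) \<phi> \<psi>"
  unfolding local_form_iff[OF foliated_chart(2)[OF W U(1)] Int_lower1]
  using W U unfolding foliated_manifold_def by auto

lemma bex_charts: "(\<exists>(U, \<phi>)\<in>A. \<exists>(V, \<psi>)\<in>B. \<exists>N. Q U \<phi> V \<psi> N) \<longleftrightarrow>
    (\<exists>U \<phi> V \<psi> N. (U, \<phi>) \<in> A \<and> (V, \<psi>) \<in> B \<and> Q U \<phi> V \<psi> N)"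
  by (force simp: Bex_def)

lemma regular_map_iff:
  assumes W: "foliated_manifold k l r s W"
  shows "regular_map k l r s W W' f \<longleftrightarrow> continuous_map (fol_top W) (fol_top W') f \<and>
     (\<forall>p\<in>topspace (fol_top W). \<exists>U \<phi> V \<psi> N. (U, \<phi>) \<in> fol_atlas W \<and> (V, \<psi>) \<in> fol_atlas W' \<and>
        openin (fol_top W) N \<and> p \<in> N \<and> N \<subseteq> U \<and> f ` N \<subseteq> V \<and> local_form k l r s N \<phi> (\<psi> \<circ> f))"
proof -
  have eq: "((U, \<phi>) \<in> fol_atlas W \<and> (V, \<psi>) \<in> fol_atlas W' \<and>
        openin (fol_top W) N \<and> p \<in> N \<and> N \<subseteq> U \<and> f ` N \<subseteq> V \<and> fol_form k l r s (\<phi> ` N) (\<psi> \<circ> f \<circ> inv_into U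
            \<phi>)) \<longleftrightarrow>
     ((U, \<phi>) \<in> fol_atlas W \<and> (V, \<psi>) \<in> fol_atlas W' \<and>
        openin (fol_top W) N \<and> p \<in> N \<and> N \<subseteq> U \<and> f ` N \<subseteq> V \<and> local_form k l r s N \<phi> (\<psi> \<circ> f))" for p U \<phi> V
            \<psi> N
    by (intro conj_cong refl local_form_iff[OF foliated_chart(2)[OF W], symmetric])
  show ?thesis unfolding regular_map_def bex_charts eq ..
qed

text \<open>
  The chart used at \<open>f p\<close> as a target of \<open>f\<close> and the one used there as a source of \<open>g\<close> need not agree, so
  a transition map is inserted between the two local forms.
\<close>

lemma regular_map_compose:
  assumes W: "foliated_manifold k l r s W" and W': "foliated_manifold k l r s W'"
      and W'': "foliated_manifold k l r s W''"
    and f: "regular_map k l r s W W' f" and g: "regular_map k l r s W' W'' g"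
  shows "regular_map k l r s W W'' (g \<circ> f)"
  unfolding regular_map_iff[OF W]
proof (intro conjI ballI)
  note f' = f[unfolded regular_map_iff[OF W], THEN conjunct2, rule_format]
    and g' = g[unfolded regular_map_iff[OF W'], THEN conjunct2, rule_format]
  have fc: "continuous_map (fol_top W) (fol_top W') f"
      and gc: "continuous_map (fol_top W') (fol_top W'') g"
    using f g by (simp_all add: regular_map_def)
  show "continuous_map (fol_top W) (fol_top W'') (g \<circ> f)"
    by (rule continuous_map_compose[OF fc gc])
  fix p assume p: "p \<in> topspace (fol_top W)"
  obtain U \<phi> V \<psi> N where 1: "(U, \<phi>) \<in> fol_atlas W" "(V, \<psi>) \<in> fol_atlas W'"
     "openin (fol_top W) N" "p \<in> N" "N \<subseteq> U" "f ` N \<subseteq> V" "local_form k l r s N \<phi> (\<psi> \<circ> f)"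
    using f'[OF p] by blast
  have fp: "f p \<in> topspace (fol_top W')"
    using continuous_map_image_subset_topspace[OF fc] p by blast
  obtain V' \<psi>' Z \<kappa> M where 2: "(V', \<psi>') \<in> fol_atlas W'" "(Z, \<kappa>) \<in> fol_atlas W''"
     "openin (fol_top W') M" "f p \<in> M" "M \<subseteq> V'" "g ` M \<subseteq> Z" "local_form k l r s M \<psi>' (\<kappa> \<circ> g)"
    using g'[OF fp] by blast
  define N' where "N' = N \<inter> {x \<in> topspace (fol_top W). f x \<in> M}"
  have N': "openin (fol_top W) N'"
    unfolding N'_def by (intro openin_Int openin_continuous_map_preimage[OF fc] 1(3) 2(3))
  have im: "f ` N' \<subseteq> V \<inter> M" "f ` N' \<subseteq> M" using 1(6) by (auto simp: N'_def)
  have \<phi>N: "openin (prod_Euclidean k l) (\<phi> ` N)" "openin (prod_Euclidean k l) (\<phi> ` N')"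
    using foliated_chart(4)[OF W 1(1)] 1(3,5) N' by (auto simp: N'_def)
  have VM: "openin (fol_top W') (V \<inter> M)" using 2(3) foliated_chart(1)[OF W' 1(2)] by blast
  have VV: "openin (fol_top W') (V \<inter> V')"
    using foliated_chart(1)[OF W' 1(2)] foliated_chart(1)[OF W' 2(1)] by blast
  \<comment> \<open>The transition from the target chart of \<open>f\<close> to the source chart of \<open>g\<close>.\<close>
  have T: "local_form k l r s (V \<inter> M) \<psi> \<psi>'"
    by (rule local_form_restrict[OF transition_form[OF W' 1(2) 2(1)]])
       (use 2(5) foliated_chart(4)[OF W' 1(2)] VM VV in auto)
  have "local_form k l r s N' \<phi> (\<psi> \<circ> f)"
    by (rule local_form_restrict[OF 1(7) _ \<phi>N]) (simp add: N'_def)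
  then have "local_form k l r s N' \<phi> (\<psi>' \<circ> f)"
    by (rule local_form_compose[OF _ T im(1) \<phi>N(2) foliated_chart(4)[OF W' 1(2) VM Int_lower1]])
  from local_form_compose[OF this 2(7) im(2) \<phi>N(2) foliated_chart(4)[OF W' 2(1) 2(3) 2(5)]]
  have "local_form k l r s N' \<phi> (\<kappa> \<circ> (g \<circ> f))" by (simp add: o_assoc)
  moreover have "p \<in> N'" "N' \<subseteq> U" "(g \<circ> f) ` N' \<subseteq> Z"
    using p 1(4,5) 2(4,6) im by (auto simp: N'_def)
  ultimately show "\<exists>U \<phi> V \<psi> N. (U, \<phi>) \<in> fol_atlas W \<and> (V, \<psi>) \<in> fol_atlas W'' \<and>
        openin (fol_top W) N \<and> p \<in> N \<and> N \<subseteq> U \<and> (g \<circ> f) ` N \<subseteq> V \<and> local_form k l r s N \<phi> (\<psi> \<circ> (g \<circ> f))"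
    using 1(1) 2(2) N'
    by (intro exI[of _ U] exI[of _ \<phi>] exI[of _ Z] exI[of _ \<kappa>] exI[of _ N']) simp
qed

lemma fol_restrict_simps [simp]:
  "fol_top (fol_restrict W U) = subtopology (fol_top W) U"
  "fol_atlas (fol_restrict W U) = (\<lambda>(V, \<phi>). (V \<inter> U, \<phi>)) ` fol_atlas W"
  by (auto simp: fol_restrict_def)

lemma fol_restrict_restrict: "O' \<subseteq> U \<Longrightarrow> fol_restrict (fol_restrict W U) O' = fol_restrict W O'"
  unfolding fol_restrict_def
  by (auto simp: subtopology_subtopology Int_absorb1 image_image case_prod_beta intro!: image_cong)

lemma foliated_restrict:
  assumes W: "foliated_manifold k l r s W" and U: "openin (fol_top W) U"
  shows "foliated_manifold k l r s (fol_restrict W U)"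
  unfolding foliated_manifold_def
proof (intro conjI)
  show "Hausdorff_space (fol_top (fol_restrict W U))" "second_countable (fol_top (fol_restrict W U))"
    using W by (auto simp: foliated_manifold_def Hausdorff_space_subtopology
        second_countable_subtopology)
  have "(\<Union>(V, \<phi>)\<in>fol_atlas W. V) = topspace (fol_top W)" using W by (simp add: foliated_manifold_def)
  then show "(\<Union>(V, \<phi>)\<in>fol_atlas (fol_restrict W U). V) = topspace (fol_top (fol_restrict W U))"
    by (force simp: case_prod_beta)
  have chart: "openin (fol_top W) (V \<inter> U)" "openin (prod_Euclidean k l) (\<phi> ` (V \<inter> U))"
      "inj_on \<phi> (V \<inter> U)"
    "homeomorphic_map (subtopology (subtopology (fol_top W) U) (V \<inter> U)) (subtopology (prod_Euclidean k
        l) (\<phi> ` (V \<inter> U))) \<phi>"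
    if V: "(V, \<phi>) \<in> fol_atlas W" for V \<phi>
  proof -
    note c = foliated_chart[OF W V]
    show o: "openin (fol_top W) (V \<inter> U)" using c(1) U by blast
    show "openin (prod_Euclidean k l) (\<phi> ` (V \<inter> U))" by (rule c(4)[OF o]) simp
    show "inj_on \<phi> (V \<inter> U)" using c(2) by (rule inj_on_subset) simp
    have "homeomorphic_map (subtopology (subtopology (fol_top W) V) (V \<inter> U))
      (subtopology (subtopology (prod_Euclidean k l) (\<phi> ` V)) (\<phi> ` (V \<inter> U))) \<phi>"
    proof (rule homeomorphic_map_subtopologies[OF c(3)])
      have "V \<subseteq> topspace (fol_top W)" "\<phi> ` V \<subseteq> topspace (prod_Euclidean k l)"
        using openin_subset[OF c(1)] openin_subset[OF c(4)[OF c(1) order_refl]] by auto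
      then show "\<phi> ` (topspace (subtopology (fol_top W) V) \<inter> (V \<inter> U)) =
         topspace (subtopology (prod_Euclidean k l) (\<phi> ` V)) \<inter> \<phi> ` (V \<inter> U)"
        by (auto simp: Int_absorb1)
    qed
    moreover have "V \<inter> (V \<inter> U) = V \<inter> U" "U \<inter> (V \<inter> U) = V \<inter> U" "\<phi> ` V \<inter> \<phi> ` (V \<inter> U) = \<phi> ` (V \<inter> U)"
        by auto
    ultimately show "homeomorphic_map (subtopology (subtopology (fol_top W) U) (V \<inter> U)) (subtopology
        (prod_Euclidean k l) (\<phi> ` (V \<inter> U))) \<phi>"
      by (simp add: subtopology_subtopology)
  qed
  show "\<forall>(V, \<phi>)\<in>fol_atlas (fol_restrict W U).
        openin (fol_top (fol_restrict W U)) V \<and> openin (prod_Euclidean k l) (\<phi> ` V) \<and>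
        homeomorphic_map (subtopology (fol_top (fol_restrict W U)) V)
          (subtopology (prod_Euclidean k l) (\<phi> ` V)) \<phi>"
    using chart U by (auto simp: openin_open_subtopology)
  show "\<forall>(V, \<phi>)\<in>fol_atlas (fol_restrict W U). \<forall>(V', \<psi>)\<in>fol_atlas (fol_restrict W U).
        fol_form k l r s (\<phi> ` (V \<inter> V')) (\<psi> \<circ> inv_into V \<phi>)"
  proof -
    have "fol_form k l r s (\<phi> ` ((V \<inter> U) \<inter> (V' \<inter> U))) (\<psi> \<circ> inv_into (V \<inter> U) \<phi>)"
      if V: "(V, \<phi>) \<in> fol_atlas W" "(V', \<psi>) \<in> fol_atlas W" for V \<phi> V' \<psi>
    proof -
      have "openin (fol_top W) (V \<inter> V')" "openin (fol_top W) ((V \<inter> U) \<inter> (V' \<inter> U))"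
        using foliated_chart(1)[OF W V(1)] foliated_chart(1)[OF W V(2)] U by auto
      then have "local_form k l r s ((V \<inter> U) \<inter> (V' \<inter> U)) \<phi> \<psi>"
        by (intro local_form_restrict[OF transition_form[OF W V]] foliated_chart(4)[OF W V(1)]) auto
      then show ?thesis
        by (subst (asm) local_form_iff[OF chart(3)[OF V(1)]]) auto
    qed
    then show ?thesis by auto
  qed
qed

lemma regular_map_restrict:
  assumes W: "foliated_manifold k l r s W"
    and f: "regular_map k l r s W W' f"
    and U: "openin (fol_top W) U" and im: "f ` U \<subseteq> U'"
  shows "regular_map k l r s (fol_restrict W U) (fol_restrict W' U') f"
  unfolding regular_map_iff[OF foliated_restrict[OF W U]]
proof (intro conjI ballI)
  note f = f[unfolded regular_map_iff[OF W]]
  show "continuous_map (fol_top (fol_restrict W U)) (fol_top (fol_restrict W' U')) f"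
    unfolding fol_restrict_simps
  proof (rule continuous_map_into_subtopology)
    show "continuous_map (subtopology (fol_top W) U) (fol_top W') f"
      using f continuous_map_from_subtopology by blast
  qed (use im in auto)
  fix p assume "p \<in> topspace (fol_top (fol_restrict W U))"
  then have p: "p \<in> topspace (fol_top W)" "p \<in> U" by auto
  then obtain V \<phi> V' \<psi> N where 1: "(V, \<phi>) \<in> fol_atlas W" "(V', \<psi>) \<in> fol_atlas W'"
     "openin (fol_top W) N" "p \<in> N" "N \<subseteq> V" "f ` N \<subseteq> V'" "local_form k l r s N \<phi> (\<psi> \<circ> f)"
    using f by blast
  have N: "openin (fol_top W) (N \<inter> U)" using 1(3) U by blast
  have "local_form k l r s (N \<inter> U) \<phi> (\<psi> \<circ> f)"
    by (rule local_form_restrict[OF 1(7)]) (use foliated_chart(4)[OF W 1(1)] 1(3,5) N in auto)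
  moreover have "(V \<inter> U, \<phi>) \<in> fol_atlas (fol_restrict W U)"
      "(V' \<inter> U', \<psi>) \<in> fol_atlas (fol_restrict W' U')"
    using 1(1,2) by force+
  moreover have "openin (fol_top (fol_restrict W U)) (N \<inter> U)"
      using N U by (simp add: openin_open_subtopology)
  moreover have "p \<in> N \<inter> U" "N \<inter> U \<subseteq> V \<inter> U" "f ` (N \<inter> U) \<subseteq> V' \<inter> U'" using p 1 im by auto
  ultimately show "\<exists>Ua \<phi> V \<psi> N. (Ua, \<phi>) \<in> fol_atlas (fol_restrict W U) \<and>
      (V, \<psi>) \<in> fol_atlas (fol_restrict W' U') \<and>
        openin (fol_top (fol_restrict W U)) N \<and> p \<in> N \<and> N \<subseteq> Ua \<and> f ` N \<subseteq> V \<and>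
            local_form k l r s N \<phi> (\<psi> \<circ> f)"
    by blast
qed

lemma regular_map_id:
  assumes W: "foliated_manifold k l r s W"
  shows "regular_map k l r s W W id"
  unfolding regular_map_iff[OF W]
proof (intro conjI ballI)
  fix p assume "p \<in> topspace (fol_top W)"
  then obtain U \<phi> where U: "(U, \<phi>) \<in> fol_atlas W" "p \<in> U"
    using W unfolding foliated_manifold_def by blast
  have "local_form k l r s U \<phi> (\<phi> \<circ> id)" using transition_form[OF W U(1) U(1)] by simp
  then show "\<exists>U \<phi> V \<psi> N. (U, \<phi>) \<in> fol_atlas W \<and> (V, \<psi>) \<in> fol_atlas W \<and>
        openin (fol_top W) N \<and> p \<in> N \<and> N \<subseteq> U \<and> id ` N \<subseteq> V \<and> local_form k l r s N \<phi> (\<psi> \<circ> id)"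
    using U foliated_chart(1)[OF W U(1)]
    by (intro exI[of _ U] exI[of _ \<phi>] exI[of _ U] exI[of _ \<phi>] exI[of _ U]) simp
qed simp

definition fol_iso_pair where
  "fol_iso_pair k l r s W W' f g \<longleftrightarrow> homeomorphic_maps (fol_top W) (fol_top W') f g \<and>
        regular_map k l r s W W' f \<and> regular_map k l r s W' W g"

lemma fol_iso_pair_restrict:
  assumes W: "foliated_manifold k l r s W" "foliated_manifold k l r s W'"
    and fg: "fol_iso_pair k l r s W W' f g"
    and U: "openin (fol_top W) U" "openin (fol_top W') U'" and im: "f ` U \<subseteq> U'" "g ` U' \<subseteq> U"
  shows "fol_iso_pair k l r s (fol_restrict W U) (fol_restrict W' U') f g"
  unfolding fol_iso_pair_def
proof (intro conjI)
  show "homeomorphic_maps (fol_top (fol_restrict W U)) (fol_top (fol_restrict W' U')) f g"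
    using fg im unfolding fol_iso_pair_def fol_restrict_simps
    by (intro homeomorphic_maps_subtopologies_alt) auto
  show "regular_map k l r s (fol_restrict W U) (fol_restrict W' U') f"
    using fg regular_map_restrict[OF W(1) _ U(1) im(1)] unfolding fol_iso_pair_def by blast
  show "regular_map k l r s (fol_restrict W' U') (fol_restrict W U) g"
    using fg regular_map_restrict[OF W(2) _ U(2) im(2)] unfolding fol_iso_pair_def by blast
qed

text \<open>
  A diffeomorphism of neighbourhoods of \<open>S\<close> that fixes \<open>S\<close>, with its inverse made explicit: the inverse
  fixes \<open>S\<close> as well, which makes the relation visibly symmetric.
\<close>

definition germ_iso where
  "germ_iso k l r s S W W' \<longleftrightarrow> (\<exists>U U' f g. openin (fol_top W) U \<and> openin (fol_top W') U' \<and> S \<subseteq> U \<and>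
      S \<subseteq> U' \<and>
     fol_iso_pair k l r s (fol_restrict W U) (fol_restrict W' U') f g \<and> (\<forall>p\<in>S. f p = p \<and> g p = p))"

lemma solenoid_equiv_iff:
  "((S, W), (S', W')) \<in> solenoid_equiv k l r s \<longleftrightarrow>
     pre_solenoid k l r s (S, W) \<and> pre_solenoid k l r s (S', W') \<and> S = S' \<and> germ_iso k l r s S W W'"
proof -
  have "g p = p" if "homeomorphic_maps (subtopology (fol_top W) U) (subtopology (fol_top W') U') f g"
    "openin (fol_top W) U" "S \<subseteq> U" "\<forall>p\<in>S. f p = p" "p \<in> S" for U U' f g p
  proof -
    have "p \<in> topspace (subtopology (fol_top W) U)" using that openin_subset by fastforce
    then show ?thesis using that unfolding homeomorphic_maps_def by metis
  qed
  then show ?thesis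
    unfolding solenoid_equiv_def germ_iso_def fol_diffeo_def fol_iso_pair_def
    by auto (metis fol_restrict_simps(1))+
qed

lemma germ_iso_refl:
  assumes W: "foliated_manifold k l r s W" and S: "S \<subseteq> topspace (fol_top W)"
  shows "germ_iso k l r s S W W"
proof -
  let ?X = "topspace (fol_top W)"
  have "fol_iso_pair k l r s (fol_restrict W ?X) (fol_restrict W ?X) id id"
    using regular_map_id[OF foliated_restrict[OF W openin_topspace]]
    by (simp add: fol_iso_pair_def homeomorphic_maps_def)
  then show ?thesis
    unfolding germ_iso_def using S openin_topspace by (metis id_apply)
qed

lemma germ_iso_sym: "germ_iso k l r s S W W' \<Longrightarrow> germ_iso k l r s S W' W"
  unfolding germ_iso_def fol_iso_pair_def by (metis homeomorphic_maps_sym)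

text \<open>
  The two diffeomorphisms are restricted to the part where they can be composed.
\<close>

lemma germ_iso_trans:
  assumes W: "foliated_manifold k l r s W" "foliated_manifold k l r s W'"
      "foliated_manifold k l r s W''"
    and "germ_iso k l r s S W W'" "germ_iso k l r s S W' W''"
  shows "germ_iso k l r s S W W''"
proof -
  obtain U U' f f' where f: "openin (fol_top W) U" "openin (fol_top W') U'" "S \<subseteq> U" "S \<subseteq> U'"
     "fol_iso_pair k l r s (fol_restrict W U) (fol_restrict W' U') f f'" "\<And>p. p \<in> S \<Longrightarrow> f p = p"
         "\<And>p. p \<in> S \<Longrightarrow> f' p = p"
    using assms(4) unfolding germ_iso_def by blast
  obtain V V' g g' where g: "openin (fol_top W') V" "openin (fol_top W'') V'" "S \<subseteq> V" "S \<subseteq> V'"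
     "fol_iso_pair k l r s (fol_restrict W' V) (fol_restrict W'' V') g g'" "\<And>p. p \<in> S \<Longrightarrow> g p = p"
         "\<And>p. p \<in> S \<Longrightarrow> g' p = p"
    using assms(5) unfolding germ_iso_def by blast
  have Us: "U \<subseteq> topspace (fol_top W)" "U' \<subseteq> topspace (fol_top W')" "V \<subseteq> topspace (fol_top W')"
      "V' \<subseteq> topspace (fol_top W'')"
    using f g by (auto dest: openin_subset)
  have hf: "homeomorphic_maps (subtopology (fol_top W) U) (subtopology (fol_top W') U') f f'"
    and hg: "homeomorphic_maps (subtopology (fol_top W') V) (subtopology (fol_top W'') V') g g'"
    using f(5) g(5) by (auto simp: fol_iso_pair_def)
  have ff: "\<And>x. x \<in> U \<Longrightarrow> f x \<in> U' \<and> f' (f x) = x" "\<And>x. x \<in> U' \<Longrightarrow> f' x \<in> U \<and> f (f' x) = x"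
    using hf Us unfolding homeomorphic_maps_def continuous_map_def by auto
  have gg: "\<And>x. x \<in> V \<Longrightarrow> g x \<in> V' \<and> g' (g x) = x" "\<And>x. x \<in> V' \<Longrightarrow> g' x \<in> V \<and> g (g' x) = x"
    using hg Us unfolding homeomorphic_maps_def continuous_map_def by auto
  define B where "B = U' \<inter> V"
  define A where "A = {x \<in> U. f x \<in> B}"
  define C where "C = {x \<in> V'. g' x \<in> B}"
  have B: "openin (fol_top W') B" using f(2) g(1) by (auto simp: B_def)
  have "openin (subtopology (fol_top W) U) {x \<in> topspace (subtopology (fol_top W) U). f x \<in> B}"
    using hf B f(2) unfolding homeomorphic_maps_def
    by (intro openin_continuous_map_preimage[where Y =
        "subtopology (fol_top W') U'"]) (auto simp: openin_open_subtopology B_def)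
  then have "openin (subtopology (fol_top W) U) A" using Us by (simp add: A_def Int_absorb1 inf.absorb2)
  then have A: "openin (fol_top W) A" using f(1) openin_trans_full by blast
  have "openin (subtopology (fol_top W'') V') {x \<in> topspace (subtopology (fol_top W'') V'). g' x \<in> B}"
    using hg B g(1) unfolding homeomorphic_maps_def
    by (intro openin_continuous_map_preimage[where Y =
        "subtopology (fol_top W') V"]) (auto simp: openin_open_subtopology B_def)
  then have "openin (subtopology (fol_top W'') V') C"
      using Us by (simp add: C_def Int_absorb1 inf.absorb2)
  then have C: "openin (fol_top W'') C" using g(2) openin_trans_full by blast
  have sub: "A \<subseteq> U" "B \<subseteq> U'" "B \<subseteq> V" "C \<subseteq> V'" by (auto simp: A_def B_def C_def)
  have im: "f ` A \<subseteq> B" "f' ` B \<subseteq> A" "g ` B \<subseteq> C" "g' ` C \<subseteq> B"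
    using ff gg by (auto simp: A_def B_def C_def)
  have "fol_iso_pair k l r s (fol_restrict (fol_restrict W U) A) (fol_restrict (fol_restrict W' U') B) f
      f'"
    by (rule fol_iso_pair_restrict[OF foliated_restrict[OF W(1) f(1)] foliated_restrict[OF W(2) f(2)]
        f(5)])
       (use A B f im sub in \<open>auto simp: openin_open_subtopology\<close>)
  then have F: "fol_iso_pair k l r s (fol_restrict W A) (fol_restrict W' B) f f'"
    using sub by (simp add: fol_restrict_restrict)
  have "fol_iso_pair k l r s (fol_restrict (fol_restrict W' V) B) (fol_restrict (fol_restrict W'' V') C)
      g g'"
    by (rule fol_iso_pair_restrict[OF foliated_restrict[OF W(2) g(1)] foliated_restrict[OF W(3) g(2)]
        g(5)])
       (use C B g im sub in \<open>auto simp: openin_open_subtopology\<close>)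
  then have G: "fol_iso_pair k l r s (fol_restrict W' B) (fol_restrict W'' C) g g'"
    using sub by (simp add: fol_restrict_restrict)
  note WA = foliated_restrict[OF W(1) A] and WB = foliated_restrict[OF W(2) B]
      and WC = foliated_restrict[OF W(3) C]
  have "fol_iso_pair k l r s (fol_restrict W A) (fol_restrict W'' C) (g \<circ> f) (f' \<circ> g')"
    using F G regular_map_compose[OF WA WB WC] regular_map_compose[OF WC WB WA]
        homeomorphic_maps_compose
    unfolding fol_iso_pair_def by blast
  moreover have "S \<subseteq> A" "S \<subseteq> C" using f g by (auto simp: A_def B_def C_def)
  moreover have "\<forall>p\<in>S. (g \<circ> f) p = p \<and> (f' \<circ> g') p = p" using f g by auto
  ultimately show ?thesis
    unfolding germ_iso_def using A C by blast
qed

lemma pre_solenoidD: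
  assumes "pre_solenoid k l r s (S, W)"
  shows "foliated_manifold k l r s W" "S \<noteq> {}" "compactin (fol_top W) S" "S \<subseteq> topspace (fol_top W)"
  using assms compactin_subset_topspace by (auto simp: pre_solenoid_def)

theorem equiv_solenoid_equiv:
  "equiv (Collect (pre_solenoid k l r s)) (solenoid_equiv k l r s :: (('a set \<times> 'a foliated) \<times> ('a set \<times>
      'a foliated)) set)" (is "equiv ?A ?R")
proof (rule equivI)
  show "?R \<subseteq> ?A \<times> ?A"
    by (auto simp: solenoid_equiv_def)
  show "refl_on ?A ?R"
  proof (rule refl_onI)
    fix x :: "'a set \<times> 'a foliated"
    obtain S W where x: "x = (S, W)" by fastforce
    assume "x \<in> Collect (pre_solenoid k l r s)"
    then have "pre_solenoid k l r s (S, W)" by (simp add: x)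
    then show "(x, x) \<in> solenoid_equiv k l r s"
      using germ_iso_refl[OF pre_solenoidD(1,4)] by (simp add: solenoid_equiv_iff x)
  qed
  show "sym ?R"
  proof (rule symI)
    fix x y :: "'a set \<times> 'a foliated"
    assume "(x, y) \<in> solenoid_equiv k l r s"
    then show "(y, x) \<in> solenoid_equiv k l r s"
      using germ_iso_sym by (cases x; cases y) (auto simp: solenoid_equiv_iff)
  qed
  show "trans ?R"
  proof (rule transI)
    fix x y z :: "'a set \<times> 'a foliated"
    assume "(x, y) \<in> solenoid_equiv k l r s" "(y, z) \<in> solenoid_equiv k l r s"
    then show "(x, z) \<in> solenoid_equiv k l r s"
      using germ_iso_trans[OF pre_solenoidD(1) pre_solenoidD(1) pre_solenoidD(1)]
      by (cases x; cases y; cases z) (simp add: solenoid_equiv_iff, blast)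
  qed
qed

lemma same_plaque_of_connected:
  assumes "(U, \<phi>) \<in> fol_atlas W" "connectedin (fol_top W) C" "C \<subseteq> U"
    and "\<And>z. z \<in> C \<Longrightarrow> snd (\<phi> z) = c" and "p \<in> C" "q \<in> C"
  shows "same_plaque W p q"
proof -
  have "connectedin (subtopology (fol_top W) {z \<in> U. snd (\<phi> z) = snd (\<phi> p)}) C"
    using assms(2-5) by (auto simp: connectedin_subtopology)
  then have "connected_component_of (subtopology (fol_top W) {z \<in> U. snd (\<phi> z) = snd (\<phi> p)}) p q"
    using assms(5,6) unfolding connected_component_of_def by blast
  then show ?thesis
    unfolding same_plaque_def using assms(1,3,5) by (intro bexI[of _ "(U, \<phi>)"]) auto
qed

text \<open>
  Near a point of \<open>S\<close>, the transversal coordinate of \<open>W\<close> at \<open>f p = p\<close> is \<open>Y c\<close>, where \<open>c\<close> is the constant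
  transversal coordinate of \<open>S\<close> in \<open>W0\<close>. Hence a short piece of the path lies in a single plaque of \<open>W\<close>, and
  the set of times at which the path is in a given leaf is open with open complement.
\<close>

lemma leaf_contains_path_connected:
  assumes W0: "foliated_manifold k l r s W0"
    and W: "foliated_manifold k l r s W" and iso: "germ_iso k l r s S W0 W"
    and flat: "\<And>U \<phi> p. (U, \<phi>) \<in> fol_atlas W0 \<Longrightarrow> p \<in> S \<inter> U \<Longrightarrow> snd (\<phi> p) = c"
    and \<gamma>: "continuous_map euclideanreal (fol_top W0) \<gamma>" "range \<gamma> \<subseteq> S"
  shows "\<gamma> t \<in> leaf_through W (\<gamma> u)"
proof -
  obtain O1 O2 f g where O: "openin (fol_top W0) O1" "openin (fol_top W) O2" "S \<subseteq> O1" "S \<subseteq> O2"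
     "fol_iso_pair k l r s (fol_restrict W0 O1) (fol_restrict W O2) f g" "\<And>p. p \<in> S \<Longrightarrow> f p = p"
    using iso unfolding germ_iso_def by blast
  have reg: "regular_map k l r s (fol_restrict W0 O1) (fol_restrict W O2) f"
    using O(5) by (simp add: fol_iso_pair_def)
  have fc: "continuous_map (subtopology (fol_top W0) O1) (subtopology (fol_top W) O2) f"
    using reg by (simp add: regular_map_def)
  have \<gamma>S: "\<gamma> x \<in> S" for x using \<gamma>(2) by blast
  have "continuous_map euclideanreal (subtopology (fol_top W0) O1) \<gamma>"
    using \<gamma>(1) \<gamma>S O(3) by (intro continuous_map_into_subtopology) auto
  from continuous_map_compose[OF this fc]
  have "continuous_map euclideanreal (subtopology (fol_top W) O2) (f \<circ> \<gamma>)" .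
  moreover have "f \<circ> \<gamma> = \<gamma>" using O(6) \<gamma>S by auto
  ultimately have \<gamma>W: "continuous_map euclideanreal (fol_top W) \<gamma>"
    by (simp add: continuous_map_in_subtopology)
  have local: "\<exists>\<delta>>0. \<forall>y. \<bar>y - x\<bar> < \<delta> \<longrightarrow> same_plaque W (\<gamma> x) (\<gamma> y) \<and> same_plaque W (\<gamma> y) (\<gamma> x)" for x
  proof -
    have "\<gamma> x \<in> topspace (fol_top (fol_restrict W0 O1))"
      using \<gamma>S O(1,3) openin_subset by fastforce
    then obtain U \<phi> V \<psi> N where 1: "(U, \<phi>) \<in> fol_atlas (fol_restrict W0 O1)"
        "(V, \<psi>) \<in> fol_atlas (fol_restrict W O2)"
       "openin (fol_top (fol_restrict W0 O1)) N" "\<gamma> x \<in> N" "N \<subseteq> U" "f ` N \<subseteq> V"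
           "local_form k l r s N \<phi> (\<psi> \<circ> f)"
      using reg[unfolded regular_map_iff[OF foliated_restrict[OF W0 O(1)]]] by blast
    obtain U' V' where 2: "(U', \<phi>) \<in> fol_atlas W0" "U = U' \<inter> O1" "(V', \<psi>) \<in> fol_atlas W" "V = V' \<inter> O2"
      using 1(1,2) by auto
    have N: "openin (fol_top W0) N" using 1(3) O(1) by (simp add: openin_open_subtopology)
    obtain X Y where XY: "\<And>p. p \<in> N \<Longrightarrow> \<psi> (f p) = (X (\<phi> p), Y (snd (\<phi> p)))"
      using 1(7) unfolding local_form_def fol_form_def by (fastforce simp: case_prod_beta)
    have trans: "snd (\<psi> p) = Y c" "p \<in> V'" if "p \<in> N" "p \<in> S" for p
    proof -
      have "p \<in> S \<inter> U'" using that 1(5) 2(2) by auto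
      then show "snd (\<psi> p) = Y c" using XY[OF that(1)] O(6)[OF that(2)] flat[OF 2(1)] by simp
      show "p \<in> V'" using 1(6) 2(4) that O(6)[OF that(2)] by force
    qed
    have "open (\<gamma> -` N)"
      using openin_continuous_map_preimage[OF \<gamma>(1) N] by (simp add: vimage_def)
    then obtain \<delta> where \<delta>: "\<delta> > 0" "ball x \<delta> \<subseteq> \<gamma> -` N" using 1(4) open_contains_ball by blast
    let ?C = "\<gamma> ` ball x \<delta>"
    have C: "connectedin (fol_top W) ?C"
      by (rule connectedin_continuous_map_image[OF \<gamma>W]) simp
    have inN: "\<gamma> y \<in> N" "\<gamma> y \<in> S" if "y \<in> ball x \<delta>" for y using \<delta>(2) that \<gamma>S by auto
    have "same_plaque W p q" if "p \<in> ?C" "q \<in> ?C" for p q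
      by (rule same_plaque_of_connected[OF 2(3) C _ _ that]) (use trans inN in auto)
    then show ?thesis using \<delta>(1) by (intro exI[of _ \<delta>]) (auto simp: dist_real_def abs_minus_commute)
  qed
  let ?A = "{x. \<gamma> x \<in> leaf_through W (\<gamma> u)}"
  have step: "y \<in> ?A" if "x \<in> ?A" "same_plaque W (\<gamma> x) (\<gamma> y)" for x y
    using that unfolding leaf_through_def by (auto intro: rtranclp.rtrancl_into_rtrancl)
  have "open ?A"
    unfolding open_dist dist_real_def using local step by blast
  moreover have "open (- ?A)"
    unfolding open_dist dist_real_def using local step by blast
  then have "closed ?A" by (simp add: closed_def)
  ultimately have "?A = {} \<or> ?A = UNIV" by (rule_tac clopen[THEN iffD1]) blast
  moreover have "u \<in> ?A" by (simp add: leaf_through_def)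
  ultimately show ?thesis by blast
qed

section \<open>The flat torus times a Euclidean transversal\<close>

lemma second_countable_euclidean: "second_countable (euclidean :: 'b::second_countable_topology
    topology)"
proof -
  obtain B :: "'b set set" where "countable B" "topological_basis B" using ex_countable_basis by blast
  moreover have "\<exists>V\<in>B. x \<in> V \<and> V \<subseteq> U" if "open U" "x \<in> U" for U x
    using topological_basisE[OF \<open>topological_basis B\<close> that] by metis
  ultimately show ?thesis
    unfolding second_countable_def using topological_basis_open by (intro exI[of _ B]) auto
qed

text \<open>
  Ternary expansions with digits 0 and 1: at the first place where two sets differ, the digit outweighs all
  later ones.
\<close>

lemma nat_sets_inject_real: "\<exists>f :: nat set \<Rightarrow> real. inj f"
proof -
  define c where "c S n = (if n \<in> S then (1/3) ^ n else (0::real))" for S n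
  have sg: "summable (\<lambda>n. (1/3::real) ^ n)" by (rule summable_geometric) simp
  have sc: "summable (c S)" for S
    by (rule summable_comparison_test'[OF sg, of 0]) (auto simp: c_def)
  have less: "suminf (c T) < suminf (c S)" if n: "n \<in> S" "n \<notin> T" "\<And>m. m < n \<Longrightarrow> m \<in> S \<longleftrightarrow> m \<in> T" for S T n
  proof -
    have "suminf (\<lambda>i. c T (i + Suc n)) \<le> suminf (\<lambda>i. (1/3::real) ^ (i + Suc n))"
      by (intro suminf_le summable_ignore_initial_segment[OF sc] summable_ignore_initial_segment[OF sg])
         (simp add: c_def)
    also have "\<dots> = suminf (\<lambda>i. (1/3::real) ^ Suc n * (1/3) ^ i)" by (simp add: power_add mult_ac)
    also have "\<dots> = (1/3) ^ Suc n * suminf (\<lambda>i. (1/3::real) ^ i)" by (rule suminf_mult[OF sg])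
    also have "\<dots> = (1/3) ^ n / 2" by (simp add: suminf_geometric)
    also have "\<dots> < (1/3) ^ n" by simp
    finally have 1: "suminf (\<lambda>i. c T (i + Suc n)) < (1/3) ^ n" .
    have 2: "0 \<le> suminf (\<lambda>i. c S (i + Suc n))"
      by (intro suminf_nonneg summable_ignore_initial_segment[OF sc]) (simp add: c_def)
    have "sum (c S) {..<n} = sum (c T) {..<n}" using n(3) by (intro sum.cong) (auto simp: c_def)
    then have "sum (c S) {..<Suc n} = sum (c T) {..<Suc n} + (1/3) ^ n"
        using n(1,2) by (simp add: c_def)
    then show ?thesis
      using suminf_split_initial_segment[OF sc, of S "Suc n"] suminf_split_initial_segment[OF sc, of T
          "Suc n"] 1 2 by simp
  qed
  have "S = T" if eq: "suminf (c S) = suminf (c T)" for S T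
  proof (rule ccontr)
    assume "S \<noteq> T"
    then have ex: "\<exists>n. (n \<in> S) \<noteq> (n \<in> T)" by auto
    define n where "n = (LEAST n. (n \<in> S) \<noteq> (n \<in> T))"
    have n: "(n \<in> S) \<noteq> (n \<in> T)" unfolding n_def using ex by (rule LeastI_ex)
    have m: "m \<in> S \<longleftrightarrow> m \<in> T" if "m < n" for m using not_less_Least that unfolding n_def by blast
    show False using n less[of n S T] less[of n T S] m eq by (cases "n \<in> S") auto
  qed
  then show ?thesis by (intro exI[of _ "\<lambda>S. suminf (c S)"]) (auto simp: inj_def)
qed

text \<open>
  A point of a Hausdorff space is determined by the basic open sets that contain it.
\<close>

lemma second_countable_inject_real: "\<exists>f :: 'b::{second_countable_topology, t2_space} \<Rightarrow> real. inj f"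
proof -
  obtain B :: "'b set set" where B: "countable B" "topological_basis B"
      using ex_countable_basis by blast
  define h where "h x = {n. x \<in> from_nat_into B n}" for x
  have "B \<noteq> {}" using topological_basisE[OF B(2) open_UNIV UNIV_I] by (metis empty_iff)
  then have r: "range (from_nat_into B) = B" using B(1) by (rule range_from_nat_into)
  have "x = y" if "h x = h y" for x y
  proof (rule ccontr)
    assume "x \<noteq> y"
    then obtain U where U: "open U" "(x \<in> U) \<noteq> (y \<in> U)" using hausdorff[OF \<open>x \<noteq> y\<close>] by blast
    have same: "x \<in> b \<longleftrightarrow> y \<in> b" if "b \<in> B" for b
    proof -
      obtain n where "b = from_nat_into B n" using \<open>b \<in> B\<close> r by blast
      then show ?thesis using \<open>h x = h y\<close> by (auto simp: h_def)
    qed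
    show False
    proof (cases "x \<in> U")
      case True
      then obtain b where "b \<in> B" "x \<in> b" "b \<subseteq> U" using topological_basisE[OF B(2) U(1)] by metis
      then show ?thesis using same True U(2) by blast
    next
      case False
      then have "y \<in> U" using U(2) by blast
      then obtain b where "b \<in> B" "y \<in> b" "b \<subseteq> U" using topological_basisE[OF B(2) U(1)] by metis
      then show ?thesis using same False by blast
    qed
  qed
  then have "inj h" by (auto simp: inj_def)
  moreover obtain f :: "nat set \<Rightarrow> real" where "inj f" using nat_sets_inject_real by blast
  ultimately show ?thesis using inj_compose by blast
qed

lemma continuous_map_coords:
  "continuous_map (prod_Euclidean k l) euclideanreal (\<lambda>p. fst p i)"
  "continuous_map (prod_Euclidean k l) euclideanreal (\<lambda>p. snd p i)"
proof -
  have E: "continuous_map (Euclidean_space n) euclideanreal (\<lambda>x. x i)" for n i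
    unfolding Euclidean_space_def
    by (intro continuous_map_from_subtopology continuous_map_product_projection) simp
  show "continuous_map (prod_Euclidean k l) euclideanreal (\<lambda>p. fst p i)"
    using continuous_map_compose[OF continuous_map_fst E] by (simp add: o_def)
  show "continuous_map (prod_Euclidean k l) euclideanreal (\<lambda>p. snd p i)"
    using continuous_map_compose[OF continuous_map_snd E] by (simp add: o_def)
qed

lemma second_countable_prod_Euclidean: "second_countable (prod_Euclidean k l)"
proof -
  have "prod_Euclidean k l = subtopology (prod_topology euclidean euclidean) (coordspace {..<k} \<times>
      coordspace {..<l})"
    by (simp add: Euclidean_space_top_of_set subtopology_Times)
  also have "prod_topology euclidean euclidean = (euclidean :: (point \<times> point) topology)"
    by (metis euclidean_product_topology prod_topology_euclidean)
  finally show ?thesis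
    using second_countable_subtopology[OF second_countable_euclidean] by metis
qed

text \<open>
  The map \<open>E\<close> has the fibres of the projection of \<open>\<real>\<^sup>k \<times> \<real>\<^sup>l\<close> to the torus times \<open>\<real>\<^sup>l\<close>; its values are arbitrary
  names for the points of the quotient.
\<close>

locale torus_cover =
  fixes k l :: nat and E :: "point \<times> point \<Rightarrow> 'a"
  assumes E_eq: "\<And>p q. p \<in> topspace (prod_Euclidean k l) \<Longrightarrow> q \<in> topspace (prod_Euclidean k l) \<Longrightarrow>
    E p = E q \<longleftrightarrow> (\<forall>i<k. fst p i - fst q i \<in> \<int>) \<and> snd p = snd q"
begin

abbreviation "P \<equiv> prod_Euclidean k l"

lemma mem_P: "p \<in> topspace P \<longleftrightarrow> (\<forall>i\<ge>k. fst p i = 0) \<and> (\<forall>i\<ge>l. snd p i = 0)"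
  by (cases p) (simp add: topspace_Euclidean_space)

text \<open>
  The quotient topology of \<open>E\<close>.
\<close>

definition torus_top :: "'a topology" where
  "torus_top = topology (\<lambda>U. U \<subseteq> E ` topspace P \<and> openin P {p \<in> topspace P. E p \<in> U})"

lemma openin_torus_top: "openin torus_top U \<longleftrightarrow> U \<subseteq> E ` topspace P \<and> openin P {p \<in> topspace P. E p \<in> U}"
proof -
  have "istopology (\<lambda>U. U \<subseteq> E ` topspace P \<and> openin P {p \<in> topspace P. E p \<in> U})"
    unfolding istopology_def
  proof (intro conjI allI impI)
    fix S T assume "S \<subseteq> E ` topspace P \<and> openin P {p \<in> topspace P. E p \<in> S}"
        "T \<subseteq> E ` topspace P \<and> openin P {p \<in> topspace P. E p \<in> T}"
    then have "openin P ({p \<in> topspace P. E p \<in> S} \<inter> {p \<in> topspace P. E p \<in> T})"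
        "S \<inter> T \<subseteq> E ` topspace P" by auto
    moreover have "{p \<in> topspace P. E p \<in> S} \<inter> {p \<in> topspace P. E p \<in> T} = {p \<in> topspace P. E p \<in> S \<inter>
        T}" by auto
    ultimately show "S \<inter> T \<subseteq> E ` topspace P" "openin P {p \<in> topspace P. E p \<in> S \<inter> T}" by simp_all
  next
    fix K assume K: "\<forall>S\<in>K. S \<subseteq> E ` topspace P \<and> openin P {p \<in> topspace P. E p \<in> S}"
    then show "\<Union>K \<subseteq> E ` topspace P" by blast
    have "openin P (\<Union>S\<in>K. {p \<in> topspace P. E p \<in> S})" using K by (intro openin_Union) auto
    moreover have "(\<Union>S\<in>K. {p \<in> topspace P. E p \<in> S}) = {p \<in> topspace P. E p \<in> \<Union>K}" by auto
    ultimately show "openin P {p \<in> topspace P. E p \<in> \<Union>K}" by simp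
  qed
  then show ?thesis unfolding torus_top_def by (simp add: topology_inverse')
qed

lemma topspace_torus_top: "topspace torus_top = E ` topspace P"
proof
  show "topspace torus_top \<subseteq> E ` topspace P" using openin_torus_top[of "topspace torus_top"] by auto
  have "{p \<in> topspace P. E p \<in> E ` topspace P} = topspace P" by auto
  then have "openin P {p \<in> topspace P. E p \<in> E ` topspace P}" by (simp only: openin_topspace)
  then have "openin torus_top (E ` topspace P)" unfolding openin_torus_top by blast
  then show "E ` topspace P \<subseteq> topspace torus_top" by (rule openin_subset)
qed

lemma continuous_E: "continuous_map P torus_top E"
  unfolding continuous_map_def topspace_torus_top by (auto simp: openin_torus_top)

text \<open>
  The saturation of an open set is a union of translates by integer vectors.
\<close>

lemma open_map_E: "open_map P torus_top E"
  unfolding open_map_def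
proof (intro allI impI)
  fix V assume V: "openin P V"
  have "openin P {p \<in> topspace P. E p \<in> E ` V}"
  proof (subst openin_subopen, rule ballI)
    fix p assume "p \<in> {p \<in> topspace P. E p \<in> E ` V}"
    then obtain v where p: "p \<in> topspace P" and v: "v \<in> V" "E p = E v" by auto
    have vP: "v \<in> topspace P" using v V openin_subset by blast
    have int: "\<And>i. i < k \<Longrightarrow> fst p i - fst v i \<in> \<int>" and snd: "snd p = snd v"
        using E_eq[OF p vP] v(2) by auto
    \<comment> \<open>The translation that takes \<open>p\<close> to \<open>v\<close>; it is by an integer vector, so it preserves the fibres of \<open>E\<close>.\<close>
    define \<tau> where "\<tau> q = ((\<lambda>i. if i < k then fst q i - (fst p i - fst v i) else 0), snd q)"
        for q :: "point \<times> point"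
    have "continuous_map P (Euclidean_space k) (\<lambda>q i. if i < k then fst q i - (fst p i - fst v i) else
        0)"
      unfolding continuous_map_componentwise_Euclidean_space
      by (intro allI impI continuous_map_diff continuous_map_coords continuous_map_const[THEN iffD2])
          auto
    then have \<tau>: "continuous_map P P \<tau>"
      unfolding \<tau>_def by (intro continuous_map_paired[THEN iffD2] conjI continuous_map_snd) 
    let ?T = "{q \<in> topspace P. \<tau> q \<in> V}"
    have "openin P ?T" using openin_continuous_map_preimage[OF \<tau> V] .
    moreover have "\<tau> p = v"
      using vP[unfolded mem_P] snd by (auto simp: \<tau>_def fun_eq_iff prod_eq_iff not_less)
    then have "p \<in> ?T" using p v by simp
    moreover have "?T \<subseteq> {p \<in> topspace P. E p \<in> E ` V}"
    proof
      fix q assume q: "q \<in> ?T"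
      then have "\<tau> q \<in> topspace P" using V openin_subset by blast
      then have "E q = E (\<tau> q)" using q int by (subst E_eq) (auto simp: \<tau>_def)
      then show "q \<in> {p \<in> topspace P. E p \<in> E ` V}" using q by auto
    qed
    ultimately show "\<exists>T. openin P T \<and> p \<in> T \<and> T \<subseteq> {p \<in> topspace P. E p \<in> E ` V}" by blast
  qed
  then show "openin torus_top (E ` V)" unfolding openin_torus_top using openin_subset[OF V] by auto
qed

text \<open>
  Take disjoint neighbourhoods of the two values of \<open>H\<close> and push their preimages forward along the open map
  \<open>E\<close>; the images are disjoint because \<open>H\<close> is constant on the fibres of \<open>E\<close>.
\<close>

lemma separated_by_function:
  assumes H: "continuous_map P euclideanreal H"
    and inv: "\<And>p q. p \<in> topspace P \<Longrightarrow> q \<in> topspace P \<Longrightarrow> E p = E q \<Longrightarrow> H p = H q"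
    and p: "p \<in> topspace P" "q \<in> topspace P" "H p \<noteq> H q"
  shows "\<exists>U V. openin torus_top U \<and> openin torus_top V \<and> E p \<in> U \<and> E q \<in> V \<and> disjnt U V"
proof -
  obtain A B where AB: "open A" "open B" "H p \<in> A" "H q \<in> B" "A \<inter> B = {}"
    using hausdorff[OF p(3)] by blast
  have "openin P {z \<in> topspace P. H z \<in> A}" "openin P {z \<in> topspace P. H z \<in> B}"
    using openin_continuous_map_preimage[OF H] AB by auto
  then have "openin torus_top (E ` {z \<in> topspace P. H z \<in> A})"
      "openin torus_top (E ` {z \<in> topspace P. H z \<in> B})"
    using open_map_E by (auto simp: open_map_def)
  moreover have "False" if "z \<in> topspace P" "z' \<in> topspace P" "H z \<in> A" "H z' \<in> B" "E z = E z'" for z z'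
    using inv[OF that(1,2,5)] that(3,4) AB(5) by auto
  then have "disjnt (E ` {z \<in> topspace P. H z \<in> A}) (E ` {z \<in> topspace P. H z \<in> B})"
    unfolding disjnt_def by blast
  ultimately show ?thesis using p AB(3,4) by blast
qed

text \<open>
  Points with different transversal coordinates are separated by such a coordinate, other points by the
  1-periodic function \<open>cos (2 \<pi> (x\<^sub>i - p\<^sub>i))\<close>, which takes the value 1 only where \<open>x\<^sub>i - p\<^sub>i\<close> is an integer.
\<close>

lemma Hausdorff_torus_top: "Hausdorff_space torus_top"
  unfolding Hausdorff_space_def
proof (intro allI impI, elim conjE)
  fix x y assume "x \<in> topspace torus_top" "y \<in> topspace torus_top" "x \<noteq> y"
  then obtain p q where p: "p \<in> topspace P" "x = E p" and q: "q \<in> topspace P" "y = E q"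
      and ne: "E p \<noteq> E q"
    by (auto simp: topspace_torus_top)
  show "\<exists>U V. openin torus_top U \<and> openin torus_top V \<and> x \<in> U \<and> y \<in> V \<and> disjnt U V"
  proof (cases "snd p = snd q")
    case False
    then obtain j where "snd p j \<noteq> snd q j" by auto
    then show ?thesis
      unfolding p(2) q(2) using p(1) q(1)
      by (intro separated_by_function[of "\<lambda>z. snd z j"] continuous_map_coords) (auto simp: E_eq)
  next
    case True
    then obtain i where i: "i < k" "fst p i - fst q i \<notin> \<int>" using ne E_eq[OF p(1) q(1)] by auto
    let ?H = "\<lambda>z. cos (2 * pi * (fst z i - fst p i))"
    have "continuous_map P euclideanreal ((\<lambda>t. cos (2 * pi * (t - fst p i))) \<circ> (\<lambda>z. fst z i))"
      by (rule continuous_map_compose[OF continuous_map_coords(1)]) (auto intro!: continuous_intros)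
    then have H1: "continuous_map P euclideanreal ?H" by (simp add: o_def)
    have H2: "?H z = ?H z'" if zz: "z \<in> topspace P" "z' \<in> topspace P" "E z = E z'" for z z'
    proof -
      obtain n where "fst z i - fst z' i = of_int n"
        using E_eq[OF zz(1,2)] zz(3) i(1) by (auto elim: Ints_cases)
      then have "2 * pi * (fst z i - fst p i) = 2 * pi * (fst z' i - fst p i) + 2 * pi * of_int n"
        by (simp add: algebra_simps)
      then show ?thesis by (simp only: cos_add cos_int_2pin sin_int_2pin mult_1_right mult_zero_right
          diff_zero)
    qed
    have H3: "?H p \<noteq> ?H q"
    proof
      assume "?H p = ?H q"
      then have "cos (2 * pi * (fst q i - fst p i)) = 1" by simp
      then obtain n :: int where "2 * pi * (fst q i - fst p i) = of_int n * 2 * pi"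
        unfolding cos_one_2pi_int by blast
      then have "(2 * pi) * (fst q i - fst p i) = (2 * pi) * of_int n" by (simp only: mult_ac)
      then have "fst q i - fst p i = of_int n" by (subst (asm) mult_left_cancel) simp_all
      then have "fst p i - fst q i = of_int (- n)" by simp
      then show False using i(2) by (metis Ints_of_int)
    qed
    show ?thesis
      unfolding p(2) q(2) by (rule separated_by_function[of ?H, OF H1 H2 p(1) q(1) H3])
  qed
qed

lemma second_countable_torus_top: "second_countable torus_top"
  by (rule second_countable_open_map_image[OF continuous_E open_map_E _
      second_countable_prod_Euclidean])
    (simp add: topspace_torus_top)

text \<open>
  Small enough for \<open>E\<close> to be injective; the inverses of \<open>E\<close> on these cells are the charts.
\<close>

definition unit_cell :: "point \<Rightarrow> (point \<times> point) set" where
  "unit_cell a = {p \<in> topspace P. \<forall>i<k. a i < fst p i \<and> fst p i < a i + 1}"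

lemma unit_cell_subset: "unit_cell a \<subseteq> topspace P" by (auto simp: unit_cell_def)

lemma open_unit_cell: "openin P (unit_cell a)"
proof -
  have "openin P {p \<in> topspace P. fst p i \<in> {a i<..<a i + 1}}" for i
    by (rule openin_continuous_map_preimage[OF continuous_map_coords(1)]) simp
  then have "openin P ((\<Inter>i\<in>{..<k}. {p \<in> topspace P. fst p i \<in> {a i<..<a i + 1}}) \<inter> topspace P)"
    by (rule openin_INT[OF finite_lessThan])
  moreover have "(\<Inter>i\<in>{..<k}. {p \<in> topspace P. fst p i \<in> {a i<..<a i + 1}}) \<inter> topspace P = unit_cell a"
    unfolding unit_cell_def by auto
  ultimately show ?thesis by simp
qed

lemma inj_unit_cell: "inj_on E (unit_cell a)"
proof (rule inj_onI)
  fix p q assume pq: "p \<in> unit_cell a" "q \<in> unit_cell a" "E p = E q"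
  have P: "p \<in> topspace P" "q \<in> topspace P" using pq unit_cell_subset by auto
  have E: "\<forall>i<k. fst p i - fst q i \<in> \<int>" "snd p = snd q" using E_eq[OF P] pq(3) by auto
  have "fst p i = fst q i" for i
  proof (cases "i < k")
    case True
    then obtain n :: int where n: "fst p i - fst q i = of_int n" using E(1) by (auto elim: Ints_cases)
    have "\<bar>fst p i - fst q i\<bar> < 1" using pq True by (force simp: unit_cell_def abs_less_iff)
    then have "n = 0" using n by linarith
    then show ?thesis using n by simp
  qed (use P[unfolded mem_P] in auto)
  then show "p = q" using E(2) by (auto simp: prod_eq_iff)
qed

definition chart_of :: "point \<Rightarrow> 'a chart" where
  "chart_of a = (E ` unit_cell a, inv_into (unit_cell a) E)"

definition torus_foliation :: "'a foliated" where
  "torus_foliation = \<lparr>fol_top = torus_top, fol_atlas = range chart_of\<rparr>"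

lemma chart_inv: "p \<in> unit_cell a \<Longrightarrow> inv_into (unit_cell a) E (E p) = p"
  by (rule inv_into_f_f[OF inj_unit_cell])

lemma chart_image: "inv_into (unit_cell a) E ` (E ` unit_cell a) = unit_cell a"
  by (auto simp: image_image chart_inv)

lemma chart_homeomorphic:
  "homeomorphic_map (subtopology torus_top (E ` unit_cell a)) (subtopology P (unit_cell a)) (inv_into
      (unit_cell a) E)"
proof -
  have UX: "openin torus_top (E ` unit_cell a)"
      using open_map_E open_unit_cell by (auto simp: open_map_def)
  have ts: "topspace (subtopology P (unit_cell a)) = unit_cell a"
      "topspace (subtopology torus_top (E ` unit_cell a)) = E ` unit_cell a"
    using unit_cell_subset[of a] by (auto simp: topspace_torus_top)
  have "homeomorphic_map (subtopology P (unit_cell a)) (subtopology torus_top (E ` unit_cell a)) E"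
  proof (rule bijective_open_imp_homeomorphic_map)
    show "continuous_map (subtopology P (unit_cell a)) (subtopology torus_top (E ` unit_cell a)) E"
      by (intro continuous_map_into_subtopology continuous_map_from_subtopology continuous_E) (auto
          simp: ts)
    show "open_map (subtopology P (unit_cell a)) (subtopology torus_top (E ` unit_cell a)) E"
      using open_map_E UX unfolding open_map_def openin_open_subtopology[OF open_unit_cell]
          openin_open_subtopology[OF UX] by blast
  qed (use ts inj_unit_cell in auto)
  then obtain g where g: "homeomorphic_maps (subtopology P (unit_cell a)) (subtopology torus_top (E `
      unit_cell a)) E g"
    by (auto simp: homeomorphic_map_maps)
  then have "homeomorphic_map (subtopology torus_top (E ` unit_cell a)) (subtopology P (unit_cell a)) g"
    by (simp add: homeomorphic_maps_map)
  then show ?thesis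
  proof (rule homeomorphic_map_eq)
    fix x assume "x \<in> topspace (subtopology torus_top (E ` unit_cell a))"
    then obtain p where p: "p \<in> unit_cell a" "x = E p" using ts by auto
    have "\<forall>z\<in>unit_cell a. g (E z) = z" using g ts by (simp add: homeomorphic_maps_def)
    then show "g x = inv_into (unit_cell a) E x" using p by (simp add: chart_inv)
  qed
qed

text \<open>
  In the cell with corner \<open>b\<close> the representative of a class has leaf coordinates \<open>x\<^sub>i - \<lfloor>x\<^sub>i - b\<^sub>i\<rfloor>\<close>, and the
  integer part does not jump because the faces of the cell are excluded.
\<close>

lemma transition:
  assumes p: "p \<in> topspace P" and "E p \<in> E ` unit_cell b"
  shows "inv_into (unit_cell b) E (E p) = ((\<lambda>i. if i < k then fst p i - of_int \<lfloor>fst p i - b i\<rfloor> else 0),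
      snd p)"
    and "i < k \<Longrightarrow> fst p i - b i \<notin> \<int>"
proof -
  obtain q where q: "q \<in> unit_cell b" "E p = E q" using assms(2) by blast
  have qP: "q \<in> topspace P" using q(1) unit_cell_subset by blast
  have E: "\<And>i. i < k \<Longrightarrow> fst p i - fst q i \<in> \<int>" "snd p = snd q" using E_eq[OF p qP] q(2) by auto
  have fl: "fst q i = fst p i - of_int \<lfloor>fst p i - b i\<rfloor> \<and> fst p i - b i \<notin> \<int>" if ik: "i < k" for i
  proof -
    obtain n :: int where n: "fst p i - fst q i = of_int n" using E(1)[OF ik] by (auto elim: Ints_cases)
    have b: "b i < fst q i" "fst q i < b i + 1" using q(1) that by (auto simp: unit_cell_def)
    have "\<lfloor>fst p i - b i\<rfloor> = n" using n b by (intro floor_unique) auto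
    moreover have "fst p i - b i \<notin> \<int>"
    proof
      assume "fst p i - b i \<in> \<int>"
      then obtain m :: int where "fst p i - b i = of_int m" by (auto elim: Ints_cases)
      then have "of_int n < (of_int m :: real)" "(of_int m :: real) < of_int n + 1"
          using n b by linarith+
      then have "n < m" "m < n + 1" by linarith+
      then show False by linarith
    qed
    ultimately show ?thesis using n by simp
  qed
  show "i < k \<Longrightarrow> fst p i - b i \<notin> \<int>" using fl by blast
  have "q = ((\<lambda>i. if i < k then fst p i - of_int \<lfloor>fst p i - b i\<rfloor> else 0), snd p)"
    using fl E(2) qP[unfolded mem_P] by (auto simp: prod_eq_iff fun_eq_iff not_less)
  then show "inv_into (unit_cell b) E (E p) = ((\<lambda>i. if i < k then fst p i - of_int \<lfloor>fst p i - b i\<rfloor> else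
      0), snd p)"
    using chart_inv[OF q(1)] q(2) by simp
qed

lemma floor_locally_constant:
  assumes "t \<notin> \<int>"
  shows "\<exists>\<delta>>0. \<forall>u. \<bar>u - t\<bar> < \<delta> \<longrightarrow> \<lfloor>u\<rfloor> = \<lfloor>t :: real\<rfloor>"
proof -
  have "of_int \<lfloor>t\<rfloor> < t" using assms by (metis Ints_of_int floor_correct order_le_less)
  moreover have "t < of_int \<lfloor>t\<rfloor> + 1" by linarith
  ultimately have pos: "min (t - of_int \<lfloor>t\<rfloor>) (of_int \<lfloor>t\<rfloor> + 1 - t) > 0" by simp
  have "\<lfloor>u\<rfloor> = \<lfloor>t\<rfloor>" if "\<bar>u - t\<bar> < min (t - of_int \<lfloor>t\<rfloor>) (of_int \<lfloor>t\<rfloor> + 1 - t)" for u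
  proof (rule floor_unique)
    have "\<bar>u - t\<bar> < t - of_int \<lfloor>t\<rfloor>" "\<bar>u - t\<bar> < of_int \<lfloor>t\<rfloor> + 1 - t" using that by simp_all
    then show "of_int \<lfloor>t\<rfloor> \<le> u" "u < of_int \<lfloor>t\<rfloor> + 1" by (simp_all add: abs_less_iff)
  qed
  with pos show ?thesis by blast
qed

lemma integer_shift_form:
  assumes \<Omega>: "openin P \<Omega>" and nz: "\<And>p i. p \<in> \<Omega> \<Longrightarrow> i < k \<Longrightarrow> fst p i - b i \<notin> \<int>"
  shows "fol_form k l r s \<Omega> (\<lambda>p. ((\<lambda>i. if i < k then fst p i - of_int \<lfloor>fst p i - b i\<rfloor> else 0), snd p))"
proof -
  let ?X = "\<lambda>p i. if i < k then fst p i - of_int \<lfloor>fst p i - b i\<rfloor> else 0"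
  note dom = open_glue[OF \<Omega>]
  have "C_rs_fun k l r s \<Omega> (\<lambda>p. ?X p i)" if i: "i < k" for i
  proof -
    have eq: "(\<lambda>p. ?X p i) \<circ> unglue = (\<lambda>q. q (Inl i) + - of_int \<lfloor>q (Inl i) - b i\<rfloor>)"
      using i by (auto simp: unglue_def)
    have lc: "\<exists>\<delta>>0. \<forall>q\<in>glue ` \<Omega>. (\<forall>d\<in>leaf_dirs k \<union> trans_dirs l. \<bar>q d - p d\<bar> < \<delta>) \<longrightarrow>
        - real_of_int \<lfloor>q (Inl i) - b i\<rfloor> = - of_int \<lfloor>p (Inl i) - b i\<rfloor>" if "p \<in> glue ` \<Omega>" for p
    proof -
      have "p (Inl i) - b i \<notin> \<int>" using that nz[OF _ i] by auto
      from floor_locally_constant[OF this]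
      obtain \<delta> where \<delta>: "\<delta> > 0" "\<And>u. \<bar>u - (p (Inl i) - b i)\<bar> < \<delta> \<Longrightarrow> \<lfloor>u\<rfloor> = \<lfloor>p (Inl i) - b i\<rfloor>" by blast
      have F: "\<lfloor>q (Inl i) - b i\<rfloor> = \<lfloor>p (Inl i) - b i\<rfloor>"
          if "\<forall>d\<in>leaf_dirs k \<union> trans_dirs l. \<bar>q d - p d\<bar> < \<delta>" for q
      proof (rule \<delta>(2))
        have "\<bar>q (Inl i) - p (Inl i)\<bar> < \<delta>" using that i by simp
        then show "\<bar>q (Inl i) - b i - (p (Inl i) - b i)\<bar> < \<delta>" by simp
      qed
      show ?thesis
      proof (intro exI[of _ \<delta>] conjI ballI impI \<delta>(1))
        fix q assume "\<forall>d\<in>leaf_dirs k \<union> trans_dirs l. \<bar>q d - p d\<bar> < \<delta>"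
        from F[OF this] show "- real_of_int \<lfloor>q (Inl i) - b i\<rfloor> = - of_int \<lfloor>p (Inl i) - b i\<rfloor>"
            by (simp only:)
      qed
    qed
    show ?thesis
      unfolding C_rs_fun_iff[OF \<Omega>] eq
      by (intro conjI allI impI regular_add[OF dom] coord_regular[OF dom] locally_constant_regular[OF
          dom]
          real_analytic_in_add[OF dom order_refl] coord_analytic[OF dom order_refl] lc order_refl)
  qed
  moreover have "C_fun l s (snd ` \<Omega>) (\<lambda>y. y j)" for j
    unfolding C_fun_iff[OF open_snd_image[OF \<Omega>]]
    using coord_regular[OF open_coord_domain[OF open_snd_image[OF \<Omega>]]] by blast
  ultimately show ?thesis
    unfolding fol_form_def by (intro exI[of _ ?X] exI[of _ "\<lambda>y. y"]) auto
qed

lemma foliated_torus: "foliated_manifold k l r s torus_foliation"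
  unfolding foliated_manifold_def
proof (intro conjI)
  show "Hausdorff_space (fol_top torus_foliation)" "second_countable (fol_top torus_foliation)"
    by (simp_all add: torus_foliation_def Hausdorff_torus_top second_countable_torus_top)
  have "\<exists>a. p \<in> unit_cell a" if "p \<in> topspace P" for p
    using that by (intro exI[of _ "\<lambda>i. fst p i - 1/2"]) (auto simp: unit_cell_def)
  then show "(\<Union>(U, \<phi>)\<in>fol_atlas torus_foliation. U) = topspace (fol_top torus_foliation)"
    using unit_cell_subset by (fastforce simp: torus_foliation_def chart_of_def topspace_torus_top)
  have UX: "openin torus_top (E ` unit_cell a)" for a using open_map_E open_unit_cell
      by (auto simp: open_map_def)
  show "\<forall>(U, \<phi>)\<in>fol_atlas torus_foliation.
        openin (fol_top torus_foliation) U \<and> openin P (\<phi> ` U) \<and>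
        homeomorphic_map (subtopology (fol_top torus_foliation) U) (subtopology P (\<phi> ` U)) \<phi>"
    using UX open_unit_cell chart_homeomorphic
        by (auto simp: torus_foliation_def chart_of_def chart_image)
  show "\<forall>(U, \<phi>)\<in>fol_atlas torus_foliation. \<forall>(V, \<psi>)\<in>fol_atlas torus_foliation. fol_form k l r s (\<phi> ` (U \<inter>
      V)) (\<psi> \<circ> inv_into U \<phi>)"
  proof -
    have "fol_form k l r s (inv_into (unit_cell a) E ` (E ` unit_cell a \<inter> E ` unit_cell b))
       (inv_into (unit_cell b) E \<circ> inv_into (E ` unit_cell a) (inv_into (unit_cell a) E))" for a b
    proof -
      let ?\<Omega> = "inv_into (unit_cell a) E ` (E ` unit_cell a \<inter> E ` unit_cell b)"
      have "E ` unit_cell a \<inter> E ` unit_cell b = E ` {p \<in> unit_cell a. E p \<in> E ` unit_cell b}" by blast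
      then have "?\<Omega> = (\<lambda>p. inv_into (unit_cell a) E (E p)) ` {p \<in> unit_cell a. E p \<in> E ` unit_cell b}"
        by (simp only: image_image)
      also have "\<dots> = (\<lambda>p. p) ` {p \<in> unit_cell a. E p \<in> E ` unit_cell b}"
        by (rule image_cong) (simp_all add: chart_inv)
      finally have \<Omega>: "?\<Omega> = {p \<in> unit_cell a. E p \<in> E ` unit_cell b}" by simp
      have "openin P {p \<in> topspace P. E p \<in> E ` unit_cell b}"
        using openin_continuous_map_preimage[OF continuous_E UX] .
      then have "openin P (unit_cell a \<inter> {p \<in> topspace P. E p \<in> E ` unit_cell b})"
          using open_unit_cell by blast
      moreover have "unit_cell a \<inter> {p \<in> topspace P. E p \<in> E ` unit_cell b} = ?\<Omega>"
        unfolding \<Omega> using unit_cell_subset by blast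
      ultimately have o: "openin P ?\<Omega>" by simp
      have pP: "p \<in> topspace P" "E p \<in> E ` unit_cell b" "p \<in> unit_cell a" if "p \<in> ?\<Omega>" for p
        using that unit_cell_subset unfolding \<Omega> by blast+
      have inj: "inj_on (inv_into (unit_cell a) E) (E ` unit_cell a)"
        by (rule inj_on_inv_into) simp
      show ?thesis
      proof (rule fol_form_cong[OF integer_shift_form[OF o]])
        show "fst p i - b i \<notin> \<int>" if "p \<in> ?\<Omega>" "i < k" for p i
          using transition(2)[OF pP(1,2)[OF that(1)] that(2)] .
        fix p assume p: "p \<in> ?\<Omega>"
        have "inv_into (E ` unit_cell a) (inv_into (unit_cell a) E) p = E p"
          using inv_into_f_f[OF inj, of "E p"] pP(3)[OF p] chart_inv[OF pP(3)[OF p]] by auto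
        then show "((\<lambda>i. if i < k then fst p i - of_int \<lfloor>fst p i - b i\<rfloor> else 0), snd p) =
           (inv_into (unit_cell b) E \<circ> inv_into (E ` unit_cell a) (inv_into (unit_cell a) E)) p"
          using transition(1)[OF pP(1,2)[OF p]] by simp
      qed
    qed
    then show ?thesis by (auto simp: torus_foliation_def chart_of_def)
  qed
qed

text \<open>
  The torus \<open>T \<times> {0}\<close>.
\<close>

definition core :: "'a set" where
  "core = E ` {p \<in> topspace P. snd p = (\<lambda>_. 0)}"

text \<open>
  As a plaque of a chart has constant transversal coordinate, this keeps plaques that meet the core inside it.
\<close>

lemma core_iff_flat:
  assumes "(U, \<phi>) \<in> fol_atlas torus_foliation" "x \<in> U"
  shows "x \<in> core \<longleftrightarrow> snd (\<phi> x) = (\<lambda>_. 0)"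
proof -
  obtain a where a: "U = E ` unit_cell a" "\<phi> = inv_into (unit_cell a) E"
    using assms(1) by (auto simp: torus_foliation_def chart_of_def)
  then obtain p where p: "p \<in> unit_cell a" "x = E p" using assms(2) by auto
  have pP: "p \<in> topspace P" using p unit_cell_subset by blast
  have "x \<in> core \<longleftrightarrow> snd p = (\<lambda>_. 0)"
  proof
    assume "x \<in> core"
    then obtain q where "q \<in> topspace P" "snd q = (\<lambda>_. 0)" "E p = E q" unfolding core_def p(2) by blast
    then show "snd p = (\<lambda>_. 0)" using E_eq[OF pP] by metis
  qed (use pP in \<open>unfold core_def p(2), blast\<close>)
  then show ?thesis using chart_inv[OF p(1)] a p by simp
qed

lemma compact_core: "compactin torus_top core"
proof -
  let ?K1 = "\<Pi>\<^sub>E i\<in>UNIV. if i < k then {0..1} else {0 :: real}"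
  let ?K = "?K1 \<times> {(\<lambda>_. 0) :: point}"
  have "compactin (powertop_real UNIV) ?K1"
    unfolding compactin_PiE by auto
  then have "compactin (Euclidean_space k) ?K1"
    unfolding Euclidean_space_def compactin_subtopology
        by (auto simp: PiE_iff not_less) (metis leD singletonD)
  moreover have "compactin (Euclidean_space l) {\<lambda>_. 0}"
    by (simp add: topspace_Euclidean_space)
  ultimately have K: "compactin P ?K" by (simp add: compactin_Times)
  have "E ` ?K = core"
  proof
    have "p \<in> topspace P \<and> snd p = (\<lambda>_. 0)" if "p \<in> ?K" for p
      using that compactin_subset_topspace[OF K] by (intro conjI, blast, auto)
    then show "E ` ?K \<subseteq> core" unfolding core_def by blast
    show "core \<subseteq> E ` ?K"
    proof
      fix x assume "x \<in> core"
      then obtain p where p: "p \<in> topspace P" "snd p = (\<lambda>_. 0)" "x = E p" by (auto simp: core_def)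
      define q where "q = ((\<lambda>i. if i < k then frac (fst p i) else 0), (\<lambda>_. 0) :: point)"
      have q: "q \<in> ?K" by (auto simp: q_def less_imp_le frac_lt_1)
      then have "q \<in> topspace P" using compactin_subset_topspace[OF K] by blast
      then have "E p = E q" using p by (subst E_eq) (auto simp: q_def frac_def)
      then show "x \<in> E ` ?K" using q p by blast
    qed
  qed
  then show ?thesis using image_compactin[OF K continuous_E] by simp
qed

lemma path_in_core:
  assumes "x \<in> core" "y \<in> core"
  obtains \<gamma> where "continuous_map euclideanreal torus_top \<gamma>" "range \<gamma> \<subseteq> core" "\<gamma> 0 = x" "\<gamma> 1 = y"
proof -
  obtain p q where p: "p \<in> topspace P" "snd p = (\<lambda>_. 0)" "x = E p" and q: "q \<in> topspace P"
      "snd q = (\<lambda>_. 0)" "y = E q"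
    using assms by (auto simp: core_def)
  define \<sigma> where "\<sigma> t = ((\<lambda>i. if i < k then fst p i + t * (fst q i - fst p i) else 0),
      (\<lambda>_. 0) :: point)" for t
  have "continuous_map euclideanreal (Euclidean_space k) (\<lambda>t i. if i < k then fst p i + t * (fst q i -
      fst p i) else 0)"
    unfolding continuous_map_componentwise_Euclidean_space by (auto intro!: continuous_intros)
  then have \<sigma>: "continuous_map euclideanreal P \<sigma>"
    unfolding \<sigma>_def by (intro continuous_map_paired[THEN iffD2] conjI) (auto simp:
        topspace_Euclidean_space)
  have "\<sigma> t \<in> topspace P" for t unfolding mem_P by (auto simp: \<sigma>_def)
  then have "range (E \<circ> \<sigma>) \<subseteq> core" by (auto simp: core_def \<sigma>_def)
  moreover have "\<sigma> 0 = p" "\<sigma> 1 = q"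
    using p(1)[unfolded mem_P] q(1)[unfolded mem_P] p(2) q(2)
        by (auto simp: \<sigma>_def prod_eq_iff fun_eq_iff not_less)
  ultimately show ?thesis
    using that[of "E \<circ> \<sigma>"] continuous_map_compose[OF \<sigma> continuous_E] p q by simp
qed

lemma leaf_in_core:
  assumes "x \<in> core" "y \<in> leaf_through torus_foliation x"
  shows "y \<in> core"
proof -
  have step: "z' \<in> core" if z: "z \<in> core" "same_plaque torus_foliation z z'" for z z'
  proof -
    obtain U \<phi> where U: "(U, \<phi>) \<in> fol_atlas torus_foliation" "z \<in> U"
      and c: "connected_component_of (subtopology (fol_top torus_foliation) {w \<in> U. snd (\<phi> w) = snd (\<phi>
          z)}) z z'"
      using z(2) unfolding same_plaque_def by auto
    have "z' \<in> U" "snd (\<phi> z') = snd (\<phi> z)"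
      using connected_component_of_maximal connected_component_in_topspace[OF c] by auto
    then show ?thesis using core_iff_flat[OF U(1)] U(2) z(1) by metis
  qed
  have "(same_plaque torus_foliation)\<^sup>*\<^sup>* x y" using assms(2) by (simp add: leaf_through_def)
  then show ?thesis using assms(1) by (induction rule: rtranclp_induct) (use step in auto)
qed

lemma pre_solenoid_core: "pre_solenoid k l r s (core, torus_foliation)"
proof -
  have "((\<lambda>_. 0), (\<lambda>_. 0)) \<in> {p \<in> topspace P. snd p = (\<lambda>_. 0)}" unfolding mem_Collect_eq mem_P by simp
  then have "core \<noteq> {}" unfolding core_def by blast
  moreover have "core \<subseteq> topspace torus_top" using compact_core compactin_subset_topspace by blast
  moreover have "core = \<Union> (leaf_through torus_foliation ` core)"
    using leaf_in_core by (auto simp: leaf_through_def)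
  ultimately show ?thesis
    unfolding pre_solenoid_def using foliated_torus compact_core
    by (auto simp: torus_foliation_def leaves_def intro!: exI[of _
        "leaf_through torus_foliation ` core"])
qed

end

section \<open>A minimal solenoid\<close>

text \<open>
  Coordinates modulo 1 are represented by their fractional parts and sent to \<open>'a\<close> by an injection.
\<close>

lemma torus_cover_exists:
  assumes "\<exists>f :: real \<Rightarrow> 'a. inj f"
  shows "\<exists>E :: point \<times> point \<Rightarrow> 'a. torus_cover k l E"
proof -
  obtain f :: "real \<Rightarrow> 'a" where f: "inj f" using assms by blast
  obtain h :: "point \<times> point \<Rightarrow> real" where h: "inj h" using second_countable_inject_real by blast
  define E where "E p = f (h ((\<lambda>i. if i < k then frac (fst p i) else 0), snd p))" for p
  have frac: "frac x = frac y \<longleftrightarrow> x - y \<in> \<int>" for x y :: real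
  proof
    assume "frac x = frac y"
    then have "x - y = of_int (\<lfloor>x\<rfloor> - \<lfloor>y\<rfloor>)" by (simp add: frac_def)
    then show "x - y \<in> \<int>" by (metis Ints_of_int)
  next
    assume "x - y \<in> \<int>"
    then obtain n where "x = y + of_int n" by (metis Ints_cases add.commute diff_add_cancel)
    then show "frac x = frac y" by (simp add: frac_def)
  qed
  have "E p = E q \<longleftrightarrow> (\<forall>i<k. fst p i - fst q i \<in> \<int>) \<and> snd p = snd q" for p q
  proof -
    have "E p = E q \<longleftrightarrow> ((\<lambda>i. if i < k then frac (fst p i) else 0) = (\<lambda>i. if i < k then frac (fst q i)
        else 0)) \<and> snd p = snd q"
      unfolding E_def using f h by (simp add: inj_eq)
    also have "\<dots> \<longleftrightarrow> (\<forall>i<k. frac (fst p i) = frac (fst q i)) \<and> snd p = snd q"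
      by (auto simp: fun_eq_iff)
    finally show ?thesis unfolding frac .
  qed
  then have "torus_cover k l E" by unfold_locales
  then show ?thesis by blast
qed

theorem corollary2p14:
  fixes k l :: nat and r s :: smoothness
  assumes "s \<le> r"
    and "\<exists>f :: real \<Rightarrow> 'a. inj f"
  shows "\<exists>\<mu> \<in> (solenoids k l r s :: ('a set \<times> 'a foliated) set set).
           \<forall>\<sigma> \<in> solenoids k l r s. solenoid_le \<sigma> \<mu> \<longrightarrow> \<sigma> = \<mu>"
proof -
  obtain E :: "point \<times> point \<Rightarrow> 'a" where "torus_cover k l E" using torus_cover_exists[OF assms(2)]
      by blast
  then interpret T: torus_cover k l E .
  define R where "R = (solenoid_equiv k l r s :: (('a set \<times> 'a foliated) \<times> ('a set \<times> 'a foliated)) set)"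
  have equiv: "equiv (Collect (pre_solenoid k l r s)) R" unfolding R_def by (rule equiv_solenoid_equiv)
  define \<mu> where "\<mu> = R `` {(T.core, T.torus_foliation)}"
  have \<mu>: "\<mu> \<in> solenoids k l r s"
    unfolding solenoids_def \<mu>_def R_def using T.pre_solenoid_core by (intro quotientI) simp
  have "\<sigma> = \<mu>" if \<sigma>: "\<sigma> \<in> solenoids k l r s" and le: "solenoid_le \<sigma> \<mu>" for \<sigma>
  proof -
    obtain S S' W \<L> where SW: "(S, W) \<in> \<sigma>" "(S', W) \<in> \<mu>" "S \<subseteq> S'"
      and \<L>0: "\<L> \<subseteq> {L \<in> leaves W. L \<subseteq> S'}" "S = \<Union>\<L>"
      using le unfolding solenoid_le_def by (elim exE conjE) (rule that)
    then have \<L>: "\<L> \<subseteq> leaves W" "S = \<Union>\<L>" by blast+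
    \<comment> \<open>\<open>W\<close> defines the structure of \<open>\<mu>\<close>, so it is related to the torus by a germ of diffeomorphism only.\<close>
    have S': "S' = T.core" "germ_iso k l r s T.core T.torus_foliation W" "pre_solenoid k l r s (S', W)"
      using SW(2) by (auto simp: \<mu>_def R_def solenoid_equiv_iff)
    have "pre_solenoid k l r s (S, W)"
      using SW(1) \<sigma> equiv unfolding solenoids_def R_def
      by (metis in_quotient_imp_subset mem_Collect_eq subsetD)
    then have "S \<noteq> {}" by (rule pre_solenoidD)
    then obtain L x where L: "L \<in> \<L>" "x \<in> L" using \<L>(2) by blast
    then obtain y where y: "L = leaf_through W y" using \<L>(1) by (auto simp: leaves_def)
    have "y \<in> L" by (simp add: y leaf_through_def)
    then have yS: "y \<in> T.core" using L(1) SW(3) \<L>(2) S'(1) by blast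
    have "T.core \<subseteq> L"
    proof
      fix z assume z: "z \<in> T.core"
      obtain \<gamma> where \<gamma>: "continuous_map euclideanreal T.torus_top \<gamma>" "range \<gamma> \<subseteq> T.core" "\<gamma> 0 = y"
          "\<gamma> 1 = z"
        using T.path_in_core[OF yS z] .
      have "\<gamma> 1 \<in> leaf_through W (\<gamma> 0)"
      proof (rule leaf_contains_path_connected[OF T.foliated_torus pre_solenoidD(1)[OF S'(3)] S'(2) _ _
          \<gamma>(2)])
        show "snd (\<phi> p) = (\<lambda>_. 0)" if "(U, \<phi>) \<in> fol_atlas T.torus_foliation" "p \<in> T.core \<inter> U" for U \<phi> p
          using T.core_iff_flat[OF that(1)] that(2) by blast
        show "continuous_map euclideanreal (fol_top T.torus_foliation) \<gamma>"
            using \<gamma>(1) by (simp add: T.torus_foliation_def)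
      qed
      then show "z \<in> L" using \<gamma>(3,4) y by simp
    qed
    then have "S = S'" using L(1) SW(3) \<L>(2) S'(1) by blast
    then have "\<sigma> \<inter> \<mu> \<noteq> {}" using SW(1,2) by blast
    then show ?thesis
      using quotient_disj[OF equiv, of \<sigma> \<mu>] \<sigma> \<mu> unfolding solenoids_def R_def by blast
  qed
  with \<mu> show ?thesis by blast
qed

end
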